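(* For $n\in\mathbb{N}$, let $r_1=r_1(n)=\left(\frac{\sqrt{3}\,n}{2\pi}\right)^{1/2}$ and $r_2=r_2(n)=\left(\frac{n}{\pi}\right)^{1/2}$. Let $D_1(n)$ be the set of points of $L_\Delta$ lying in the disk of radius $r_1$ centered at the origin, and let $D_2(n)$ be the set of points of $L_\Box$ lying in the disk of radius $r_2$ centered at the origin. Let $k_1=k_1(n)$ and $k_2=k_2(n)$ be the numbers of distinct distances determined by $D_1(n)$ and $D_2(n)$, respectively. Then, as $n\to\infty$, both $D_1(n)$ and $D_2(n)$ contain $n+o(n)$ points, and $$k_1=c'\,\frac{2\sqrt{3}\,n}{\pi\sqrt{\log n}}\,(1+o(1)),\qquad k_2=c\,\frac{4n}{\pi\sqrt{\log n}}\,(1+o(1)),$$ and consequently $$\frac{k_1}{k_2}=\frac{\sqrt{3}}{2}\cdot\frac{c'}{c}+o(1).$$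
   Context: $L_\Delta=\left\{\left(a+\tfrac12 b,\tfrac{\sqrt3}{2}b\right): a,b\in\mathbb{Z}\right\}$ is the triangular lattice and $L_\Box=\{(a,b):a,b\in\mathbb{Z}\}$ is the integer lattice in $\mathbb{R}^2$. The number of distinct distances determined by a finite set $E\subseteq\mathbb{R}^2$ is the cardinality of $\{\|P-Q\| : P,Q\in E,\ P\neq Q\}$, where $\|\cdot\|$ is the Euclidean norm (the value $0$ is not counted). The constants are $$c=\left(\frac12\prod_{p\equiv 3\ (\mathrm{mod}\ 4)}\frac{p^2}{p^2-1}\right)^{1/2},\qquad c'=\left(\frac{1}{2\sqrt3}\prod_{p\equiv 2\ (\mathrm{mod}\ 3)}\frac{p^2}{p^2-1}\right)^{1/2},$$ where the products run over primes $p$ in the indicated residue classes. The constant $c$ is the Landau-Ramanujan constant. It is known that, as $N\to\infty$, the number of integers $1\le m\le N$ of the form $a^2+b^2$ with $a,b\in\mathbb{Z}$ is $cN/\sqrt{\log N}\,(1+o(1))$, and the number of integers $1\le m\le N$ of the form $a^2+ab+b^2$ with $a,b\in\mathbb{Z}$ is $c'N/\sqrt{\log N}\,(1+o(1))$. *)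

theory Defs
  imports
    "HOL-Analysis.Analysis"
    "HOL-Library.Landau_Symbols"
    "HOL-Computational_Algebra.Primes"
begin

(* The plane is real \<times> real, whose library norm is the Euclidean one. *)

definition tri_lattice :: "(real \<times> real) set" where
  "tri_lattice = {(of_int a + 1 / 2 * of_int b, sqrt 3 / 2 * of_int b) | a b :: int. True}"

definition int_lattice :: "(real \<times> real) set" where
  "int_lattice = {(of_int a, of_int b) | a b :: int. True}"

definition num_distances :: "(real \<times> real) set \<Rightarrow> nat" where
  "num_distances E = card {norm (P - Q) | P Q. P \<in> E \<and> Q \<in> E \<and> P \<noteq> Q}"

(* Products over the primes of a residue class are written as products over all
   natural numbers with factor 1 at the remaining indices. *)

definition landau_ramanujan_const :: real where
  "landau_ramanujan_const =
     sqrt (1 / 2 * (\<Prod>p. if prime p \<and> p mod 4 = 3 then (real p)\<^sup>2 / ((real p)\<^sup>2 - 1) else 1))"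

definition tri_const :: real where
  "tri_const =
     sqrt (1 / (2 * sqrt 3) *
       (\<Prod>p. if prime p \<and> p mod 3 = 2 then (real p)\<^sup>2 / ((real p)\<^sup>2 - 1) else 1))"

definition r1 :: "nat \<Rightarrow> real" where
  "r1 n = sqrt (sqrt 3 * real n / (2 * pi))"

definition r2 :: "nat \<Rightarrow> real" where
  "r2 n = sqrt (real n / pi)"

definition D1 :: "nat \<Rightarrow> (real \<times> real) set" where
  "D1 n = tri_lattice \<inter> cball 0 (r1 n)"

definition D2 :: "nat \<Rightarrow> (real \<times> real) set" where
  "D2 n = int_lattice \<inter> cball 0 (r2 n)"

definition k1 :: "nat \<Rightarrow> nat" where
  "k1 n = num_distances (D1 n)"

definition k2 :: "nat \<Rightarrow> nat" where
  "k2 n = num_distances (D2 n)"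

end

theory Submission
  imports Defs "HOL-Number_Theory.Number_Theory" "HOL-Real_Asymp.Real_Asymp"
begin

text \<open>Bricks tile the plane along either lattice, so a disc of radius \<open>\<rho>\<close> contains (area / cell area)
  \<open>+ O(\<rho>)\<close> lattice points. A lattice vector of length at most \<open>2\<rho> - 2\<close> is a difference of two lattice
  points of the disc (round its half), so the number of distances lies between the numbers of values of
  the quadratic form up to \<open>(2\<rho> - 2)\<^sup>2\<close> and up to \<open>4\<rho>\<^sup>2\<close>. It remains to prove the theorem of Landau
  for both forms.

  Let \<open>\<chi>\<close> be the character modulo 4 or 3 and \<open>r = 1 * \<chi>\<close>, whose partial sums are
  \<open>L(1, \<chi>) x + O(\<surd>x)\<close>. By the method of Tatuzawa and Iseki this alone yields Chebyshev's bound, Mertens'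
  theorem and Selberg's formula for \<open>l = \<Lambda>(1 + \<chi>)\<close>. If \<open>f\<close> is the indicator of the values of the form
  and \<open>B\<close> its summatory function, then \<open>B(x) ln x = \<Sum> l(n) B(x/n) / 2 + O(x)\<close>. Iterating this once and using
  Selberg's formula, two thirds of the main term of \<open>B(x) (ln x)\<^sup>2\<close> become a logarithmic mean of \<open>f\<close>, known
  from the Euler product and Karamata's theorem, and the last third is an average of \<open>B\<close> itself. Hence the
  asymptotic oscillation of \<open>B(x) \<surd>(ln x) / x\<close> about the expected limit is at most a third of itself, so it
  vanishes. Neither the prime number theorem nor complex analysis is needed.\<close>

section \<open>Sums over real ranges\<close>

text \<open>The factor 1/2 reflects that the square of the Dirichlet series of \<open>f\<close> is
  that of \<open>r\<close> times an Euler product converging at s = 1, so \<open>l / 2\<close> acts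
  for \<open>f\<close> as the von Mangoldt function acts for the constant 1. Used alone, the
  relation for B(x) ln x determines nothing: with B(y) about c y / sqrt(ln y), its right side
  reproduces the main term with factor exactly 1, so deviations are not damped; read as a sum of
  f(m) psi(x/m), it would call for psi(x) ~ x. Iterating creates the weights of Selberg's formula.
  In units of c x (ln x)^(3/2), the logarithmic mean then enters as 1/2 * 4/3 and the average of
  \<open>B\<close> as 1/4 * 4/3, where 4/3 = Beta(1/2, 2) both times; the latter, 1/3, is the
  contraction ratio. Karamata's theorem is used with the tent weight ln(x/n), which is what
  Selberg's formula produces and which, unlike a sharp cutoff, is continuous. The limit is sqrt(L G
  / pi) with L = L(1, chi) and G the value of the quotient's Euler product at s = 1, where the
  ramified prime supplies a factor 2 or 3/2.\<close>

definition nats_upto :: "real \<Rightarrow> nat set" where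
  "nats_upto x = {n. 1 \<le> n \<and> real n \<le> x}"

lemma nats_upto_eq: "nats_upto x = {1..nat \<lfloor>x\<rfloor>}"
proof -
  have "real n \<le> x \<longleftrightarrow> n \<le> nat \<lfloor>x\<rfloor>" if "1 \<le> n" for n
    using that le_nat_floor[of n x] by linarith
  thus ?thesis by (auto simp: nats_upto_def)
qed

lemma finite_nats_upto [simp, intro]: "finite (nats_upto x)"
  by (simp add: nats_upto_eq)

lemma mem_nats_upto: "n \<in> nats_upto x \<longleftrightarrow> 0 < n \<and> real n \<le> x"
  by (auto simp: nats_upto_def)

lemma nats_upto_mono: "x \<le> y \<Longrightarrow> nats_upto x \<subseteq> nats_upto y"
  by (auto simp: nats_upto_def)

lemma nats_upto_of_nat [simp]: "nats_upto (real n) = {1..n}"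
  by (auto simp: nats_upto_def)

lemma nats_upto_empty: "x < 1 \<Longrightarrow> nats_upto x = {}"
  by (auto simp: nats_upto_def)

lemma card_nats_upto_le: "x \<ge> 0 \<Longrightarrow> real (card (nats_upto x)) \<le> x"
  by (simp add: nats_upto_eq)

text \<open>Both sides run over the hyperbola region \<open>n * m \<le> x\<close>, which is
  symmetric in n and m.\<close>

lemma sum_nats_upto_swap:
  "(\<Sum>n\<in>nats_upto x. \<Sum>m\<in>nats_upto (x / real n). g n m)
    = (\<Sum>m\<in>nats_upto x. \<Sum>n\<in>nats_upto (x / real m). g n m)"
proof -
  have *: "(SIGMA n:nats_upto x. nats_upto (x / real n)) = {(n, m). 0 < n \<and> 0 < m \<and> real n * real m \<le> x}"
  proof -
    have "real n \<le> x" if "0 < m" "real n * real m \<le> x" for n m :: nat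
      using that mult_left_mono[of 1 "real m" "real n"] by simp
    thus ?thesis by (auto simp: mem_nats_upto field_simps)
  qed
  have "(\<Sum>n\<in>nats_upto x. \<Sum>m\<in>nats_upto (x / real n). g n m)
    = (\<Sum>(n, m)\<in>{(n, m). 0 < n \<and> 0 < m \<and> real n * real m \<le> x}. g n m)"
    by (subst sum.Sigma) (auto simp: *)
  also have "\<dots> = (\<Sum>(m, n)\<in>{(n, m). 0 < n \<and> 0 < m \<and> real n * real m \<le> x}. g n m)"
    by (rule sum.reindex_bij_witness[where i = prod.swap and j = prod.swap]) (auto simp: mult.commute)
  also have "\<dots> = (\<Sum>m\<in>nats_upto x. \<Sum>n\<in>nats_upto (x / real m). g n m)"
    by (subst sum.Sigma) (auto simp: *)
  finally show ?thesis .
qed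

lemma sum_nats_upto_divisors:
  "(\<Sum>k\<in>nats_upto x. \<Sum>d | d dvd k. g d (k div d))
    = (\<Sum>n\<in>nats_upto x. \<Sum>m\<in>nats_upto (x / real n). g n m)"
proof -
  have "(\<Sum>k\<in>nats_upto x. \<Sum>d | d dvd k. g d (k div d))
      = (\<Sum>(k, d)\<in>(SIGMA k:nats_upto x. {d. d dvd k}). g d (k div d))"
    by (subst sum.Sigma) (auto simp: mem_nats_upto)
  also have "\<dots> = (\<Sum>(n, m)\<in>(SIGMA n:nats_upto x. nats_upto (x / real n)). g n m)"
  proof (rule sum.reindex_bij_witness[where i = "\<lambda>(n, m). (n * m, n)" and j = "\<lambda>(k, d). (d, k div d)"])
    fix a assume "a \<in> (SIGMA k:nats_upto x. {d. d dvd k})"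
    then obtain k d where a: "a = (k, d)" "0 < k" "real k \<le> x" "d dvd k"
      by (auto simp: mem_nats_upto)
    then obtain e where e: "k = d * e" by auto
    have "d > 0" "e > 0" using a e by auto
    moreover have "real d \<le> real d * real e" using \<open>e > 0\<close> mult_left_mono[of 1 "real e" "real d"] by simp
    ultimately show "(case a of (k, d) \<Rightarrow> (d, k div d)) \<in> (SIGMA n:nats_upto x. nats_upto (x / real n))"
      using a e order.trans[of "real d" "real d * real e" x] by (auto simp: mem_nats_upto field_simps)
  next
    fix b assume "b \<in> (SIGMA n:nats_upto x. nats_upto (x / real n))"
    then show "(case b of (n, m) \<Rightarrow> (n * m, n)) \<in> (SIGMA k:nats_upto x. {d. d dvd k})"
      by (auto simp: mem_nats_upto field_simps)
  qed (auto simp: mem_nats_upto)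
  also have "\<dots> = (\<Sum>n\<in>nats_upto x. \<Sum>m\<in>nats_upto (x / real n). g n m)"
    by (subst sum.Sigma) auto
  finally show ?thesis .
qed

text \<open>Dirichlet convolution is compatible with its action on functions of a real variable:
  acting by the convolution of \<open>a\<close> and \<open>b\<close> is acting by \<open>b\<close>
  and then by \<open>a\<close>. The inversion by \<open>h\<close> and Selberg's twist rest on
  this.\<close>

lemma sum_nats_upto_conv:
  fixes a b c :: "_ \<Rightarrow> real"
  shows "(\<Sum>k\<in>nats_upto x. (\<Sum>d | d dvd k. a d * b (k div d)) * c (x / real k))
    = (\<Sum>n\<in>nats_upto x. a n * (\<Sum>m\<in>nats_upto (x / real n). b m * c (x / real n / real m)))"
proof -
  have "(\<Sum>k\<in>nats_upto x. (\<Sum>d | d dvd k. a d * b (k div d)) * c (x / real k))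
      = (\<Sum>k\<in>nats_upto x. \<Sum>d | d dvd k. a d * b (k div d) * c (x / (real d * real (k div d))))"
    by (auto intro!: sum.cong simp: sum_distrib_right simp flip: of_nat_mult)
  also have "\<dots> = (\<Sum>n\<in>nats_upto x. \<Sum>m\<in>nats_upto (x / real n). a n * b m * c (x / (real n * real m)))"
    by (rule sum_nats_upto_divisors)
  finally show ?thesis by (simp add: sum_distrib_left mult.assoc)
qed

section \<open>Linear bounds for sums with power and logarithmic weights\<close>

lemma ln_le_powr: "ln x \<le> x powr a / a" if "x > 0" "a > 0" for x a :: real
proof -
  have "a * ln x \<le> x powr a"
    using ln_le_minus_one[of "x powr a"] that by (simp add: ln_powr)
  thus ?thesis using that by (simp add: field_simps)
qed

lemma sqrt_le_self: "sqrt x \<le> x" if "x \<ge> 1" for x :: real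
  using mult_left_mono[of 1 "sqrt x" "sqrt x"] that by simp

text \<open>Puts a power into the form of a sum of nonnegative weights over
  \<open>j \<le> x\<close>, the kind of majorant that \<open>sum_weight_bound\<close>
  accepts.\<close>

lemma powr_le_sum_powr:
  assumes "x \<ge> 1" shows "x powr (3/4) \<le> 2 * (\<Sum>j\<in>nats_upto x. real j powr (-1/4))"
proof -
  \<comment> \<open>For x >= 1 the floor of x is at least x / 2; this costs the factor 2.\<close>
  have card: "x \<le> 2 * real (card (nats_upto x))"
  proof -
    have "1 \<le> \<lfloor>x\<rfloor>" using assms by simp
    hence "1 \<le> real_of_int \<lfloor>x\<rfloor>" "real (nat \<lfloor>x\<rfloor>) = real_of_int \<lfloor>x\<rfloor>" by simp_all
    moreover have "x < real_of_int \<lfloor>x\<rfloor> + 1" by linarith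
    ultimately have "x \<le> 2 * real (nat \<lfloor>x\<rfloor>)" by linarith
    thus ?thesis by (simp add: nats_upto_eq)
  qed
  have "x powr (3/4) = x * x powr (-1/4)"
    using assms by (simp add: powr_mult_base)
  also have "\<dots> \<le> 2 * real (card (nats_upto x)) * x powr (-1/4)"
    using card by (intro mult_right_mono) auto
  also have "\<dots> = 2 * (\<Sum>j\<in>nats_upto x. x powr (-1/4))"
    by simp
  also have "\<dots> \<le> 2 * (\<Sum>j\<in>nats_upto x. real j powr (-1/4))"
    by (intro mult_left_mono sum_mono powr_mono2') (auto simp: mem_nats_upto)
  finally show ?thesis .
qed

text \<open>Takes the place of partial summation: once W(x/n) is majorized by a sum over j <= x/n,
  exchanging the sums leaves partial sums of \<open>a\<close> up to x/j, each at most K x / j, and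
  the series of w j / j converges.\<close>

lemma sum_weight_bound:
  fixes a w :: "nat \<Rightarrow> real" and W :: "real \<Rightarrow> real"
  assumes a: "\<And>n. a n \<ge> 0" and w: "\<And>n. w n \<ge> 0"
    and A: "\<And>x. x \<ge> 1 \<Longrightarrow> (\<Sum>n\<in>nats_upto x. a n) \<le> K * x"
    and W: "\<And>x. x \<ge> 1 \<Longrightarrow> W x \<le> (\<Sum>j\<in>nats_upto x. w j)"
    and s: "summable (\<lambda>j. w j / real j)"
    and K: "K \<ge> 0" and x: "x \<ge> 0"
  shows "(\<Sum>n\<in>nats_upto x. a n * W (x / real n)) \<le> K * (\<Sum>j. w j / real j) * x"
proof -
  have "(\<Sum>n\<in>nats_upto x. a n * W (x / real n)) \<le> (\<Sum>n\<in>nats_upto x. a n * (\<Sum>j\<in>nats_upto (x / real n). w j))"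
    by (intro sum_mono mult_left_mono W a) (auto simp: mem_nats_upto field_simps)
  also have "\<dots> = (\<Sum>j\<in>nats_upto x. w j * (\<Sum>n\<in>nats_upto (x / real j). a n))"
    unfolding sum_distrib_left
    by (subst sum_nats_upto_swap) (simp add: mult.commute)
  also have "\<dots> \<le> (\<Sum>j\<in>nats_upto x. w j * (K * (x / real j)))"
    by (intro sum_mono mult_left_mono A w) (auto simp: mem_nats_upto field_simps)
  also have "\<dots> = K * x * (\<Sum>j\<in>nats_upto x. w j / real j)"
    by (simp add: sum_distrib_left mult_ac)
  also have "\<dots> \<le> K * x * (\<Sum>j. w j / real j)"
    by (intro mult_left_mono sum_le_suminf s) (auto simp: w K x)
  finally show ?thesis by (simp add: mult_ac)
qed

text \<open>The exponent 3/4 = 1/2 + 1/8 + 1/8 leaves room for a square-root error term and two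
  logarithms; being below 1, it still makes the series of \<open>j powr (-5/4)\<close>
  converge.\<close>

lemma sum_powr_weight_bound:
  fixes a :: "nat \<Rightarrow> real"
  assumes a: "\<And>n. a n \<ge> 0"
    and A: "\<And>x. x \<ge> 1 \<Longrightarrow> (\<Sum>n\<in>nats_upto x. a n) \<le> K * x" and K: "K \<ge> 0"
  obtains K' where "K' > 0" "\<And>x. x \<ge> 0 \<Longrightarrow> (\<Sum>n\<in>nats_upto x. a n * (x / real n) powr (3/4)) \<le> K' * x"
proof -
  have s: "summable (\<lambda>j. (2 * real j powr (-1/4)) / real j)"
  proof -
    have "summable (\<lambda>j. 2 * real j powr (-5/4))"
      by (intro summable_mult) (simp add: summable_real_powr_iff)
    also have "(\<lambda>j. 2 * real j powr (-5/4)) = (\<lambda>j. (2 * real j powr (-1/4)) / real j)"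
    proof
      fix j show "2 * real j powr (-5/4) = (2 * real j powr (-1/4)) / real j"
        by (cases "j = 0") (simp_all add: powr_diff[of "real j" "-1/4" 1, simplified])
    qed
    finally show ?thesis .
  qed
  define K' where "K' = \<bar>K * (\<Sum>j. 2 * real j powr (-1/4) / real j)\<bar> + 1"
  show ?thesis
  proof (rule that)
    show "K' > 0" unfolding K'_def by simp
    fix x :: real assume x: "x \<ge> 0"
    have "(\<Sum>n\<in>nats_upto x. a n * (x / real n) powr (3/4)) \<le> K * (\<Sum>j. 2 * real j powr (-1/4) / real j) * x"
      by (rule sum_weight_bound[where w = "\<lambda>j. 2 * real j powr (-1/4)" and W = "\<lambda>x. x powr (3/4)"])
         (use a A K s x powr_le_sum_powr in \<open>auto simp: sum_distrib_left\<close>)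
    also have "\<dots> \<le> K' * x" unfolding K'_def by (intro mult_right_mono x) auto
    finally show "(\<Sum>n\<in>nats_upto x. a n * (x / real n) powr (3/4)) \<le> K' * x" .
  qed
qed

lemma sum_ln_weight_bound:
  fixes a :: "nat \<Rightarrow> real"
  assumes a: "\<And>n. a n \<ge> 0"
    and A: "\<And>x. x \<ge> 1 \<Longrightarrow> (\<Sum>n\<in>nats_upto x. a n) \<le> K * x" and K: "K \<ge> 0"
  obtains K' where "K' > 0" "\<And>x. x \<ge> 0 \<Longrightarrow> (\<Sum>n\<in>nats_upto x. a n * ln (x / real n)) \<le> K' * x"
proof -
  obtain K' where K': "K' > 0" "\<And>x. x \<ge> 0 \<Longrightarrow> (\<Sum>n\<in>nats_upto x. a n * (x / real n) powr (3/4)) \<le> K' * x"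
    using sum_powr_weight_bound[OF a A K] by blast
  show ?thesis
  proof (rule that[of "4 * K'"])
    fix x :: real assume x: "x \<ge> 0"
    have "(\<Sum>n\<in>nats_upto x. a n * ln (x / real n)) \<le> (\<Sum>n\<in>nats_upto x. 4 * (a n * (x / real n) powr (3/4)))"
    proof (rule sum_mono)
      fix n assume "n \<in> nats_upto x"
      hence n: "x / real n \<ge> 1" by (auto simp: mem_nats_upto)
      have "ln (x / real n) \<le> 4 * (x / real n) powr (1/4)" using n ln_le_powr[of "x / real n" "1/4"] by simp
      also have "\<dots> \<le> 4 * (x / real n) powr (3/4)" using n by (intro mult_left_mono powr_mono) auto
      finally have "a n * ln (x / real n) \<le> a n * (4 * (x / real n) powr (3/4))"
        by (intro mult_left_mono a)
      thus "a n * ln (x / real n) \<le> 4 * (a n * (x / real n) powr (3/4))" by simp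
    qed
    also have "\<dots> \<le> 4 * K' * x" using K'(2)[OF x] by (simp flip: sum_distrib_left)
    finally show "(\<Sum>n\<in>nats_upto x. a n * ln (x / real n)) \<le> 4 * K' * x" .
  qed (use K' in auto)
qed

section \<open>Chebyshev, Mertens and Selberg for a system with a square-root error term\<close>

text \<open>The input of the Tatuzawa-Iseki method. \<open>l\<close> is the analogue of the von
  Mangoldt function, defined by r ln = r * l, and \<open>h\<close> is the Dirichlet inverse of
  \<open>r\<close>. The model case is r = 1, l = \<Lambda>, h = the Moebius function.\<close>

locale selberg_system =
  fixes r l h :: "nat \<Rightarrow> real" and A K H :: real
  assumes nonneg_r: "r n \<ge> 0"
    and nonneg_l: "l n \<ge> 0"
    and A_pos: "A > 0"
    and K_nonneg: "K \<ge> 0"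
    and H_nonneg: "H \<ge> 0"
    and R_bound: "x \<ge> 1 \<Longrightarrow> \<bar>(\<Sum>n\<in>nats_upto x. r n) - A * x\<bar> \<le> K * sqrt x"
    and conv_ln: "n > 0 \<Longrightarrow> r n * ln (real n) = (\<Sum>d | d dvd n. r d * l (n div d))"
    and conv_inverse: "n > 0 \<Longrightarrow> (\<Sum>d | d dvd n. h d * r (n div d)) = (if n = 1 then 1 else 0)"
    and sum_h_bound: "x \<ge> 1 \<Longrightarrow> (\<Sum>n\<in>nats_upto x. \<bar>h n\<bar>) \<le> H * x"
begin

definition psi :: "real \<Rightarrow> real" where "psi x = (\<Sum>n\<in>nats_upto x. l n)"

definition err :: "nat \<Rightarrow> real" where "err N = (\<Sum>n=1..N. r n) - A * real N"

lemma err_bound: "\<bar>err N\<bar> \<le> K * sqrt (real N)"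
  using R_bound[of "real N"] by (cases "N = 0") (simp_all add: err_def)

lemma err_Suc: "err (Suc N) = err N + r (Suc N) - A"
  by (simp add: err_def algebra_simps)

section \<open>Abel summation for r(n) / n and r(n) ln n\<close>

lemma floor_sandwich:
  assumes "x \<ge> 1"
  obtains N where "N \<ge> 1" "nats_upto x = {1..N}" "real N \<le> x" "x < real N + 1"
proof (rule that[of "nat \<lfloor>x\<rfloor>"])
  show "1 \<le> nat \<lfloor>x\<rfloor>" using assms by linarith
qed (use assms in \<open>auto simp: nats_upto_eq; linarith\<close>)+

text \<open>Partial summation, written as an induction along the integers. The constant
  \<open>B\<close> is the analogue of Euler's constant; only its existence and the rate of
  convergence matter later.\<close>

lemma sum_r_over_n:
  obtains B C where "C \<ge> 0"
    "\<And>x. x \<ge> 1 \<Longrightarrow> \<bar>(\<Sum>n\<in>nats_upto x. r n / real n) - A * ln x - B\<bar> \<le> C / sqrt x"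
proof -
  \<comment> \<open>\<open>t n\<close> is the increment of (sum of r(k)/k) - err(N)/N - A ln N as N
    passes from n + 1 to n + 2.\<close>
  define t where "t n = err (Suc n) / (real (Suc n) * real (Suc (Suc n)))
    + A * (1 / real (Suc (Suc n)) - ln (1 + 1 / real (Suc n)))" for n
  have eq: "(\<Sum>n=1..Suc N. r n / real n)
      = A + err (Suc N) / real (Suc N) + A * ln (real (Suc N)) + (\<Sum>n<N. t n)" for N
  proof (induction N)
    case 0
    show ?case by (simp add: err_def)
  next
    case (Suc N)
    have 1: "real (Suc (Suc N)) = real (Suc N) * (1 + 1 / real (Suc N))" by (simp add: field_simps)
    have 2: "ln (real (Suc (Suc N))) = ln (real (Suc N)) + ln (1 + 1 / real (Suc N))"
      by (subst 1, rule ln_mult_pos) (auto intro: add_pos_nonneg)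
    have 3: "err (Suc N) / real (Suc N) = err (Suc N) / real (Suc (Suc N))
       + err (Suc N) / (real (Suc N) * real (Suc (Suc N)))"
      by (simp add: field_simps del: of_nat_Suc) (simp add: algebra_simps)
    have "(\<Sum>n=1..Suc (Suc N). r n / real n)
      = A + err (Suc N) / real (Suc N) + A * ln (real (Suc N)) + (\<Sum>n<N. t n)
        + r (Suc (Suc N)) / real (Suc (Suc N))"
      using Suc by (simp del: of_nat_Suc)
    also have "\<dots> = A + err (Suc (Suc N)) / real (Suc (Suc N)) + A * ln (real (Suc (Suc N))) + (\<Sum>n<Suc N. t n)"
      unfolding 3 2 t_def sum.lessThan_Suc err_Suc[of "Suc N"]
      by (simp add: add_divide_distrib diff_divide_distrib right_diff_distrib distrib_left del: of_nat_Suc)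
    finally show ?case .
  qed
  define s where "s n = 1 / sqrt (real (Suc n))" for n
  \<comment> \<open>A telescoping majorant for terms of size n^(-3/2), so that the tail of the
    series of \<open>t\<close> is explicitly of order N^(-1/2).\<close>
  have s_term: "1 / (sqrt (real (Suc n)) * real (Suc (Suc n))) \<le> 2 * (s n - s (Suc n))" for n
  proof -
    define a b where "a = sqrt (real (Suc n))" and "b = sqrt (real (Suc (Suc n)))"
    have ab: "a > 0" "b > 0" "a \<le> b" "b * b = real (Suc (Suc n))" "a * a = real (Suc n)"
      by (auto simp: a_def b_def)
    have d: "(b - a) * (b + a) = 1" using ab by (simp add: algebra_simps)
    have "2 * (s n - s (Suc n)) = 2 * (b - a) / (a * b)"
      unfolding s_def a_def[symmetric] b_def[symmetric] using ab by (simp add: field_simps)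
    also have "b - a = 1 / (b + a)" using d ab by (simp add: field_simps)
    also have "2 * (1 / (b + a)) / (a * b) = 2 / ((b + a) * (a * b))" by simp
    finally have *: "2 * (s n - s (Suc n)) = 2 / ((b + a) * (a * b))" .
    have "(b + a) * (a * b) \<le> 2 * (a * (b * b))"
    proof -
      have "(b + a) * (a * b) \<le> (2 * b) * (a * b)" using ab by (intro mult_right_mono) auto
      thus ?thesis by (simp add: mult_ac)
    qed
    hence "2 / (2 * (a * (b * b))) \<le> 2 / ((b + a) * (a * b))"
      using ab by (intro divide_left_mono) auto
    thus ?thesis unfolding * using ab(4) unfolding a_def by simp
  qed
  have t_bound: "\<bar>t n\<bar> \<le> 2 * (K + A) * (s n - s (Suc n))" for n
  proof -
    define y where "y = real (Suc n)"
    have y: "y \<ge> 1" "y > 0" "real (Suc (Suc n)) = y + 1" by (auto simp: y_def)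
    have sq: "sqrt y * sqrt y = y" "sqrt y > 0" using y by auto
    have 1: "\<bar>err (Suc n) / (y * (y + 1))\<bar> \<le> K * (1 / (sqrt y * (y + 1)))"
    proof -
      have "\<bar>err (Suc n) / (y * (y + 1))\<bar> \<le> K * sqrt y / (y * (y + 1))"
        using err_bound[of "Suc n"] y unfolding abs_divide y_def[symmetric] by (simp add: divide_right_mono)
      also have "\<dots> = K * (sqrt y / y) / (y + 1)" by simp
      also have "sqrt y / y = 1 / sqrt y" using sq y by (simp add: field_simps)
      also have "K * (1 / sqrt y) / (y + 1) = K * (1 / (sqrt y * (y + 1)))" by simp
      finally show ?thesis .
    qed
    have "ln (1 + 1 / y) \<le> 1 / y" using y by (intro ln_add_one_self_le_self) auto
    moreover have "ln (1 + 1 / y) \<ge> 1 / (y + 1)"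
    proof -
      have "1 + 1 / y = inverse (y / (y + 1))" using y by (simp add: field_simps)
      hence "ln (1 + 1 / y) = - ln (y / (y + 1))" using y by (simp only: ln_inverse)
      moreover have "ln (y / (y + 1)) \<le> y / (y + 1) - 1" using y by (intro ln_le_minus_one) auto
      moreover have "y / (y + 1) - 1 = - (1 / (y + 1))" using y by (simp add: field_simps)
      ultimately show ?thesis by linarith
    qed
    moreover have "1 / y - 1 / (y + 1) = 1 / (y * (y + 1))" using y by (simp add: field_simps)
    ultimately have "\<bar>1 / (y + 1) - ln (1 + 1 / y)\<bar> \<le> 1 / (y * (y + 1))" by linarith
    also have "\<dots> \<le> 1 / (sqrt y * (y + 1))"
    proof -
      have "sqrt y \<le> y" using y by (auto intro: sqrt_le_self)
      thus ?thesis using y sq by (intro divide_left_mono mult_right_mono) auto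
    qed
    finally have 2: "\<bar>A * (1 / (y + 1) - ln (1 + 1 / y))\<bar> \<le> A * (1 / (sqrt y * (y + 1)))"
      unfolding abs_mult using A_pos by (intro mult_mono) auto
    have "\<bar>t n\<bar> \<le> (K + A) * (1 / (sqrt y * (y + 1)))"
      unfolding t_def y(3) y_def[symmetric] distrib_right[of K A] using 1 2 by linarith
    also have "\<dots> \<le> (K + A) * (2 * (s n - s (Suc n)))"
      using s_term[of n] K_nonneg A_pos unfolding y(3) y_def[symmetric] by (intro mult_left_mono) auto
    finally show ?thesis by (simp only: mult_ac)
  qed
  have s_lim: "s \<longlonglongrightarrow> 0" unfolding s_def by real_asymp
  have s_sums: "(\<lambda>n. 2 * (K + A) * (s (n + N) - s (Suc n + N))) sums (2 * (K + A) * s N)" for N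
    using sums_mult[OF telescope_sums'[of "\<lambda>n. s (n + N)" 0], of "2 * (K + A)"] LIMSEQ_ignore_initial_segment[OF s_lim, of N]
    by simp
  have t_summable: "summable t"
    using s_sums[of 0] by (intro summable_comparison_test[of t "\<lambda>n. 2 * (K + A) * (s n - s (Suc n))"])
      (use t_bound in \<open>auto simp: sums_iff\<close>)
  have tail: "\<bar>(\<Sum>n<N. t n) - suminf t\<bar> \<le> 2 * (K + A) * s N" for N
  proof -
    have "\<bar>\<Sum>n. t (n + N)\<bar> \<le> (\<Sum>n. 2 * (K + A) * (s (n + N) - s (Suc n + N)))"
    proof -
      have sm: "summable (\<lambda>n. 2 * (K + A) * (s (n + N) - s (Suc n + N)))" using s_sums[of N] by (simp add: sums_iff)
      have "norm (\<Sum>n. t (n + N)) \<le> (\<Sum>n. 2 * (K + A) * (s (n + N) - s (Suc n + N)))"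
        by (rule norm_suminf_le[OF _ sm]) (use t_bound in auto)
      thus ?thesis by simp
    qed
    also have "\<dots> = 2 * (K + A) * s N" using s_sums[of N] by (simp add: sums_iff)
    finally show ?thesis using suminf_minus_initial_segment[OF t_summable, of N] by simp
  qed
  \<comment> \<open>The summand \<open>A\<close> is the starting value at N = 1, where r(1) = A +
    err(1).\<close>
  define B where "B = A + suminf t"
  define C where "C = 2 * K + 4 * (K + A) + 2 * A"
  show ?thesis
  proof (rule that[of C B])
    show "C \<ge> 0" using K_nonneg A_pos by (simp add: C_def)
    fix x :: real assume x: "x \<ge> 1"
    obtain N where N: "N \<ge> 1" "nats_upto x = {1..N}" "real N \<le> x" "x < real N + 1"
      using floor_sandwich[OF x] by blast
    then obtain M where M: "N = Suc M" by (cases N) auto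
    have sx: "sqrt x > 0" "sqrt x * sqrt x = x" "sqrt x \<le> x" using x by (auto intro: sqrt_le_self)
    have xN: "x \<le> 2 * real N" using N by linarith
    have sxN: "sqrt x \<le> 2 * sqrt (real N)"
      using xN N(1) by (intro real_le_lsqrt) auto
    have invN: "1 / sqrt (real N) \<le> 2 / sqrt x" using sxN sx N(1) by (simp add: field_simps)
    have 1: "\<bar>err N / real N\<bar> \<le> 2 * K / sqrt x"
    proof -
      have "\<bar>err N / real N\<bar> \<le> K * sqrt (real N) / real N"
        using err_bound[of N] by (simp add: abs_divide divide_right_mono)
      also have "\<dots> = K * (1 / sqrt (real N))" using N(1) by (simp add: field_simps)
      also have "\<dots> \<le> K * (2 / sqrt x)" by (intro mult_left_mono invN K_nonneg)
      finally show ?thesis by (simp add: mult.commute)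
    qed
    have 2: "\<bar>(\<Sum>n<M. t n) - suminf t\<bar> \<le> 4 * (K + A) / sqrt x"
    proof -
      have "2 * (K + A) * s M \<le> 2 * (K + A) * (2 / sqrt x)"
        unfolding s_def M[symmetric] using K_nonneg A_pos by (intro mult_left_mono invN) auto
      also have "2 * (K + A) * (2 / sqrt x) = 4 * (K + A) / sqrt x" by simp
      finally show ?thesis using tail[of M] by linarith
    qed
    \<comment> \<open>The price of moving from the integer N to the real x with N <= x < N +
      1.\<close>
    have 3: "\<bar>ln x - ln (real N)\<bar> \<le> 2 / sqrt x"
    proof -
      have "ln x - ln (real N) = ln (x / real N)" using x N by (simp add: ln_div)
      also have "\<dots> \<le> x / real N - 1" using x N by (intro ln_le_minus_one) auto
      also have "\<dots> \<le> (real N + 1) / real N - 1" using N by (intro diff_right_mono divide_right_mono) auto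
      also have "\<dots> = 1 / real N" using N by (simp add: field_simps)
      also have "\<dots> \<le> 2 / x" using xN x N(1) by (simp add: field_simps)
      also have "\<dots> \<le> 2 / sqrt x" using sx x by (intro divide_left_mono) auto
      finally show ?thesis using N x by simp
    qed
    have "(\<Sum>n\<in>nats_upto x. r n / real n) - A * ln x - B
      = err N / real N + ((\<Sum>n<M. t n) - suminf t) - A * (ln x - ln (real N))"
      unfolding N(2) M eq B_def by (simp add: algebra_simps)
    also have "\<bar>\<dots>\<bar> \<le> 2 * K / sqrt x + 4 * (K + A) / sqrt x + A * (2 / sqrt x)"
    proof -
      have "\<bar>A * (ln x - ln (real N))\<bar> \<le> A * (2 / sqrt x)"
        unfolding abs_mult using 3 A_pos by (intro mult_mono) auto
      thus ?thesis using 1 2 by linarith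
    qed
    also have "\<dots> = C / sqrt x" by (simp add: C_def add_divide_distrib)
    finally show "\<bar>(\<Sum>n\<in>nats_upto x. r n / real n) - A * ln x - B\<bar> \<le> C / sqrt x" .
  qed
qed


lemma sum_inverse_sqrt_le: "(\<Sum>n=1..N. 1 / sqrt (real n)) \<le> 2 * sqrt (real N)"
proof (induction N)
  case (Suc N)
  define a b where "a = sqrt (real N)" and "b = sqrt (real (Suc N))"
  have ab: "a \<ge> 0" "b > 0" "a \<le> b" "b * b = real N + 1" "a * a = real N" by (auto simp: a_def b_def)
  have "2 * a * b \<le> a * a + b * b" using zero_le_square[of "a - b"] by (simp add: algebra_simps)
  hence "2 * a * b + 1 \<le> 2 * b * b" using ab by simp
  hence "2 * a + 1 / b \<le> 2 * b" using ab by (simp add: field_simps)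
  thus ?case using Suc by (simp add: a_def b_def)
qed auto

text \<open>Partial summation leaves an error of order sqrt x * ln x, which is absorbed into x^(5/8)
  through ln x <= 8 x^(1/8).\<close>

lemma sum_r_ln:
  obtains C where "C \<ge> 0"
    "\<And>x. x \<ge> 1 \<Longrightarrow> \<bar>(\<Sum>n\<in>nats_upto x. r n * ln (real n)) - A * (x * ln x - x)\<bar> \<le> C * x powr (5/8)"
proof -
  \<comment> \<open>The first term comes from \<open>err\<close> against the increments of the
    logarithm, the second from comparing A times the sum of ln n with A (N ln N - N).\<close>
  define t where "t n = - err n * ln (1 + 1 / real n) - A * (real n * ln (1 + 1 / real n) - 1)" for n
  have eq: "(\<Sum>n=1..Suc N. r n * ln (real n))
      = A * (real (Suc N) * ln (real (Suc N)) - real (Suc N)) + A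
        + err (Suc N) * ln (real (Suc N)) + (\<Sum>n=1..N. t n)" for N
  proof (induction N)
    case (Suc N)
    have 1: "real (Suc (Suc N)) = real (Suc N) * (1 + 1 / real (Suc N))" by (simp add: field_simps)
    have 2: "ln (1 + 1 / real (Suc N)) = ln (real (Suc (Suc N))) - ln (real (Suc N))"
      by (subst 1, subst ln_mult_pos) (auto intro: add_pos_nonneg)
    have 3: "t (Suc N) = - err (Suc N) * (ln (real (Suc (Suc N))) - ln (real (Suc N)))
       - A * (real (Suc N) * (ln (real (Suc (Suc N))) - ln (real (Suc N))) - 1)"
      unfolding t_def 2 ..
    have "(\<Sum>n=1..Suc (Suc N). r n * ln (real n))
      = (A * (real (Suc N) * ln (real (Suc N)) - real (Suc N)) + A
        + err (Suc N) * ln (real (Suc N)) + (\<Sum>n=1..N. t n)) + r (Suc (Suc N)) * ln (real (Suc (Suc N)))"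
      using Suc by (simp del: of_nat_Suc)
    also have "\<dots> = A * (real (Suc (Suc N)) * ln (real (Suc (Suc N))) - real (Suc (Suc N))) + A
        + err (Suc (Suc N)) * ln (real (Suc (Suc N))) + ((\<Sum>n=1..N. t n) + t (Suc N))"
    proof -
      define u v where "u = ln (real (Suc N))" and "v = ln (real (Suc (Suc N)))"
      have e: "real (Suc (Suc N)) = real (Suc N) + 1" by simp
      show ?thesis unfolding 3 err_Suc[of "Suc N"] u_def[symmetric] v_def[symmetric] e
        by (simp add: algebra_simps del: of_nat_Suc)
    qed
    finally show ?case by (simp del: of_nat_Suc)
  qed (simp add: err_def)
  have t_bound: "\<bar>t n\<bar> \<le> (K + A) * (1 / sqrt (real n))" if "n \<ge> 1" for n
  proof -
    define y where "y = real n"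
    have y: "y \<ge> 1" using that by (simp add: y_def)
    have sq: "sqrt y * sqrt y = y" "sqrt y > 0" "sqrt y \<le> y" using y by (auto intro: sqrt_le_self)
    have L: "0 \<le> ln (1 + 1 / y)" "ln (1 + 1 / y) \<le> 1 / y" "ln (1 + 1 / y) \<ge> 1 / y - (1 / y)^2"
      using y ln_add_one_self_le_self[of "1 / y"] ln_one_plus_pos_lower_bound[of "1 / y"] by auto
    have "\<bar>err n * ln (1 + 1 / y)\<bar> \<le> K * sqrt y * (1 / y)"
      unfolding abs_mult using L err_bound[of n] K_nonneg y by (intro mult_mono) (auto simp: y_def)
    also have "\<dots> = K * (1 / sqrt y)" using sq y by (simp add: field_simps)
    finally have 1: "\<bar>err n * ln (1 + 1 / y)\<bar> \<le> K * (1 / sqrt y)" .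
    have "y * ln (1 + 1 / y) \<le> 1" using L(2) y by (simp add: field_simps)
    moreover have "y * ln (1 + 1 / y) \<ge> 1 - 1 / y"
    proof -
      have "1 - 1 / y = y * (1 / y - (1 / y)^2)" using y by (simp add: field_simps power2_eq_square)
      also have "\<dots> \<le> y * ln (1 + 1 / y)" using L(3) y by (intro mult_left_mono) auto
      finally show ?thesis .
    qed
    ultimately have "\<bar>y * ln (1 + 1 / y) - 1\<bar> \<le> 1 / y" by linarith
    also have "\<dots> \<le> 1 / sqrt y" using sq y by (intro divide_left_mono) auto
    finally have 2: "\<bar>A * (y * ln (1 + 1 / y) - 1)\<bar> \<le> A * (1 / sqrt y)"
      unfolding abs_mult using A_pos by (intro mult_mono) auto
    show ?thesis
      unfolding t_def y_def[symmetric] distrib_right[of K A] using 1 2 by linarith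
  qed
  define C where "C = 8 * K + A + 2 * (K + A) + 8 * A"
  show ?thesis
  proof (rule that[of C])
    show "C \<ge> 0" using K_nonneg A_pos by (simp add: C_def)
    fix x :: real assume x: "x \<ge> 1"
    obtain N where N: "N \<ge> 1" "nats_upto x = {1..N}" "real N \<le> x" "x < real N + 1"
      using floor_sandwich[OF x] by blast
    then obtain M where M: "N = Suc M" by (cases N) auto
    define P where "P = x powr (5/8)"
    have P1: "P \<ge> 1" unfolding P_def using x by (simp add: ge_one_powr_ge_zero)
    have lnx: "ln x \<le> 8 * x powr (1/8)" "ln x \<ge> 0" using ln_le_powr[of x "1/8"] x by auto
    have sP: "sqrt x \<le> P" unfolding P_def powr_half_sqrt[symmetric, OF order_trans[OF zero_le_one x]]
      using x by (intro powr_mono) auto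
    have lP: "ln x \<le> 8 * P"
    proof -
      have "x powr (1/8) \<le> P" unfolding P_def using x by (intro powr_mono) auto
      thus ?thesis using lnx by linarith
    qed
    have slP: "sqrt x * ln x \<le> 8 * P"
    proof -
      have "sqrt x * ln x \<le> sqrt x * (8 * x powr (1/8))" using lnx x by (intro mult_left_mono) auto
      also have "\<dots> = 8 * (x powr (1/2) * x powr (1/8))" using x by (simp add: powr_half_sqrt)
      also have "\<dots> = 8 * P" unfolding P_def by (simp flip: powr_add)
      finally show ?thesis .
    qed
    have Nx: "sqrt (real N) \<le> sqrt x" "0 \<le> ln (real N)" "ln (real N) \<le> ln x" using N by auto
    have 1: "\<bar>err N * ln (real N)\<bar> \<le> 8 * K * P"
    proof -
      have "\<bar>err N * ln (real N)\<bar> \<le> (K * sqrt x) * ln x"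
        unfolding abs_mult using err_bound[of N] Nx mult_left_mono[OF Nx(1) K_nonneg] K_nonneg x
        by (intro mult_mono) auto
      thus ?thesis using mult_left_mono[OF slP K_nonneg] by (simp add: mult_ac)
    qed
    have 2: "\<bar>\<Sum>n=1..M. t n\<bar> \<le> 2 * (K + A) * P"
    proof -
      have "\<bar>\<Sum>n=1..M. t n\<bar> \<le> (\<Sum>n=1..M. (K + A) * (1 / sqrt (real n)))"
        using t_bound by (intro order_trans[OF sum_abs] sum_mono) auto
      also have "\<dots> \<le> (K + A) * (2 * sqrt (real M))"
        unfolding sum_distrib_left[symmetric] using K_nonneg A_pos
        by (intro mult_left_mono sum_inverse_sqrt_le) auto
      also have "\<dots> \<le> (K + A) * (2 * P)"
        using K_nonneg A_pos sP N M by (intro mult_left_mono) (auto intro: order_trans[rotated])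
      finally show ?thesis by (simp only: mult_ac)
    qed
    have 3: "\<bar>(real N * ln (real N) - real N) - (x * ln x - x)\<bar> \<le> 8 * P"
    proof -
      define g where "g y = y * ln y - y" for y :: real
      have "g (real N) \<le> g x \<and> g x - g (real N) \<le> ln x"
      proof (cases "real N = x")
        case False
        hence "real N < x" using N by simp
        have "\<exists>z>real N. z < x \<and> g x - g (real N) = (x - real N) * ln z"
          using \<open>real N < x\<close> N(1) by (intro MVT2) (auto simp: g_def intro!: derivative_eq_intros)
        then obtain z where z: "real N < z" "z < x" "g x - g (real N) = (x - real N) * ln z"
          by blast
        have "1 \<le> z" using z(1) N(1) by linarith
        hence "0 \<le> ln z" "ln z \<le> ln x" using z by auto
        hence "0 \<le> (x - real N) * ln z" "(x - real N) * ln z \<le> 1 * ln x"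
          using N z by (intro mult_nonneg_nonneg mult_mono; simp)+
        thus ?thesis using z by linarith
      qed (use lnx in auto)
      thus ?thesis using lP unfolding g_def by linarith
    qed
    have "(\<Sum>n\<in>nats_upto x. r n * ln (real n)) - A * (x * ln x - x)
      = err N * ln (real N) + (\<Sum>n=1..M. t n) + A + A * ((real N * ln (real N) - real N) - (x * ln x - x))"
      unfolding N(2) M eq by (simp add: algebra_simps del: of_nat_Suc)
    also have "\<bar>\<dots>\<bar> \<le> 8 * K * P + 2 * (K + A) * P + A * P + A * (8 * P)"
    proof -
      have "\<bar>A * ((real N * ln (real N) - real N) - (x * ln x - x))\<bar> \<le> A * (8 * P)"
        using 3 A_pos by (simp add: abs_mult mult_left_mono)
      moreover have "A \<le> A * P" using P1 A_pos by simp
      ultimately show ?thesis using 1 2 A_pos by linarith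
    qed
    also have "\<dots> = C * P" by (simp add: C_def algebra_simps)
    finally show "\<bar>(\<Sum>n\<in>nats_upto x. r n * ln (real n)) - A * (x * ln x - x)\<bar> \<le> C * x powr (5/8)"
      unfolding P_def .
  qed
qed

section \<open>The Tatuzawa-Iseki transform and its inversion\<close>

definition inv_sum :: "(real \<Rightarrow> real) \<Rightarrow> real \<Rightarrow> real" where
  "inv_sum F x = (\<Sum>n\<in>nats_upto x. r n * F (x / real n))"

text \<open>Generalized Moebius inversion: the action of \<open>h\<close> undoes that of
  \<open>r\<close> because their convolution is the unit.\<close>

lemma inv_sum_inversion:
  assumes "x \<ge> 1" shows "F x = (\<Sum>d\<in>nats_upto x. h d * inv_sum F (x / real d))"
proof -
  have "(\<Sum>d\<in>nats_upto x. h d * inv_sum F (x / real d))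
      = (\<Sum>k\<in>nats_upto x. (\<Sum>d | d dvd k. h d * r (k div d)) * F (x / real k))"
    unfolding inv_sum_def by (rule sum_nats_upto_conv[symmetric])
  also have "\<dots> = (\<Sum>k\<in>nats_upto x. if k = 1 then F x else 0)"
    by (intro sum.cong refl) (use conv_inverse in \<open>auto simp: mem_nats_upto\<close>)
  also have "\<dots> = F x" using assms by (auto simp: mem_nats_upto)
  finally show ?thesis ..
qed

text \<open>A transform that saves a power of x forces the function itself to be O(x). Only the
  trivial bound for the sums of |h| enters, so no cancellation in \<open>h\<close> has to be
  known.\<close>

lemma inv_sum_bound:
  assumes C: "\<And>x. x \<ge> 1 \<Longrightarrow> \<bar>inv_sum F x\<bar> \<le> C * x powr (3/4)"
  obtains C' where "C' > 0" "\<And>x. x \<ge> 1 \<Longrightarrow> \<bar>F x\<bar> \<le> C' * x"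
proof -
  obtain K' where K': "K' > 0" "\<And>x. x \<ge> 0 \<Longrightarrow> (\<Sum>n\<in>nats_upto x. \<bar>h n\<bar> * (x / real n) powr (3/4)) \<le> K' * x"
    using sum_powr_weight_bound[of "\<lambda>n. \<bar>h n\<bar>" H] sum_h_bound H_nonneg by auto
  have C0: "C \<ge> 0" using C[of 1] by simp
  show ?thesis
  proof (rule that[of "C * K' + 1"])
    show "C * K' + 1 > 0" using C0 K' by (simp add: add_nonneg_pos)
    fix x :: real assume x: "x \<ge> 1"
    have "\<bar>F x\<bar> \<le> (\<Sum>d\<in>nats_upto x. \<bar>h d * inv_sum F (x / real d)\<bar>)"
      unfolding inv_sum_inversion[OF x, of F] by (rule sum_abs)
    also have "\<dots> \<le> (\<Sum>d\<in>nats_upto x. C * (\<bar>h d\<bar> * (x / real d) powr (3/4)))"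
    proof (rule sum_mono)
      fix d assume "d \<in> nats_upto x"
      hence "\<bar>inv_sum F (x / real d)\<bar> \<le> C * (x / real d) powr (3/4)"
        by (intro C) (auto simp: mem_nats_upto field_simps)
      hence "\<bar>h d\<bar> * \<bar>inv_sum F (x / real d)\<bar> \<le> \<bar>h d\<bar> * (C * (x / real d) powr (3/4))"
        by (intro mult_left_mono) auto
      thus "\<bar>h d * inv_sum F (x / real d)\<bar> \<le> C * (\<bar>h d\<bar> * (x / real d) powr (3/4))"
        by (simp add: abs_mult mult_ac)
    qed
    also have "\<dots> \<le> C * (K' * x)"
      unfolding sum_distrib_left[symmetric] using x by (intro mult_left_mono K' C0) auto
    also have "\<dots> \<le> (C * K' + 1) * x" using x by (simp add: algebra_simps)
    finally show "\<bar>F x\<bar> \<le> (C * K' + 1) * x" .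
  qed
qed

text \<open>Chebyshev's identity; for r = 1 it expresses ln N! through psi.\<close>

lemma sum_r_psi: "(\<Sum>n\<in>nats_upto x. r n * psi (x / real n)) = (\<Sum>n\<in>nats_upto x. r n * ln (real n))"
proof -
  have "(\<Sum>n\<in>nats_upto x. r n * psi (x / real n))
     = (\<Sum>k\<in>nats_upto x. (\<Sum>d | d dvd k. r d * l (k div d)) * (\<lambda>_. 1) (x / real k))"
    unfolding psi_def by (subst sum_nats_upto_conv) simp
  also have "\<dots> = (\<Sum>n\<in>nats_upto x. r n * ln (real n))"
    by (intro sum.cong refl) (simp add: conv_ln mem_nats_upto)
  finally show ?thesis .
qed

lemma psi_shifted:
  obtains c C where "C > 0"
    "\<And>x. x \<ge> 1 \<Longrightarrow> \<bar>inv_sum (\<lambda>y. psi y - y + c) x\<bar> \<le> C * x powr (5/8)"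
proof -
  obtain B C1 where 1: "C1 \<ge> 0"
    "\<And>x. x \<ge> 1 \<Longrightarrow> \<bar>(\<Sum>n\<in>nats_upto x. r n / real n) - A * ln x - B\<bar> \<le> C1 / sqrt x"
    by (rule sum_r_over_n) auto
  obtain C2 where 2: "C2 \<ge> 0"
    "\<And>x. x \<ge> 1 \<Longrightarrow> \<bar>(\<Sum>n\<in>nats_upto x. r n * ln (real n)) - A * (x * ln x - x)\<bar> \<le> C2 * x powr (5/8)"
    by (rule sum_r_ln) auto
  \<comment> \<open>Up to O(x^(5/8)) the transforms of psi, y and 1 are A (x ln x - x), x (A ln x +
    B) and A x. This \<open>c\<close> is the constant that cancels the linear terms.\<close>
  define c where "c = 1 + B / A"
  define C where "C = C2 + C1 + \<bar>c\<bar> * K + 1"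
  show ?thesis
  proof (rule that[of C c])
    show "C > 0" unfolding C_def using 1 2 K_nonneg by (intro add_nonneg_pos add_nonneg_nonneg) auto
    fix x :: real assume x: "x \<ge> 1"
    define P where "P = x powr (5/8)"
    have P1: "P \<ge> 0" unfolding P_def by simp
    have sP: "sqrt x \<le> P" unfolding P_def powr_half_sqrt[symmetric, OF order_trans[OF zero_le_one x]]
      using x by (intro powr_mono) auto
    define S0 S1 S2 where "S0 = (\<Sum>n\<in>nats_upto x. r n)" and "S1 = (\<Sum>n\<in>nats_upto x. r n / real n)"
      and "S2 = (\<Sum>n\<in>nats_upto x. r n * ln (real n))"
    have "inv_sum (\<lambda>y. psi y - y + c) x = S2 - x * S1 + c * S0"
      unfolding inv_sum_def S0_def S1_def S2_def sum_r_psi[symmetric]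
      by (simp add: algebra_simps sum.distrib sum_subtractf sum_distrib_left)
    also have "\<dots> = (S2 - A * (x * ln x - x)) - x * (S1 - A * ln x - B) + c * (S0 - A * x)"
      using A_pos by (simp add: c_def algebra_simps)
    also have "\<bar>\<dots>\<bar> \<le> C2 * P + C1 * P + \<bar>c\<bar> * K * P"
    proof -
      have a: "\<bar>S2 - A * (x * ln x - x)\<bar> \<le> C2 * P" using 2(2)[OF x] by (simp add: S2_def P_def)
      have "\<bar>x * (S1 - A * ln x - B)\<bar> \<le> x * (C1 / sqrt x)"
        using 1(2)[OF x] x unfolding S1_def abs_mult by (intro mult_mono) auto
      also have "\<dots> = C1 * sqrt x" using x by (simp add: field_simps)
      also have "\<dots> \<le> C1 * P" by (intro mult_left_mono sP 1)
      finally have b: "\<bar>x * (S1 - A * ln x - B)\<bar> \<le> C1 * P" .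
      have "\<bar>c * (S0 - A * x)\<bar> \<le> \<bar>c\<bar> * (K * sqrt x)"
        using R_bound[OF x] unfolding S0_def abs_mult by (intro mult_left_mono) auto
      also have "\<dots> \<le> \<bar>c\<bar> * (K * P)" by (intro mult_left_mono sP K_nonneg) auto
      finally have d: "\<bar>c * (S0 - A * x)\<bar> \<le> \<bar>c\<bar> * K * P" by simp
      show ?thesis using a b d by linarith
    qed
    also have "\<dots> \<le> C * P" using P1 by (simp add: C_def algebra_simps)
    finally show "\<bar>inv_sum (\<lambda>y. psi y - y + c) x\<bar> \<le> C * x powr (5/8)" unfolding P_def .
  qed
qed


section \<open>Chebyshev's bound, Mertens' theorem and Selberg's formula\<close>

lemma chebyshev:
  obtains C where "C > 0" "\<And>x. x \<ge> 0 \<Longrightarrow> psi x \<le> C * x"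
proof -
  obtain c C0 where C0: "C0 > 0"
    "\<And>x. x \<ge> 1 \<Longrightarrow> \<bar>inv_sum (\<lambda>y. psi y - y + c) x\<bar> \<le> C0 * x powr (5/8)"
    by (rule psi_shifted) auto
  have "\<bar>inv_sum (\<lambda>y. psi y - y + c) x\<bar> \<le> C0 * x powr (3/4)" if "x \<ge> 1" for x
  proof -
    have "x powr (5/8) \<le> x powr (3/4)" using that by (intro powr_mono) auto
    hence "C0 * x powr (5/8) \<le> C0 * x powr (3/4)" using C0(1) by (intro mult_left_mono) auto
    thus ?thesis using C0(2)[OF that] by linarith
  qed
  then obtain C1 where C1: "C1 > 0" "\<And>x. x \<ge> 1 \<Longrightarrow> \<bar>psi x - x + c\<bar> \<le> C1 * x"
    using inv_sum_bound[where F = "\<lambda>y. psi y - y + c"] by blast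
  show ?thesis
  proof (rule that)
    show "C1 + 1 + \<bar>c\<bar> > 0" using C1 by linarith
    fix x :: real assume x: "x \<ge> 0"
    show "psi x \<le> (C1 + 1 + \<bar>c\<bar>) * x"
    proof (cases "x \<ge> 1")
      case True
      have "\<bar>c\<bar> \<le> \<bar>c\<bar> * x" using True mult_left_mono[of 1 x "\<bar>c\<bar>"] by simp
      thus ?thesis using C1(2)[OF True] unfolding distrib_right by linarith
    next
      case False
      thus ?thesis using x C1 by (simp add: psi_def nats_upto_empty)
    qed
  qed
qed

text \<open>The sum of r(n) ln n is evaluated twice: directly, and as a sum of l(m) times the
  partial sum of \<open>r\<close> up to x/m. In the second evaluation the errors sqrt(x/m) add up to
  O(x) by Chebyshev's bound.\<close>

lemma mertens:
  obtains M where "M > 0" "\<And>x. x \<ge> 1 \<Longrightarrow> \<bar>(\<Sum>n\<in>nats_upto x. l n / real n) - ln x\<bar> \<le> M"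
proof -
  obtain C1 where C1: "C1 > 0" "\<And>x. x \<ge> 0 \<Longrightarrow> psi x \<le> C1 * x" by (rule chebyshev) auto
  obtain C2 where C2: "C2 \<ge> 0"
    "\<And>x. x \<ge> 1 \<Longrightarrow> \<bar>(\<Sum>n\<in>nats_upto x. r n * ln (real n)) - A * (x * ln x - x)\<bar> \<le> C2 * x powr (5/8)"
    by (rule sum_r_ln) auto
  obtain C3 where C3: "C3 > 0" "\<And>x. x \<ge> 0 \<Longrightarrow> (\<Sum>n\<in>nats_upto x. l n * (x / real n) powr (3/4)) \<le> C3 * x"
    by (rule sum_powr_weight_bound[of l C1]) (use C1 nonneg_l in \<open>auto simp: psi_def\<close>)
  show ?thesis
  proof (rule that)
    show "(C2 + A + K * C3) / A + 1 > 0" using C2 C3 A_pos K_nonneg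
      by (intro add_nonneg_pos divide_nonneg_pos) auto
    fix x :: real assume x: "x \<ge> 1"
    define S where "S = (\<Sum>n\<in>nats_upto x. l n / real n)"
    have 1: "(\<Sum>n\<in>nats_upto x. r n * ln (real n)) = (\<Sum>m\<in>nats_upto x. l m * (\<Sum>n\<in>nats_upto (x / real m). r n))"
    proof -
      have "(\<Sum>m\<in>nats_upto x. l m * (\<Sum>n\<in>nats_upto (x / real m). r n))
          = (\<Sum>m\<in>nats_upto x. \<Sum>n\<in>nats_upto (x / real m). r n * l m)"
        by (simp add: sum_distrib_left mult.commute)
      also have "\<dots> = (\<Sum>n\<in>nats_upto x. r n * psi (x / real n))"
        by (subst sum_nats_upto_swap) (simp add: psi_def sum_distrib_left)
      finally show ?thesis by (simp add: sum_r_psi)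
    qed
    have 2: "\<bar>(\<Sum>n\<in>nats_upto x. r n * ln (real n)) - A * x * S\<bar> \<le> K * C3 * x"
    proof -
      have "(\<Sum>n\<in>nats_upto x. r n * ln (real n)) - A * x * S
         = (\<Sum>m\<in>nats_upto x. l m * ((\<Sum>n\<in>nats_upto (x / real m). r n) - A * (x / real m)))"
        unfolding 1 S_def by (simp add: sum_distrib_left right_diff_distrib sum_subtractf mult_ac)
      also have "\<bar>\<dots>\<bar> \<le> (\<Sum>m\<in>nats_upto x. K * (l m * (x / real m) powr (3/4)))"
      proof (rule order_trans[OF sum_abs], rule sum_mono)
        fix m assume "m \<in> nats_upto x"
        hence m: "x / real m \<ge> 1" by (auto simp: mem_nats_upto)
        have "sqrt (x / real m) \<le> (x / real m) powr (3/4)"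
          using m powr_mono[of "1/2" "3/4" "x / real m"] by (simp only: powr_half_sqrt)
        hence "K * sqrt (x / real m) \<le> K * (x / real m) powr (3/4)"
          by (intro mult_left_mono K_nonneg)
        hence "\<bar>(\<Sum>n\<in>nats_upto (x / real m). r n) - A * (x / real m)\<bar> \<le> K * (x / real m) powr (3/4)"
          using R_bound[OF m] by linarith
        hence "l m * \<bar>(\<Sum>n\<in>nats_upto (x / real m). r n) - A * (x / real m)\<bar> \<le> l m * (K * (x / real m) powr (3/4))"
          by (intro mult_left_mono nonneg_l)
        thus "\<bar>l m * ((\<Sum>n\<in>nats_upto (x / real m). r n) - A * (x / real m))\<bar>
          \<le> K * (l m * (x / real m) powr (3/4))"
          unfolding abs_mult using nonneg_l[of m] by (simp only: abs_of_nonneg mult.left_commute)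
      qed
      also have "\<dots> \<le> K * (C3 * x)"
        unfolding sum_distrib_left[symmetric] using x by (intro mult_left_mono C3 K_nonneg) auto
      finally show ?thesis by (simp add: mult.assoc)
    qed
    have "x powr (5/8) \<le> x powr 1" using x by (intro powr_mono) auto
    hence "C2 * x powr (5/8) \<le> C2 * x" using x C2(1) by (intro mult_left_mono) auto
    hence "\<bar>A * x * S - A * (x * ln x - x)\<bar> \<le> (C2 + K * C3) * x"
      using 2 C2(2)[OF x] unfolding distrib_right by linarith
    hence "\<bar>A * x * S - A * (x * ln x)\<bar> \<le> (C2 + A + K * C3) * x"
      using A_pos x unfolding distrib_right right_diff_distrib by (smt (verit) mult_nonneg_nonneg)
    also have "A * x * S - A * (x * ln x) = (A * x) * (S - ln x)" by (simp add: algebra_simps)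
    finally have "A * \<bar>S - ln x\<bar> * x \<le> (C2 + A + K * C3) * x"
      using x A_pos by (simp add: abs_mult mult_ac)
    hence "A * \<bar>S - ln x\<bar> \<le> C2 + A + K * C3" using x by simp
    hence "\<bar>S - ln x\<bar> \<le> (C2 + A + K * C3) / A" using A_pos by (simp add: field_simps)
    thus "\<bar>S - ln x\<bar> \<le> (C2 + A + K * C3) / A + 1" by linarith
  qed
qed

lemma selberg_formula:
  obtains C where "C > 0"
    "\<And>x. x \<ge> 1 \<Longrightarrow> \<bar>(\<Sum>n\<in>nats_upto x. l n * ln (real n)) + (\<Sum>n\<in>nats_upto x. l n * psi (x / real n))
        - 2 * x * ln x\<bar> \<le> C * x"
proof -
  obtain C1 where C1: "C1 > 0" "\<And>x. x \<ge> 0 \<Longrightarrow> psi x \<le> C1 * x" by (rule chebyshev) auto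
  obtain M where M: "M > 0" "\<And>x. x \<ge> 1 \<Longrightarrow> \<bar>(\<Sum>n\<in>nats_upto x. l n / real n) - ln x\<bar> \<le> M"
    by (rule mertens) auto
  obtain C2 where C2: "C2 > 0" "\<And>x. x \<ge> 0 \<Longrightarrow> (\<Sum>n\<in>nats_upto x. l n * ln (x / real n)) \<le> C2 * x"
    by (rule sum_ln_weight_bound[of l C1]) (use C1 nonneg_l in \<open>auto simp: psi_def\<close>)
  obtain c C0 where C0: "C0 > 0"
    "\<And>x. x \<ge> 1 \<Longrightarrow> \<bar>inv_sum (\<lambda>y. psi y - y + c) x\<bar> \<le> C0 * x powr (5/8)"
    by (rule psi_shifted) auto
  define F where "F y = psi y - y + c" for y
  \<comment> \<open>Tatuzawa-Iseki: twisting by the logarithm turns the convolution \<open>r * l = r ln\<close> into an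
      inversion formula for \<open>F ln + l * F\<close>.\<close>
  define G where "G x = F x * ln x + (\<Sum>n\<in>nats_upto x. l n * F (x / real n))" for x
  \<comment> \<open>At index k the two parts of \<open>G\<close> contribute ln(x/k) and ln k, whose
    sum ln x is independent of k. The twist therefore multiplies the transform of \<open>F\<close>
    by ln x, and x^(5/8) ln x is still O(x^(3/4)).\<close>
  have inv_G: "inv_sum G x = ln x * inv_sum F x" if x: "x \<ge> 1" for x
  proof -
    have "inv_sum G x = (\<Sum>n\<in>nats_upto x. r n * F (x / real n) * ln (x / real n))
       + (\<Sum>n\<in>nats_upto x. r n * (\<Sum>m\<in>nats_upto (x / real n). l m * F (x / real n / real m)))"
      by (simp add: inv_sum_def G_def algebra_simps sum.distrib)
    also have "(\<Sum>n\<in>nats_upto x. r n * (\<Sum>m\<in>nats_upto (x / real n). l m * F (x / real n / real m)))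
       = (\<Sum>k\<in>nats_upto x. (\<Sum>d | d dvd k. r d * l (k div d)) * F (x / real k))"
      by (rule sum_nats_upto_conv[symmetric])
    also have "\<dots> = (\<Sum>n\<in>nats_upto x. r n * F (x / real n) * ln (real n))"
      by (intro sum.cong refl) (simp add: conv_ln[symmetric] mem_nats_upto)
    also have "(\<Sum>n\<in>nats_upto x. r n * F (x / real n) * ln (x / real n)) + \<dots>
       = (\<Sum>n\<in>nats_upto x. ln x * (r n * F (x / real n)))"
      unfolding sum.distrib[symmetric]
      by (intro sum.cong refl) (use x in \<open>auto simp: mem_nats_upto ln_div algebra_simps\<close>)
    finally show ?thesis by (simp add: inv_sum_def sum_distrib_left)
  qed
  have "\<bar>inv_sum G x\<bar> \<le> (8 * C0) * x powr (3/4)" if x: "x \<ge> 1" for x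
  proof -
    have "\<bar>inv_sum G x\<bar> \<le> (8 * x powr (1/8)) * (C0 * x powr (5/8))"
      unfolding inv_G[OF x] abs_mult
      using C0(2)[OF x] ln_le_powr[of x "1/8"] x C0(1) by (intro mult_mono) (auto simp: F_def[abs_def])
    also have "\<dots> = 8 * C0 * (x powr (1/8) * x powr (5/8))" by simp
    also have "x powr (1/8) * x powr (5/8) = x powr (3/4)" by (simp flip: powr_add)
    finally show ?thesis .
  qed
  then obtain C3 where C3: "C3 > 0" "\<And>x. x \<ge> 1 \<Longrightarrow> \<bar>G x\<bar> \<le> C3 * x"
    using inv_sum_bound[where F = G] by blast
  show ?thesis
  proof (rule that)
    show "C3 + \<bar>c\<bar> + M + \<bar>c\<bar> * C1 + C2 > 0" using C3 M C1 C2 by (intro add_nonneg_pos add_nonneg_nonneg) auto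
    fix x :: real assume x: "x \<ge> 1"
    define S1 where "S1 = (\<Sum>n\<in>nats_upto x. l n / real n)"
    define S2 where "S2 = (\<Sum>n\<in>nats_upto x. l n * ln (x / real n))"
    define S3 where "S3 = (\<Sum>n\<in>nats_upto x. l n * psi (x / real n))"
    have 1: "(\<Sum>n\<in>nats_upto x. l n * ln (real n)) = psi x * ln x - S2"
      unfolding psi_def S2_def sum_distrib_right sum_subtractf[symmetric]
      by (intro sum.cong refl) (use x in \<open>auto simp: mem_nats_upto ln_div algebra_simps\<close>)
    have 2: "G x = (psi x - x + c) * ln x + S3 - x * S1 + c * psi x"
      unfolding G_def F_def S3_def S1_def psi_def[of x]
      by (simp add: algebra_simps sum.distrib sum_subtractf sum_distrib_left)
    \<comment> \<open>In \<open>G\<close> the terms -x ln x and -x * S1 combine to -2 x ln x + O(x)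
      by Mertens' theorem; everything else beyond Selberg's two sums is O(x).\<close>
    have "psi x * ln x - S2 + S3 - 2 * x * ln x = G x - c * ln x + x * (S1 - ln x) - c * psi x - S2"
      unfolding 2 by (simp add: algebra_simps)
    moreover have "\<bar>c * ln x\<bar> \<le> \<bar>c\<bar> * x"
      unfolding abs_mult using x ln_le_minus_one[of x] by (intro mult_left_mono) auto
    moreover have "\<bar>x * (S1 - ln x)\<bar> \<le> M * x"
      unfolding abs_mult using x M(2)[OF x] by (simp add: S1_def mult.commute mult_right_mono)
    moreover have "psi x \<ge> 0" unfolding psi_def by (intro sum_nonneg nonneg_l)
    moreover have "\<bar>c * psi x\<bar> \<le> \<bar>c\<bar> * C1 * x"
      unfolding abs_mult mult.assoc using C1(2)[of x] x \<open>psi x \<ge> 0\<close> by (intro mult_left_mono) auto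
    moreover have "0 \<le> S2" unfolding S2_def
      using x by (intro sum_nonneg mult_nonneg_nonneg nonneg_l) (auto simp: mem_nats_upto)
    moreover have "S2 \<le> C2 * x" unfolding S2_def using C2(2)[of x] x by simp
    ultimately show "\<bar>(\<Sum>n\<in>nats_upto x. l n * ln (real n)) + (\<Sum>n\<in>nats_upto x. l n * psi (x / real n))
        - 2 * x * ln x\<bar> \<le> (C3 + \<bar>c\<bar> + M + \<bar>c\<bar> * C1 + C2) * x"
      unfolding 1 S3_def[symmetric] using C3(2)[OF x] unfolding distrib_right by linarith
  qed
qed

end

section \<open>Real characters\<close>

text \<open>Each step removes the full power of one prime, so that identities between multiplicative
  functions reduce to prime powers.\<close>

lemma prime_power_coprime_induct [consumes 1, case_names one prime_power]:
  fixes n :: nat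
  assumes "n > 0" "P 1"
    and step: "\<And>p k m. prime p \<Longrightarrow> k > 0 \<Longrightarrow> m > 0 \<Longrightarrow> \<not> p dvd m \<Longrightarrow> P m \<Longrightarrow> P (p ^ k * m)"
  shows "P n"
  using \<open>n > 0\<close>
proof (induction n rule: less_induct)
  case (less n)
  show ?case
  proof (cases "n = 1")
    case False
    then obtain p where p: "prime p" "p dvd n" using prime_factor_nat by blast
    obtain m where m: "n = p ^ multiplicity p n * m" "\<not> p dvd m"
      using multiplicity_decompose'[of n p] prime_gt_1_nat[OF p(1)] less.prems by auto
    define k where "k = multiplicity p n"
    have k: "k > 0" using p less.prems by (simp add: k_def prime_multiplicity_gt_zero_iff prime_imp_prime_elem prime_elem_multiplicity_mult_distrib)
    have "p ^ k > 1" using p k by (metis one_less_power prime_gt_1_nat)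
    have "m > 0" using m less.prems by (cases m) auto
    hence "1 * m < p ^ k * m" using \<open>p ^ k > 1\<close> by (intro mult_strict_right_mono) auto
    hence "m < n" using m(1) by (simp add: k_def)
    hence "P (p ^ k * m)" using p k m \<open>m > 0\<close> by (intro step less.IH) auto
    thus ?thesis using m(1) by (simp add: k_def)
  qed (use assms in auto)
qed

lemma multiplicity_prime_power_mult:
  fixes p q k m :: nat
  assumes "prime p" "\<not> p dvd m" "m > 0" "prime q"
  shows "multiplicity q (p ^ k * m) = (if q = p then k else multiplicity q m)"
proof (cases "q = p")
  case True
  thus ?thesis using assms by (subst prime_elem_multiplicity_mult_distrib)
    (auto simp: prime_elem_multiplicity_power_distrib not_dvd_imp_multiplicity_0 prime_gt_0_nat)
next
  case False
  thus ?thesis using assms by (subst prime_elem_multiplicity_mult_distrib)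
    (auto simp: prime_elem_multiplicity_power_distrib not_dvd_imp_multiplicity_0 prime_gt_0_nat
       prime_multiplicity_other)
qed

lemma sum_divisors_prime_power_mult:
  fixes p k m :: nat and F :: "nat \<Rightarrow> real"
  assumes "prime p" "\<not> p dvd m" "m > 0"
  shows "(\<Sum>d | d dvd p ^ k * m. F d) = (\<Sum>i\<le>k. \<Sum>d | d dvd m. F (p ^ i * d))"
proof -
  have *: "multiplicity p (p ^ i * d) = i" if "d dvd m" for i d
    using that assms multiplicity_prime_power_mult[of p d p i]
    by (metis dvd_trans gr0I dvd_0_left)
  have "(\<Sum>i\<le>k. \<Sum>d | d dvd m. F (p ^ i * d)) = (\<Sum>(i, d)\<in>{..k} \<times> {d. d dvd m}. F (p ^ i * d))"
    by (simp add: sum.cartesian_product)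
  also have "\<dots> = (\<Sum>e\<in>(\<lambda>(i, d). p ^ i * d) ` ({..k} \<times> {d. d dvd m}). F e)"
  proof (subst sum.reindex)
    show "inj_on (\<lambda>(i, d). p ^ i * d) ({..k} \<times> {d. d dvd m})"
    proof (rule inj_onI, clarify)
      fix i d j e assume h: "d dvd m" "e dvd m" "p ^ i * d = p ^ j * e"
      hence "i = j" using *[of d i] *[of e j] by metis
      moreover have "p > 0" using assms by (simp add: prime_gt_0_nat)
      ultimately show "i = j \<and> d = e" using h by simp
    qed
  qed (auto simp: case_prod_unfold)
  also have "(\<lambda>(i, d). p ^ i * d) ` ({..k} \<times> {d. d dvd m}) = {d. d dvd p ^ k * m}"
  proof (intro equalityI subsetI)
    fix e assume "e \<in> {d. d dvd p ^ k * m}"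
    then obtain a b where ab: "e = a * b" "a dvd p ^ k" "b dvd m"
      using division_decomp[of e "p ^ k" m] by blast
    then obtain i where "i \<le> k" "a = p ^ i" using assms divides_primepow_nat by blast
    thus "e \<in> (\<lambda>(i, d). p ^ i * d) ` ({..k} \<times> {d. d dvd m})" using ab by auto
  qed (auto intro!: mult_dvd_mono le_imp_power_dvd)
  finally show ?thesis ..
qed

lemma sum_divisors_flip:
  fixes F :: "nat \<Rightarrow> nat \<Rightarrow> real"
  assumes "n > 0"
  shows "(\<Sum>d | d dvd n. F d (n div d)) = (\<Sum>d | d dvd n. F (n div d) d)"
  by (rule sum.reindex_bij_witness[where i = "\<lambda>d. n div d" and j = "\<lambda>d. n div d"])
     (use assms in \<open>auto simp: div_div_eq_right dvd_div_eq_mult elim!: dvdE\<close>)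

text \<open>Both sides run over the factorizations of n into three ordered factors.\<close>

lemma sum_divisors_assoc:
  fixes F :: "nat \<Rightarrow> nat \<Rightarrow> real"
  assumes "n > 0"
  shows "(\<Sum>d | d dvd n. \<Sum>e | e dvd d. F e (d div e)) = (\<Sum>e | e dvd n. \<Sum>d | d dvd n div e. F e d)"
proof -
  have pos: "d > 0" if "d dvd n" for d using that assms by (auto intro: Nat.gr0I)
  have fin: "finite {d. d dvd m}" if "m dvd n" for m using pos[OF that] by simp
  have fin': "finite {e. e dvd n div d}" if "d dvd n" for d
    using fin[of "n div d"] that by (metis dvd_div_mult_self dvd_triv_left)
  have "(\<Sum>d | d dvd n. \<Sum>e | e dvd d. F e (d div e))
      = (\<Sum>(d, e)\<in>(SIGMA d:{d. d dvd n}. {e. e dvd d}). F e (d div e))"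
    using fin assms by (subst sum.Sigma) auto
  also have "\<dots> = (\<Sum>(e, d)\<in>(SIGMA e:{e. e dvd n}. {d. d dvd n div e}). F e d)"
  proof (rule sum.reindex_bij_witness[where i = "\<lambda>(e, d). (e * d, e)" and j = "\<lambda>(d, e). (e, d div e)"])
    fix x assume "x \<in> (SIGMA d:{d. d dvd n}. {e. e dvd d})"
    then obtain e c b where x: "x = (e * c, e)" "n = e * c * b" by (auto elim!: dvdE)
    hence "e > 0" using assms by (auto intro: Nat.gr0I)
    thus "(case x of (d, e) \<Rightarrow> (e, d div e)) \<in> (SIGMA e:{e. e dvd n}. {d. d dvd n div e})"
      "(case case x of (d, e) \<Rightarrow> (e, d div e) of (e, d) \<Rightarrow> (e * d, e)) = x"
      "(case case x of (d, e) \<Rightarrow> (e, d div e) of (e, d) \<Rightarrow> F e d) = (case x of (d, e) \<Rightarrow> F e (d div e))"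
      using x by (auto simp: mult.assoc)
  next
    fix x assume "x \<in> (SIGMA e:{e. e dvd n}. {d. d dvd n div e})"
    then obtain e d where x: "x = (e, d)" "e dvd n" "d dvd n div e" by auto
    have "e > 0" using x pos by auto
    moreover have "e * d dvd n" using x by (metis dvd_mult_div_cancel mult_dvd_mono dvd_refl)
    ultimately show "(case x of (e, d) \<Rightarrow> (e * d, e)) \<in> (SIGMA d:{d. d dvd n}. {e. e dvd d})"
      "(case case x of (e, d) \<Rightarrow> (e * d, e) of (d, e) \<Rightarrow> (e, d div e)) = x"
      using x by auto
  qed
  also have "\<dots> = (\<Sum>e | e dvd n. \<Sum>d | d dvd n div e. F e d)"
    using fin' assms by (subst sum.Sigma) auto
  finally show ?thesis .
qed

lemma sum_divisors_commute:
  fixes F :: "nat \<Rightarrow> nat \<Rightarrow> real"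
  assumes "n > 0"
  shows "(\<Sum>e | e dvd n. \<Sum>d | d dvd n div e. F e d) = (\<Sum>d | d dvd n. \<Sum>e | e dvd n div d. F e d)"
proof -
  have "(\<Sum>e | e dvd n. \<Sum>d | d dvd n div e. F e d) = (\<Sum>d | d dvd n. \<Sum>e | e dvd d. F e (d div e))"
    by (rule sum_divisors_assoc[OF assms, symmetric])
  also have "\<dots> = (\<Sum>d | d dvd n. \<Sum>e | e dvd d. F (d div e) e)"
    by (intro sum.cong refl sum_divisors_flip) (use assms in \<open>auto intro: Nat.gr0I\<close>)
  also have "\<dots> = (\<Sum>d | d dvd n. \<Sum>e | e dvd n div d. F e d)"
    by (rule sum_divisors_assoc[OF assms])
  finally show ?thesis .
qed

text \<open>Periodicity enters through bounded partial sums. Positivity of L(1, chi), the delicate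
  point for general characters, is supplied for the two characters at hand by evaluating the series
  in closed form. A zero of \<open>chr\<close> at a prime means ramification.\<close>

locale real_character =
  fixes chr :: "nat \<Rightarrow> real" and D L :: real
  assumes chi_mult: "chr (m * n) = chr m * chr n"
    and chi_1: "chr 1 = 1"
    and chi_range: "chr n = 1 \<or> chr n = 0 \<or> chr n = -1"
    and finite_ramified: "finite {p. prime p \<and> chr p = 0}"
    and sum_chi_bound: "\<bar>\<Sum>n=1..N. chr n\<bar> \<le> D"
    and L_sums: "(\<lambda>n. chr (Suc n) / real (Suc n)) sums L"
    and L_pos: "L > 0"
begin

lemma chi_power: "chr (n ^ k) = chr n ^ k"
  by (induction k) (simp_all add: chi_mult chi_1[simplified])

lemma abs_chi_le: "\<bar>chr n\<bar> \<le> 1" using chi_range[of n] by auto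

lemma D_nonneg: "D \<ge> 0" using sum_chi_bound[of 0] by simp

text \<open>Coefficients of zeta(s) L(s, chi); for the two characters used this is the Dedekind zeta
  function of the Gaussian or the Eisenstein field.\<close>

definition r :: "nat \<Rightarrow> real" where "r n = (\<Sum>d | d dvd n. chr d)"

text \<open>Coefficients of minus the logarithmic derivative of zeta(s) L(s, chi).\<close>

definition l :: "nat \<Rightarrow> real" where "l n = mangoldt n * (1 + chr n)"

definition rho :: "nat \<Rightarrow> nat \<Rightarrow> real" where "rho p k = (\<Sum>i\<le>k. chr p ^ i)"

text \<open>Coefficients of \<open>1 - (1 + \<chi>(p)) T + \<chi>(p) T\<^sup>2\<close>, the inverse of the Euler factor of \<open>r\<close>.\<close>

definition gcoeff :: "nat \<Rightarrow> nat \<Rightarrow> real" where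
  "gcoeff p k = (if k = 0 then 1 else if k = 1 then - (1 + chr p) else if k = 2 then chr p else 0)"

definition h :: "nat \<Rightarrow> real" where
  "h n = (\<Prod>p\<in>prime_factors n. gcoeff p (multiplicity p n))"

lemma l_nonneg: "l n \<ge> 0"
  unfolding l_def using chi_range[of n] mangoldt_nonneg[of n] by auto

lemma r_1: "r 1 = 1" using chi_1 by (simp add: r_def)

lemma h_1: "h 1 = 1" by (simp add: h_def)

lemma r_prime_power_mult:
  assumes "prime p" "\<not> p dvd m" "m > 0"
  shows "r (p ^ k * m) = rho p k * r m"
  unfolding r_def sum_divisors_prime_power_mult[OF assms] rho_def
  by (simp add: chi_mult chi_power sum_product)

lemma h_prime_power_mult:
  assumes "prime p" "\<not> p dvd m" "m > 0"
  shows "h (p ^ k * m) = gcoeff p k * h m"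
proof (cases "k = 0")
  case False
  have pm: "p \<notin> prime_factors m" using assms by auto
  have "prime_factors (p ^ k * m) = insert p (prime_factors m)"
    using assms False by (subst prime_factors_product) (auto simp: prime_factors_power prime_gt_0_nat prime_prime_factors)
  hence "h (p ^ k * m) = gcoeff p (multiplicity p (p ^ k * m))
      * (\<Prod>q\<in>prime_factors m. gcoeff q (multiplicity q (p ^ k * m)))"
    unfolding h_def using pm by simp
  also have "multiplicity p (p ^ k * m) = k"
    using multiplicity_prime_power_mult[of p m p k] assms by simp
  also have "(\<Prod>q\<in>prime_factors m. gcoeff q (multiplicity q (p ^ k * m))) = h m"
    unfolding h_def
  proof (intro prod.cong refl)
    fix q assume q: "q \<in> prime_factors m"
    hence "q \<noteq> p" "prime q" using pm by auto
    thus "gcoeff q (multiplicity q (p ^ k * m)) = gcoeff q (multiplicity q m)"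
      using multiplicity_prime_power_mult[of p m q k] assms by simp
  qed
  finally show ?thesis .
qed (simp add: gcoeff_def)

lemma rho_Suc: "rho p (Suc k) = 1 + chr p * rho p k"
  unfolding rho_def by (subst sum.atMost_Suc_shift) (simp add: sum_distrib_left)

lemma rho_cases:
  "rho p k = (if chr p = 1 then real (Suc k) else if chr p = 0 then 1 else if even k then 1 else 0)"
  by (induction k) (use chi_range[of p] in \<open>auto simp: rho_Suc, auto simp: rho_def\<close>)

lemma abs_gcoeff_le: "\<bar>gcoeff p k\<bar> \<le> rho p k"
  using chi_range[of p] by (auto simp: gcoeff_def rho_cases)

text \<open>Prime by prime the coefficients of an inverse Euler factor are dominated by those of the
  factor. This bounds the sums of |h| by those of \<open>r\<close>.\<close>

lemma abs_h_le_r: "n > 0 \<Longrightarrow> \<bar>h n\<bar> \<le> r n"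
proof (induction n rule: prime_power_coprime_induct)
  case (prime_power p k m)
  have "\<bar>gcoeff p k\<bar> * \<bar>h m\<bar> \<le> rho p k * r m"
    using prime_power abs_gcoeff_le[of p k] by (intro mult_mono) auto
  thus ?case using prime_power by (simp add: r_prime_power_mult h_prime_power_mult abs_mult)
qed (use r_1 h_1 in auto)

lemma r_nonneg: "r n \<ge> 0"
proof (cases "n = 0")
  case True
  \<comment> \<open>Every number divides 0, and a sum over an infinite set has the default value
    0.\<close>
  have "infinite {d::nat. d dvd 0}" by (simp add: infinite_UNIV_nat)
  thus ?thesis using True by (simp add: r_def)
qed (use abs_h_le_r[of n] in force)

text \<open>The coefficient of T^k in (1 - T)(1 - chi(p) T) times its inverse power series.\<close>

lemma gcoeff_rho_conv:
  assumes "k > 0" shows "(\<Sum>i\<le>k. gcoeff p i * rho p (k - i)) = 0"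
proof (cases "k = 1")
  case True
  thus ?thesis by (simp add: gcoeff_def rho_def)
next
  case False
  then obtain j where j: "k = Suc (Suc j)" using assms by (metis One_nat_def not0_implies_Suc not_gr_zero)
  have "(\<Sum>i\<le>k. gcoeff p i * rho p (k - i)) = (\<Sum>i\<in>{0, 1, 2}. gcoeff p i * rho p (k - i))"
    by (rule sum.mono_neutral_right) (use j in \<open>auto simp: gcoeff_def\<close>)
  also have "\<dots> = rho p (Suc (Suc j)) - (1 + chr p) * rho p (Suc j) + chr p * rho p j"
    by (simp add: gcoeff_def j algebra_simps)
  also have "\<dots> = 0" unfolding rho_Suc by (simp add: algebra_simps)
  finally show ?thesis .
qed

lemma h_inverse: "n > 0 \<Longrightarrow> (\<Sum>d | d dvd n. h d * r (n div d)) = (if n = 1 then 1 else 0)"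
proof (induction n rule: prime_power_coprime_induct)
  case one
  show ?case using r_1 h_1 by simp
next
  case (prime_power p k m)
  have "h (p ^ i * d) * r (p ^ k * m div (p ^ i * d)) = (gcoeff p i * rho p (k - i)) * (h d * r (m div d))"
    if "i \<le> k" "d dvd m" for i d
  proof -
    obtain b where b: "m = d * b" using \<open>d dvd m\<close> by (elim dvdE)
    have d: "\<not> p dvd d" "d > 0" "\<not> p dvd b" "b > 0" using b prime_power by auto
    have "p ^ k = p ^ i * p ^ (k - i)" using that by (simp flip: power_add)
    hence "p ^ k * m = (p ^ i * d) * (p ^ (k - i) * b)" using b by (simp add: mult_ac)
    moreover have "p ^ i * d > 0" using prime_power d by (simp add: prime_gt_0_nat)
    ultimately have "p ^ k * m div (p ^ i * d) = p ^ (k - i) * b"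
      by (metis nonzero_mult_div_cancel_left less_not_refl)
    moreover have "m div d = b" using b d by simp
    ultimately show ?thesis using prime_power d by (simp add: h_prime_power_mult r_prime_power_mult)
  qed
  hence "(\<Sum>d | d dvd p ^ k * m. h d * r (p ^ k * m div d))
      = (\<Sum>i\<le>k. \<Sum>d | d dvd m. (gcoeff p i * rho p (k - i)) * (h d * r (m div d)))"
    using prime_power by (subst sum_divisors_prime_power_mult) (auto intro!: sum.cong)
  also have "\<dots> = (\<Sum>i\<le>k. gcoeff p i * rho p (k - i)) * (\<Sum>d | d dvd m. h d * r (m div d))"
    by (simp only: sum_product)
  also have "\<dots> = 0" using gcoeff_rho_conv[OF \<open>k > 0\<close>] by simp
  finally show ?case using prime_power prime_gt_1_nat[of p] by auto
qed

text \<open>The logarithmic derivative of zeta(s) L(s, chi) in coefficients. Convolving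
  \<open>r\<close> with \<Lambda> gives the sum of chi(e) ln(n/e), since \<Lambda> * 1 = ln;
  convolving with chi \<Lambda> gives the sum of chi(u) ln u by complete multiplicativity. The
  logarithms add up to ln n.\<close>

lemma r_ln:
  assumes n: "n > 0" shows "r n * ln (real n) = (\<Sum>d | d dvd n. r d * l (n div d))"
proof -
  have pos: "d > 0" if "d dvd n" for d using that n by (auto intro: Nat.gr0I)
  have split: "(\<Sum>d | d dvd n. r d * l (n div d)) = (\<Sum>c | c dvd n. \<Sum>e | e dvd n div c. chr e * mangoldt c)
       + (\<Sum>c | c dvd n. \<Sum>e | e dvd n div c. chr e * chr c * mangoldt c)"
    by (subst sum_divisors_flip[OF n])
       (simp add: l_def r_def algebra_simps sum.distrib sum_distrib_left sum_distrib_right)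
  have "(\<Sum>c | c dvd n. \<Sum>e | e dvd n div c. chr e * mangoldt c)
      = (\<Sum>e | e dvd n. chr e * (\<Sum>c | c dvd n div e. mangoldt c))"
    by (subst sum_divisors_commute[OF n]) (simp add: sum_distrib_left)
  also have "\<dots> = (\<Sum>e | e dvd n. chr e * (ln (real n) - ln (real e)))"
  proof (intro sum.cong refl, goal_cases)
    case (1 e)
    then obtain b where b: "n = e * b" by auto
    hence "e > 0" "b > 0" using n by auto
    thus ?case using b mangoldt_sum[of b, where ?'a = real] by (simp add: ln_mult)
  qed
  finally have 1: "(\<Sum>c | c dvd n. \<Sum>e | e dvd n div c. chr e * mangoldt c)
     = (\<Sum>e | e dvd n. chr e * (ln (real n) - ln (real e)))" .
  have "(\<Sum>c | c dvd n. \<Sum>e | e dvd n div c. chr e * chr c * mangoldt c)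
     = (\<Sum>u | u dvd n. \<Sum>c | c dvd u. chr (u div c) * chr c * mangoldt c)"
    by (rule sum_divisors_assoc[OF n, symmetric])
  also have "\<dots> = (\<Sum>u | u dvd n. chr u * (\<Sum>c | c dvd u. mangoldt c))"
    unfolding sum_distrib_left by (intro sum.cong refl) (auto simp flip: chi_mult)
  also have "\<dots> = (\<Sum>u | u dvd n. chr u * ln (real u))"
    by (intro sum.cong refl) (use pos in \<open>auto simp: mangoldt_sum[where ?'a = real, simplified]\<close>)
  finally have 2: "(\<Sum>c | c dvd n. \<Sum>e | e dvd n div c. chr e * chr c * mangoldt c)
     = (\<Sum>u | u dvd n. chr u * ln (real u))" .
  have "r n * ln (real n) = (\<Sum>e | e dvd n. chr e * ln (real n))"
    by (simp add: r_def sum_distrib_right)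
  thus ?thesis unfolding split 1 2 by (simp add: right_diff_distrib sum_subtractf)
qed


section \<open>Partial sums of r by the hyperbola method\<close>

text \<open>Abel summation arranged for induction on M: with the boundary term at M + 1 subtracted,
  each step adds at most 2 D times a telescoping difference.\<close>

lemma chr_tail_aux:
  assumes "M \<ge> N"
  shows "\<bar>(\<Sum>n=N+1..M. chr n / real n) - ((\<Sum>n=1..M. chr n) - (\<Sum>n=1..N. chr n)) / real (Suc M)\<bar>
    \<le> 2 * D * (1 / real (Suc N) - 1 / real (Suc M))"
  using assms
proof (induction M rule: dec_induct)
  case (step M)
  define S where "S k = (\<Sum>n=1..k. chr n)" for k
  define T where "T k = (\<Sum>n=N+1..k. chr n / real n)" for k
  have 1: "T (Suc M) = T M + chr (Suc M) / real (Suc M)" using step by (simp add: T_def)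
  have 2: "S (Suc M) = S M + chr (Suc M)" by (simp add: S_def)
  have "T (Suc M) - (S (Suc M) - S N) / real (Suc (Suc M))
    = (T M - (S M - S N) / real (Suc M)) + (S (Suc M) - S N) * (1 / real (Suc M) - 1 / real (Suc (Suc M)))"
    unfolding 1 2 by (simp add: algebra_simps add_divide_distrib diff_divide_distrib del: of_nat_Suc)
  also have "\<bar>\<dots>\<bar> \<le> 2 * D * (1 / real (Suc N) - 1 / real (Suc M))
      + 2 * D * (1 / real (Suc M) - 1 / real (Suc (Suc M)))"
  proof (rule order_trans[OF abs_triangle_ineq], rule add_mono)
    show "\<bar>T M - (S M - S N) / real (Suc M)\<bar> \<le> 2 * D * (1 / real (Suc N) - 1 / real (Suc M))"
      using step by (simp add: T_def S_def del: of_nat_Suc)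
    have "\<bar>S (Suc M) - S N\<bar> \<le> 2 * D"
      using sum_chi_bound[of "Suc M"] sum_chi_bound[of N] unfolding S_def by linarith
    moreover have "1 / real (Suc M) - 1 / real (Suc (Suc M)) \<ge> 0" by (simp add: field_simps)
    ultimately show "\<bar>(S (Suc M) - S N) * (1 / real (Suc M) - 1 / real (Suc (Suc M)))\<bar>
      \<le> 2 * D * (1 / real (Suc M) - 1 / real (Suc (Suc M)))"
      unfolding abs_mult by (intro mult_mono) auto
  qed
  also have "\<dots> = 2 * D * (1 / real (Suc N) - 1 / real (Suc (Suc M)))" by (simp add: algebra_simps)
  finally show ?case unfolding S_def T_def .
qed simp

lemma chr_tail: "\<bar>(\<Sum>n=1..N. chr n / real n) - L\<bar> \<le> 2 * D / real (Suc N)"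
proof -
  have lim: "(\<lambda>M. \<Sum>n=1..M. chr n / real n) \<longlonglongrightarrow> L"
    using L_sums unfolding sums_def
    by (simp only: sum.atLeast1_atMost_eq One_nat_def)
  have "\<bar>(\<Sum>n=1..M. chr n / real n) - (\<Sum>n=1..N. chr n / real n)\<bar> \<le> 2 * D / real (Suc N)" if "M \<ge> N" for M
  proof -
    have split: "(\<Sum>n=1..M. chr n / real n) - (\<Sum>n=1..N. chr n / real n) = (\<Sum>n=N+1..M. chr n / real n)"
      using that sum.ub_add_nat[of 1 N "\<lambda>n. chr n / real n" "M - N"] by simp
    define d where "d = (\<Sum>n=1..M. chr n) - (\<Sum>n=1..N. chr n)"
    have "\<bar>d\<bar> \<le> 2 * D" unfolding d_def using sum_chi_bound[of M] sum_chi_bound[of N] by linarith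
    hence "\<bar>d / real (Suc M)\<bar> \<le> 2 * D / real (Suc M)" unfolding abs_divide by (simp add: divide_right_mono)
    moreover have "\<bar>(\<Sum>n=N+1..M. chr n / real n) - d / real (Suc M)\<bar> \<le> 2 * D * (1 / real (Suc N) - 1 / real (Suc M))"
      unfolding d_def by (rule chr_tail_aux[OF that])
    moreover have "2 * D * (1 / real (Suc N) - 1 / real (Suc M)) = 2 * D / real (Suc N) - 2 * D / real (Suc M)"
      by (simp add: right_diff_distrib)
    ultimately show ?thesis unfolding split by linarith
  qed
  hence "\<forall>\<^sub>F M in sequentially. \<bar>(\<Sum>n=1..M. chr n / real n) - (\<Sum>n=1..N. chr n / real n)\<bar> \<le> 2 * D / real (Suc N)"
    by (auto simp: eventually_sequentially)
  moreover have "(\<lambda>M. \<bar>(\<Sum>n=1..M. chr n / real n) - (\<Sum>n=1..N. chr n / real n)\<bar>) \<longlonglongrightarrow> \<bar>L - (\<Sum>n=1..N. chr n / real n)\<bar>"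
    by (intro tendsto_intros lim)
  ultimately have "\<bar>L - (\<Sum>n=1..N. chr n / real n)\<bar> \<le> 2 * D / real (Suc N)"
    by (intro tendsto_upperbound) auto
  thus ?thesis by (simp add: abs_minus_commute)
qed

lemma sum_chr_upto_bound: "\<bar>\<Sum>n\<in>nats_upto x. chr n\<bar> \<le> D"
  unfolding nats_upto_eq by (rule sum_chi_bound)

text \<open>Dirichlet's hyperbola method with cut at sqrt x. For small d the integers up to x/d are
  counted, at a cost of 1 for each d, and the tail of L(1, chi) costs 2 D sqrt x. For large d the
  inner sums over \<open>chr\<close> are bounded by 2 D, and they occur only for m <= sqrt
  x.\<close>

lemma sum_r_bound:
  assumes x: "x \<ge> 1"
  shows "\<bar>(\<Sum>n\<in>nats_upto x. r n) - L * x\<bar> \<le> (4 * D + 1) * sqrt x"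
proof -
  define y where "y = sqrt x"
  have y: "y \<ge> 1" "y * y = x" "y \<le> x" using x sqrt_le_self by (auto simp: y_def)
  \<comment> \<open>\<open>F1\<close> keeps d <= sqrt x and \<open>F2\<close> the rest; only the
    second part has its sums exchanged.\<close>
  define F1 where "F1 d m = (if real d \<le> y then chr d else 0)" for d m :: nat
  define F2 where "F2 d m = (if real d \<le> y then 0 else chr d)" for d m :: nat
  have "(\<Sum>n\<in>nats_upto x. r n) = (\<Sum>d\<in>nats_upto x. \<Sum>m\<in>nats_upto (x / real d). F1 d m + F2 d m)"
    unfolding r_def by (subst sum_nats_upto_divisors[symmetric]) (auto simp: F1_def F2_def intro!: sum.cong)
  also have "\<dots> = (\<Sum>d\<in>nats_upto x. \<Sum>m\<in>nats_upto (x / real d). F1 d m)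
      + (\<Sum>m\<in>nats_upto x. \<Sum>d\<in>nats_upto (x / real m). F2 d m)"
    by (subst sum_nats_upto_swap[symmetric]) (simp add: sum.distrib)
  finally have split: "(\<Sum>n\<in>nats_upto x. r n) = (\<Sum>d\<in>nats_upto x. \<Sum>m\<in>nats_upto (x / real d). F1 d m)
      + (\<Sum>m\<in>nats_upto x. \<Sum>d\<in>nats_upto (x / real m). F2 d m)" .
  have Uy: "{d \<in> nats_upto x. real d \<le> y} = nats_upto y" by (auto simp: mem_nats_upto intro: order_trans[OF _ y(3)])
  have "(\<Sum>d\<in>nats_upto x. \<Sum>m\<in>nats_upto (x / real d). F1 d m)
     = (\<Sum>d\<in>nats_upto x. if real d \<le> y then chr d * real (card (nats_upto (x / real d))) else 0)"
    by (intro sum.cong) (auto simp: F1_def)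
  also have "\<dots> = (\<Sum>d\<in>nats_upto y. chr d * real (card (nats_upto (x / real d))))"
    by (subst sum.inter_filter[symmetric]) (auto simp: Uy)
  finally have F1: "(\<Sum>d\<in>nats_upto x. \<Sum>m\<in>nats_upto (x / real d). F1 d m)
     = (\<Sum>d\<in>nats_upto y. chr d * real (card (nats_upto (x / real d))))" .
  have "\<bar>(\<Sum>d\<in>nats_upto y. chr d * real (card (nats_upto (x / real d)))) - x * (\<Sum>d\<in>nats_upto y. chr d / real d)\<bar>
     = \<bar>\<Sum>d\<in>nats_upto y. chr d * (real (card (nats_upto (x / real d))) - x / real d)\<bar>"
    by (simp add: sum_distrib_left right_diff_distrib sum_subtractf mult_ac)
  also have "\<dots> \<le> (\<Sum>d\<in>nats_upto y. 1)"
  proof (rule order_trans[OF sum_abs], rule sum_mono)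
    fix d assume "d \<in> nats_upto y"
    have "\<bar>real (card (nats_upto z)) - z\<bar> \<le> 1" if "z \<ge> 0" for z :: real
      using that by (simp add: nats_upto_eq) linarith
    hence "\<bar>real (card (nats_upto (x / real d))) - x / real d\<bar> \<le> 1" using x by simp
    thus "\<bar>chr d * (real (card (nats_upto (x / real d))) - x / real d)\<bar> \<le> 1"
      unfolding abs_mult using abs_chi_le[of d] by (intro mult_le_one) auto
  qed
  also have "\<dots> \<le> y" using card_nats_upto_le[of y] y by simp
  finally have 1: "\<bar>(\<Sum>d\<in>nats_upto y. chr d * real (card (nats_upto (x / real d)))) - x * (\<Sum>d\<in>nats_upto y. chr d / real d)\<bar> \<le> y" .
  have 2: "\<bar>x * (\<Sum>d\<in>nats_upto y. chr d / real d) - L * x\<bar> \<le> 2 * D * y"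
  proof -
    define N where "N = nat \<lfloor>y\<rfloor>"
    have N: "real (Suc N) \<ge> y" using y unfolding N_def by linarith
    have "\<bar>(\<Sum>d\<in>nats_upto y. chr d / real d) - L\<bar> \<le> 2 * D / real (Suc N)"
      unfolding nats_upto_eq N_def by (rule chr_tail)
    also have "\<dots> \<le> 2 * D / y" using N y D_nonneg by (intro divide_left_mono) auto
    finally have "x * \<bar>(\<Sum>d\<in>nats_upto y. chr d / real d) - L\<bar> \<le> x * (2 * D / y)"
      using x by (intro mult_left_mono) auto
    also have "\<dots> = 2 * D * y" using y(1) unfolding y(2)[symmetric] by simp
    also have "x * \<bar>(\<Sum>d\<in>nats_upto y. chr d / real d) - L\<bar> = \<bar>x * ((\<Sum>d\<in>nats_upto y. chr d / real d) - L)\<bar>"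
      using x by (simp add: abs_mult)
    finally show ?thesis by (simp add: algebra_simps)
  qed
  have 3: "\<bar>\<Sum>m\<in>nats_upto x. \<Sum>d\<in>nats_upto (x / real m). F2 d m\<bar> \<le> 2 * D * y"
  proof -
    have "\<bar>\<Sum>d\<in>nats_upto (x / real m). F2 d m\<bar> \<le> (if real m \<le> y then 2 * D else 0)" if m: "m \<in> nats_upto x" for m
    proof (cases "real m \<le> y")
      case False
      have "x / real m \<le> y" using False y m by (simp add: mem_nats_upto field_simps flip: y(2))
      hence "F2 d m = 0" if "d \<in> nats_upto (x / real m)" for d using that by (auto simp: F2_def mem_nats_upto)
      thus ?thesis using False by simp
    next
      case True
      have "y * real m \<le> y * y" using True y by (intro mult_left_mono) auto
      hence xm: "y \<le> x / real m" using m y by (simp add: mem_nats_upto field_simps)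
      have eq: "chr d - F2 d m = (if real d \<le> y then chr d else 0)" for d by (simp add: F2_def)
      have U: "{d \<in> nats_upto (x / real m). real d \<le> y} = nats_upto y" using xm by (auto simp: mem_nats_upto)
      \<comment> \<open>The range sqrt x < d <= x/m is a difference of two initial segments, hence
        the bound 2 D.\<close>
      have "(\<Sum>d\<in>nats_upto (x / real m). chr d) - (\<Sum>d\<in>nats_upto (x / real m). F2 d m) = (\<Sum>d\<in>nats_upto y. chr d)"
        unfolding sum_subtractf[symmetric] eq by (subst sum.inter_filter[symmetric]) (auto simp: U)
      thus ?thesis using True sum_chr_upto_bound[of y] sum_chr_upto_bound[of "x / real m"] by simp
    qed
    hence "\<bar>\<Sum>m\<in>nats_upto x. \<Sum>d\<in>nats_upto (x / real m). F2 d m\<bar> \<le> (\<Sum>m\<in>nats_upto x. if real m \<le> y then 2 * D else 0)"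
      by (intro order_trans[OF sum_abs sum_mono])
    also have "\<dots> = 2 * D * real (card (nats_upto y))"
      by (subst sum.inter_filter[symmetric]) (auto simp: Uy)
    also have "\<dots> \<le> 2 * D * y" using y D_nonneg by (intro mult_left_mono card_nats_upto_le) auto
    finally show ?thesis .
  qed
  have "(4 * D + 1) * y = y + 2 * D * y + 2 * D * y" by (simp add: algebra_simps)
  thus ?thesis unfolding split F1 y_def[symmetric] using 1 2 3 by linarith
qed

sublocale selberg_system r l h L "4 * D + 1" "L + 4 * D + 1"
proof
  show "(\<Sum>n\<in>nats_upto x. \<bar>h n\<bar>) \<le> (L + 4 * D + 1) * x" if x: "x \<ge> 1" for x
  proof -
    have "(\<Sum>n\<in>nats_upto x. \<bar>h n\<bar>) \<le> (\<Sum>n\<in>nats_upto x. r n)"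
      by (intro sum_mono abs_h_le_r) (simp add: mem_nats_upto)
    moreover have "(4 * D + 1) * sqrt x \<le> (4 * D + 1) * x"
      using sqrt_le_self[OF x] D_nonneg by (intro mult_left_mono) auto
    ultimately show ?thesis using sum_r_bound[OF x] unfolding distrib_right by linarith
  qed
qed (use r_nonneg l_nonneg L_pos D_nonneg sum_r_bound r_ln h_inverse in auto)

end

section \<open>Integers with even exponents at the inert primes\<close>

lemma summable_ln_over_square: "summable (\<lambda>n::nat. ln (real n) / real n ^ 2)"
proof (rule summable_comparison_test')
  show "summable (\<lambda>n::nat. 2 * real n powr (-3/2))"
    by (intro summable_mult) (simp add: summable_real_powr_iff)
  fix n :: nat assume "n \<ge> 1"
  hence n: "real n \<ge> 1" by simp
  have "ln (real n) \<le> 2 * real n powr (1/2)" using ln_le_powr[of "real n" "1/2"] n by simp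
  hence "ln (real n) / real n ^ 2 \<le> 2 * real n powr (1/2) / real n powr 2"
    using n by (simp add: powr_realpow divide_right_mono)
  also have "\<dots> = 2 * real n powr (1/2 - 2)" by (simp only: powr_diff times_divide_eq_right)
  finally show "norm (ln (real n) / real n ^ 2) \<le> 2 * real n powr (-3/2)" using n by simp
qed

lemma sum_inverse_le: "x \<ge> 1 \<Longrightarrow> (\<Sum>n\<in>nats_upto x. 1 / real n) \<le> 1 + ln x"
proof -
  assume x: "x \<ge> 1"
  have *: "(\<Sum>n=1..N. 1 / real n) \<le> 1 + ln (real N)" if "N \<ge> 1" for N
    using that
  proof (induction N rule: dec_induct)
    case (step N)
    have "ln (real N / real (Suc N)) \<le> real N / real (Suc N) - 1" using step by (intro ln_le_minus_one) auto
    also have "\<dots> = - 1 / real (Suc N)" by (simp add: field_simps)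
    finally have "ln (real N) + 1 / real (Suc N) \<le> ln (real (Suc N))"
      using step by (subst (asm) ln_div) auto
    thus ?case using step by simp
  qed simp
  define N where "N = nat \<lfloor>x\<rfloor>"
  have N: "N \<ge> 1" "real N \<le> x" using x unfolding N_def by linarith+
  have "(\<Sum>n\<in>nats_upto x. 1 / real n) \<le> 1 + ln (real N)"
    unfolding nats_upto_eq N_def[symmetric] by (rule *[OF N(1)])
  thus ?thesis using N x by (smt (verit) ln_le_cancel_iff of_nat_1 of_nat_mono)
qed

text \<open>For each prime p the proper powers form a geometric series of size at most 2 ln p / p^2,
  which is summable over all p.\<close>

lemma mangoldt_nonprime_sum_bound:
  obtains C where "C \<ge> 0"
    "\<And>x. (\<Sum>d\<in>nats_upto x. if prime d then 0 else mangoldt d / real d) \<le> C"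
proof -
  define a where "a n = 2 * (ln (real n) / real n ^ 2)" for n :: nat
  have a0: "a n \<ge> 0" for n unfolding a_def by (cases "n = 0") auto
  have sa: "summable a" unfolding a_def by (intro summable_mult summable_ln_over_square)
  show ?thesis
  proof (rule that[of "suminf a"])
    show "suminf a \<ge> 0" by (intro suminf_nonneg sa a0)
    fix x :: real
    define K where "K = nat \<lfloor>x\<rfloor>"
    define P where "P = {p \<in> nats_upto x. prime p}"
    define S where "S = {d \<in> nats_upto x. primepow d \<and> \<not> prime d}"
    have fin: "finite P" "finite S" by (auto simp: P_def S_def)
    \<comment> \<open>Exponents up to \<open>K\<close> suffice, because k < 2^k <= p^k <= K.\<close>
    have sub: "S \<subseteq> (\<lambda>(p, k). p ^ k) ` (P \<times> {2..K})"
    proof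
      fix d assume d: "d \<in> S"
      hence "primepow d" "\<not> prime d" by (auto simp: S_def)
      then obtain p k where pk: "prime p" "k > 0" "d = p ^ k" unfolding primepow_def by auto
      with \<open>\<not> prime d\<close> have "k \<noteq> 1" by auto
      hence k: "k \<ge> 2" using pk by linarith
      have dK: "d \<le> K" using d by (auto simp: S_def nats_upto_eq K_def)
      have "k < 2 ^ k" by (rule less_exp)
      also have "(2::nat) ^ k \<le> p ^ k" using pk by (intro power_mono) (auto simp: prime_ge_2_nat)
      finally have "k \<le> K" using pk dK by simp
      moreover have "p \<le> d" using self_le_power[OF prime_ge_1_nat[OF pk(1)] pk(2)] pk by simp
      hence "real p \<le> real d" "real d \<le> x" using d by (simp_all add: S_def mem_nats_upto)
      hence "p \<in> P" using pk prime_gt_0_nat[of p] by (auto simp: P_def mem_nats_upto simp del: of_nat_power)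
      ultimately show "d \<in> (\<lambda>(p, k). p ^ k) ` (P \<times> {2..K})" using pk k by force
    qed
    have "(\<Sum>d\<in>nats_upto x. if prime d then 0 else mangoldt d / real d) = (\<Sum>d\<in>S. mangoldt d / real d)"
      by (rule sum.mono_neutral_cong_right) (auto simp: S_def mangoldt_def)
    also have "\<dots> \<le> (\<Sum>d\<in>(\<lambda>(p, k). p ^ k) ` (P \<times> {2..K}). mangoldt d / real d)"
      using fin sub by (intro sum_mono2) (auto simp: mangoldt_nonneg)
    also have "\<dots> \<le> (\<Sum>(p, k)\<in>P \<times> {2..K}. mangoldt (p ^ k) / real (p ^ k))"
      using fin sum_image_le[of "P \<times> {2..K}" "\<lambda>d. mangoldt d / real d" "\<lambda>(p, k). p ^ k"]
      by (simp add: mangoldt_nonneg case_prod_unfold o_def)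
    also have "\<dots> = (\<Sum>p\<in>P. \<Sum>k=2..K. mangoldt (p ^ k) / real (p ^ k))"
      by (simp add: sum.cartesian_product)
    also have "\<dots> \<le> (\<Sum>p\<in>P. a p)"
    proof (rule sum_mono)
      fix p assume "p \<in> P"
      hence p: "prime p" by (simp add: P_def)
      define q where "q = 1 / real p"
      have q: "q > 0" "q \<le> 1/2" using prime_ge_2_nat[OF p] by (auto simp: q_def field_simps)
      have geo: "(\<Sum>k=2..K. q ^ k) \<le> 2 * q ^ 2"
      proof -
        \<comment> \<open>The subtracted q^m is the slack that closes the induction, as 2 q <=
          1.\<close>
        have "(\<Sum>k=2..m. q ^ k) \<le> 2 * q ^ 2 - (if m \<ge> 2 then q ^ m else 0)" for m
        proof (induction m)
          case (Suc m)
          show ?case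
          proof (cases "m \<ge> 2")
            case True
            have "2 * q ^ Suc m \<le> q ^ m" using q mult_right_mono[of "2 * q" 1 "q ^ m"] by simp
            thus ?thesis using Suc True by simp
          next
            case False
            thus ?thesis using q by (cases "m = 1") (auto simp: numeral_2_eq_2)
          qed
        qed auto
        from this[of K] show ?thesis using q by (auto split: if_splits intro: order_trans)
      qed
      have "(\<Sum>k=2..K. mangoldt (p ^ k) / real (p ^ k)) = ln (real p) * (\<Sum>k=2..K. q ^ k)"
        unfolding sum_distrib_left using p by (intro sum.cong refl) (auto simp: q_def power_one_over)
      also have "\<dots> \<le> ln (real p) * (2 * q ^ 2)"
        using geo prime_ge_1_nat[OF p] by (intro mult_left_mono) auto
      finally show "(\<Sum>k=2..K. mangoldt (p ^ k) / real (p ^ k)) \<le> a p"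
        by (simp add: a_def q_def power_one_over field_simps)
    qed
    also have "\<dots> \<le> suminf a" by (intro sum_le_suminf sa fin) (auto simp: a0)
    finally show "(\<Sum>d\<in>nats_upto x. if prime d then 0 else mangoldt d / real d) \<le> suminf a" .
  qed
qed

section \<open>The counting function and its logarithmic relations\<close>

context real_character begin

definition admissible :: "nat \<Rightarrow> bool" where
  "admissible n \<longleftrightarrow> n > 0 \<and> (\<forall>p. prime p \<longrightarrow> chr p = -1 \<longrightarrow> even (multiplicity p n))"

definition f :: "nat \<Rightarrow> real" where "f n = of_bool (admissible n)"

definition B :: "real \<Rightarrow> real" where "B x = (\<Sum>n\<in>nats_upto x. f n)"

lemma f_range: "0 \<le> f n" "f n \<le> 1" by (auto simp: f_def)

lemma B_eq_card: "B x = real (card {n \<in> nats_upto x. admissible n})"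
  unfolding B_def f_def of_bool_def by (subst sum.inter_filter[symmetric]) auto

lemma B_nonneg: "B x \<ge> 0" unfolding B_def by (intro sum_nonneg f_range)

lemma B_le: "x \<ge> 0 \<Longrightarrow> B x \<le> x"
proof -
  assume "x \<ge> 0"
  have "B x \<le> (\<Sum>n\<in>nats_upto x. 1)" unfolding B_def by (intro sum_mono f_range)
  thus ?thesis using card_nats_upto_le[OF \<open>x \<ge> 0\<close>] by simp
qed

lemma f_prime_mult:
  assumes "prime p" "chr p \<noteq> -1" "m > 0" shows "f (p * m) = f m"
proof -
  have "multiplicity q (p * m) = multiplicity q m" if "prime q" "chr q = -1" for q
  proof -
    have "q \<noteq> p" using assms that by auto
    thus ?thesis using assms that
      by (subst prime_elem_multiplicity_mult_distrib) (auto simp: prime_gt_0_nat prime_multiplicity_other)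
  qed
  thus ?thesis using assms by (auto simp: f_def admissible_def prime_gt_0_nat)
qed

lemma f_inert_mult:
  assumes "prime p" "chr p = -1" "m > 0" "\<not> p dvd m" shows "f (p * m) = 0"
proof -
  have "multiplicity p (p * m) = 1"
    using multiplicity_prime_power_mult[of p m p 1] assms by simp
  thus ?thesis using assms by (auto simp: f_def admissible_def)
qed

text \<open>With ln = \<Lambda> * 1 the left sum becomes one of \<Lambda>(d) f(d m). A prime d with
  chi(d) = 1 leaves \<open>f\<close> unchanged and has l(d) / 2 = \<Lambda>(d). If chi(d) = -1, then
  l(d) = 0 and f(d m) vanishes unless d divides m, leaving at most x / d^2 terms. All other d have
  weights whose sum is bounded.\<close>

lemma sum_f_ln_bound:
  obtains C where "C > 0" "\<And>x. x \<ge> 1 \<Longrightarrow> \<bar>(\<Sum>n\<in>nats_upto x. f n * ln (real n)) - 1/2 * (\<Sum>n\<in>nats_upto x. l n * B (x / real n))\<bar> \<le> C * x"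
proof -
  \<comment> \<open>The error coefficient of d, divided by x: proper prime powers, ramified primes,
    and the second factor of an inert prime.\<close>
  define e where "e d = 2 * (if prime d then 0 else mangoldt d / real d)
    + 2 * (if d \<in> {p. prime p \<and> chr p = 0} then mangoldt d / real d else 0) + mangoldt d / real d ^ 2" for d
  obtain C1 where C1: "C1 \<ge> 0" "\<And>x. (\<Sum>d\<in>nats_upto x. if prime d then 0 else mangoldt d / real d) \<le> C1"
    using mangoldt_nonprime_sum_bound by blast
  define C2 where "C2 = (\<Sum>d | prime d \<and> chr d = 0. mangoldt d / real d)"
  define C3 where "C3 = (\<Sum>d. ln (real d) / real d ^ 2)"
  have C2: "C2 \<ge> 0" unfolding C2_def by (intro sum_nonneg) (auto simp: mangoldt_nonneg simp del: mangoldt_prime)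
  have ln0: "0 \<le> ln (real d) / real d ^ 2" for d :: nat by (cases "d = 0") auto
  have C3: "C3 \<ge> 0" unfolding C3_def by (intro suminf_nonneg summable_ln_over_square ln0)
  have e_sum: "(\<Sum>d\<in>nats_upto x. e d) \<le> 2 * C1 + 2 * C2 + C3" for x
  proof -
    have "(\<Sum>d\<in>nats_upto x. if d \<in> {p. prime p \<and> chr p = 0} then mangoldt d / real d else 0)
       = (\<Sum>d\<in>{d\<in>nats_upto x. d \<in> {p. prime p \<and> chr p = 0}}. mangoldt d / real d)"
      by (rule sum.inter_filter[symmetric]) simp
    also have "\<dots> \<le> C2"
      unfolding C2_def by (intro sum_mono2 finite_ramified) (auto simp: mangoldt_nonneg simp del: mangoldt_prime)
    finally have 2: "(\<Sum>d\<in>nats_upto x. if d \<in> {p. prime p \<and> chr p = 0} then mangoldt d / real d else 0) \<le> C2" .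
    have "(\<Sum>d\<in>nats_upto x. mangoldt d / real d ^ 2) \<le> (\<Sum>d\<in>nats_upto x. ln (real d) / real d ^ 2)"
      by (intro sum_mono divide_right_mono mangoldt_le) (auto simp: mem_nats_upto)
    also have "\<dots> \<le> C3" unfolding C3_def by (intro sum_le_suminf summable_ln_over_square) (auto simp: ln0)
    finally have 3: "(\<Sum>d\<in>nats_upto x. mangoldt d / real d ^ 2) \<le> C3" .
    show ?thesis using C1(2)[of x] 2 3
      unfolding e_def sum.distrib sum_distrib_left[symmetric] by linarith
  qed
  show ?thesis
  proof (rule that[of "2 * C1 + 2 * C2 + C3 + 1"])
    show "2 * C1 + 2 * C2 + C3 + 1 > 0" using C1(1) C2 C3 by linarith
    fix x :: real assume x: "x \<ge> 1"
    define N where "N d = (\<Sum>m\<in>nats_upto (x / real d). f (d * m))" for d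
    have N0: "N d \<ge> 0" for d unfolding N_def by (intro sum_nonneg f_range)
    have N1: "N d \<le> x / real d" for d
    proof -
      have "N d \<le> (\<Sum>m\<in>nats_upto (x / real d). 1)" unfolding N_def by (intro sum_mono f_range)
      thus ?thesis using card_nats_upto_le[of "x / real d"] x by simp
    qed
    have "(\<Sum>n\<in>nats_upto x. f n * ln (real n)) = (\<Sum>n\<in>nats_upto x. \<Sum>d | d dvd n. mangoldt d * f (d * (n div d)))"
    proof (intro sum.cong refl)
      fix n assume "n \<in> nats_upto x"
      hence "n > 0" by (simp add: mem_nats_upto)
      hence "f n * ln (real n) = (\<Sum>d | d dvd n. mangoldt d * f n)"
        using mangoldt_sum[of n, where ?'a = real] by (simp flip: sum_distrib_right)
      thus "f n * ln (real n) = (\<Sum>d | d dvd n. mangoldt d * f (d * (n div d)))" by simp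
    qed
    also have "\<dots> = (\<Sum>d\<in>nats_upto x. mangoldt d * N d)"
      by (subst sum_nats_upto_divisors) (simp add: N_def sum_distrib_left)
    finally have eq: "(\<Sum>n\<in>nats_upto x. f n * ln (real n)) = (\<Sum>d\<in>nats_upto x. mangoldt d * N d)" .
    have bnd: "\<bar>mangoldt d * N d - 1/2 * (l d * B (x / real d))\<bar> \<le> e d * x" if "d \<in> nats_upto x" for d
    proof -
      have d: "d > 0" using that by (simp add: mem_nats_upto)
      note L0 = mangoldt_nonneg[of d]
      have B1: "0 \<le> B (x / real d)" "B (x / real d) \<le> x / real d" using x by (auto intro: B_nonneg B_le)
      have l1: "0 \<le> l d" "l d \<le> 2 * mangoldt d"
        using l_nonneg[of d] L0 chi_range[of d] by (auto simp: l_def)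
      \<comment> \<open>Both quantities lie between 0 and \<Lambda>(d) x / d, since 0 <= l <= 2
        \<Lambda>.\<close>
      have triv: "\<bar>mangoldt d * N d - 1/2 * (l d * B (x / real d))\<bar> \<le> mangoldt d * (x / real d)"
      proof -
        have "mangoldt d * N d \<le> mangoldt d * (x / real d)" by (intro mult_left_mono N1 L0)
        moreover have "0 \<le> mangoldt d * N d" using L0 N0 by simp
        moreover have "l d * B (x / real d) \<le> (2 * mangoldt d) * (x / real d)" using l1 B1 L0 by (intro mult_mono) auto
        moreover have "0 \<le> l d * B (x / real d)" using l1 B1 by simp
        ultimately show ?thesis by linarith
      qed
      have e0: "0 \<le> mangoldt d / real d" "0 \<le> mangoldt d / real d ^ 2" using L0 by auto
      show ?thesis
      proof (cases "prime d \<and> chr d \<noteq> 0")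
        case False
        have "mangoldt d / real d \<le> e d" using False e0 by (auto simp: e_def)
        hence "mangoldt d / real d * x \<le> e d * x" using x by (intro mult_right_mono) auto
        thus ?thesis using triv by (simp add: mult.commute)
      next
        case True
        hence "chr d = 1 \<or> chr d = -1" using chi_range[of d] by auto
        thus ?thesis
        proof
          assume c: "chr d = 1"
          have "N d = B (x / real d)" unfolding N_def B_def
            by (intro sum.cong refl f_prime_mult) (use True c in \<open>auto simp: mem_nats_upto\<close>)
          hence "mangoldt d * N d - 1/2 * (l d * B (x / real d)) = 0" by (simp add: l_def c)
          moreover have "0 \<le> e d * x" using e0 x unfolding e_def by (intro mult_nonneg_nonneg add_nonneg_nonneg) auto
          ultimately show ?thesis by simp
        next
          assume c: "chr d = -1"
          have "N d \<le> (\<Sum>m\<in>nats_upto (x / real d). if d dvd m then 1 else 0)"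
            unfolding N_def by (intro sum_mono) (use True c f_inert_mult[of d] f_range in \<open>auto simp: mem_nats_upto\<close>)
          also have "\<dots> = (\<Sum>m\<in>{m \<in> nats_upto (x / real d). d dvd m}. 1)"
            by (rule sum.inter_filter[symmetric]) simp
          also have "\<dots> = real (card {m \<in> nats_upto (x / real d). d dvd m})" by simp
          also have "\<dots> \<le> real (card (nats_upto (x / real d / real d)))"
          proof -
            have "{m \<in> nats_upto (x / real d). d dvd m} \<subseteq> (\<lambda>k. d * k) ` nats_upto (x / real d / real d)"
              using d by (auto simp: mem_nats_upto field_simps elim!: dvdE)
            hence "card {m \<in> nats_upto (x / real d). d dvd m} \<le> card (nats_upto (x / real d / real d))"
              by (meson finite_nats_upto finite_imageI card_mono card_image_le order_trans)
            thus ?thesis by simp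
          qed
          also have "\<dots> \<le> x / real d / real d" using x by (intro card_nats_upto_le) auto
          finally have "N d \<le> x / real d ^ 2" by (simp add: power2_eq_square)
          hence "mangoldt d * N d \<le> mangoldt d * (x / real d ^ 2)" by (intro mult_left_mono L0)
          moreover have "0 \<le> mangoldt d * N d" using L0 N0 by simp
          ultimately show ?thesis using True c x by (simp add: l_def e_def)
        qed
      qed
    qed
    have "\<bar>(\<Sum>n\<in>nats_upto x. f n * ln (real n)) - 1/2 * (\<Sum>n\<in>nats_upto x. l n * B (x / real n))\<bar>
      = \<bar>\<Sum>d\<in>nats_upto x. mangoldt d * N d - 1/2 * (l d * B (x / real d))\<bar>"
      unfolding eq by (simp add: sum_subtractf sum_distrib_left)
    also have "\<dots> \<le> (\<Sum>d\<in>nats_upto x. e d) * x"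
      unfolding sum_distrib_right by (intro order_trans[OF sum_abs sum_mono] bnd)
    also have "\<dots> \<le> (2 * C1 + 2 * C2 + C3 + 1) * x" using e_sum[of x] x by (intro mult_right_mono) auto
    finally show "\<bar>(\<Sum>n\<in>nats_upto x. f n * ln (real n)) - 1/2 * (\<Sum>n\<in>nats_upto x. l n * B (x / real n))\<bar>
      \<le> (2 * C1 + 2 * C2 + C3 + 1) * x" .
  qed
qed

text \<open>Replacing ln n by ln x costs the sum of f(n) ln(x/n), which is O(x).\<close>

lemma B_ln_bound:
  obtains C where "C > 0" "\<And>x. x \<ge> 1 \<Longrightarrow> \<bar>B x * ln x - 1/2 * (\<Sum>n\<in>nats_upto x. l n * B (x / real n))\<bar> \<le> C * x"
proof -
  obtain C1 where C1: "C1 > 0" "\<And>x. x \<ge> 1 \<Longrightarrow> \<bar>(\<Sum>n\<in>nats_upto x. f n * ln (real n)) - 1/2 * (\<Sum>n\<in>nats_upto x. l n * B (x / real n))\<bar> \<le> C1 * x"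
    by (rule sum_f_ln_bound) auto
  obtain C2 where C2: "C2 > 0" "\<And>x. x \<ge> 0 \<Longrightarrow> (\<Sum>n\<in>nats_upto x. f n * ln (x / real n)) \<le> C2 * x"
    by (rule sum_ln_weight_bound[of f 1]) (use f_range B_le in \<open>auto simp: B_def\<close>)
  show ?thesis
  proof (rule that[of "C1 + C2"])
    fix x :: real assume x: "x \<ge> 1"
    have "B x * ln x - (\<Sum>n\<in>nats_upto x. f n * ln (real n)) = (\<Sum>n\<in>nats_upto x. f n * ln (x / real n))"
      unfolding B_def sum_distrib_right sum_subtractf[symmetric]
      by (intro sum.cong refl) (use x in \<open>auto simp: mem_nats_upto ln_div algebra_simps\<close>)
    moreover have "0 \<le> (\<Sum>n\<in>nats_upto x. f n * ln (x / real n))"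
      using x by (intro sum_nonneg mult_nonneg_nonneg f_range) (auto simp: mem_nats_upto)
    ultimately show "\<bar>B x * ln x - 1/2 * (\<Sum>n\<in>nats_upto x. l n * B (x / real n))\<bar> \<le> (C1 + C2) * x"
      using C1(2)[OF x] C2(2)[of x] x unfolding distrib_right by linarith
  qed (use C1 C2 in auto)
qed


text \<open>This crude bound is enough: it leads to errors of order x ln x, below the main term of
  order x (ln x)^(3/2).\<close>

lemma sum_f_over_n_le:
  assumes "x \<ge> 1" shows "(\<Sum>n\<in>nats_upto x. f n / real n) \<le> 1 + ln x"
proof -
  have "(\<Sum>n\<in>nats_upto x. f n / real n) \<le> (\<Sum>n\<in>nats_upto x. 1 / real n)"
    by (intro sum_mono divide_right_mono f_range) auto
  thus ?thesis using sum_inverse_le[OF assms] by linarith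
qed

text \<open>Iterating the relation between \<open>B ln\<close> and \<open>l * B\<close> produces the weights
  \<open>l * l\<close> and \<open>l ln\<close>; half of the second joins the first to form the
  weights of Selberg's formula, whose partial sums are known asymptotically.\<close>

lemma B_ln2_bound:
  obtains C where "C > 0" "\<And>x. x \<ge> 1 \<Longrightarrow>
    \<bar>B x * ln x ^ 2 - 1/2 * x * (\<Sum>n\<in>nats_upto x. f n / real n * ln (x / real n))
      - 1/4 * (\<Sum>m\<in>nats_upto x. l m * ln (real m) * B (x / real m))\<bar> \<le> C * x * (1 + ln x)"
proof -
  obtain C1 where C1: "C1 > 0" "\<And>x. x \<ge> 1 \<Longrightarrow> \<bar>B x * ln x - 1/2 * (\<Sum>n\<in>nats_upto x. l n * B (x / real n))\<bar> \<le> C1 * x"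
    by (rule B_ln_bound) auto
  obtain M where M: "M > 0" "\<And>x. x \<ge> 1 \<Longrightarrow> \<bar>(\<Sum>n\<in>nats_upto x. l n / real n) - ln x\<bar> \<le> M"
    by (rule mertens) auto
  obtain C2 where C2: "C2 > 0"
    "\<And>x. x \<ge> 1 \<Longrightarrow> \<bar>(\<Sum>n\<in>nats_upto x. l n * ln (real n)) + (\<Sum>n\<in>nats_upto x. l n * psi (x / real n))
        - 2 * x * ln x\<bar> \<le> C2 * x"
    by (rule selberg_formula) auto
  define T where "T x = (\<Sum>n\<in>nats_upto x. l n * B (x / real n))" for x
  define E where "E x = B x * ln x - 1/2 * T x" for x
  define S where "S x = (\<Sum>n\<in>nats_upto x. l n * ln (real n)) + (\<Sum>n\<in>nats_upto x. l n * psi (x / real n))" for x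
  define V where "V x = (\<Sum>m\<in>nats_upto x. l m * ln (real m) * B (x / real m))" for x
  have T_alt: "T x = (\<Sum>m\<in>nats_upto x. f m * psi (x / real m))" for x
    unfolding T_def B_def psi_def sum_distrib_left
    by (subst sum_nats_upto_swap) (simp add: mult.commute)
  \<comment> \<open>Summing Selberg's formula at x/m against f(m) reproduces the two unknown sums,
    \<open>V\<close> and the convolution of \<open>l\<close> with \<open>T\<close>.\<close>
  have fS: "(\<Sum>m\<in>nats_upto x. f m * S (x / real m)) = V x + (\<Sum>n\<in>nats_upto x. l n * T (x / real n))" for x
  proof -
    have "(\<Sum>m\<in>nats_upto x. f m * S (x / real m)) = (\<Sum>m\<in>nats_upto x. \<Sum>n\<in>nats_upto (x / real m). f m * (l n * ln (real n)))
       + (\<Sum>m\<in>nats_upto x. \<Sum>n\<in>nats_upto (x / real m). f m * (l n * psi (x / real m / real n)))"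
      by (simp add: S_def distrib_left sum.distrib sum_distrib_left)
    also have "(\<Sum>m\<in>nats_upto x. \<Sum>n\<in>nats_upto (x / real m). f m * (l n * ln (real n))) = V x"
      unfolding V_def B_def sum_distrib_left by (subst sum_nats_upto_swap) (simp add: mult_ac)
    also have "(\<Sum>m\<in>nats_upto x. \<Sum>n\<in>nats_upto (x / real m). f m * (l n * psi (x / real m / real n)))
      = (\<Sum>n\<in>nats_upto x. l n * T (x / real n))"
      unfolding T_alt sum_distrib_left by (subst sum_nats_upto_swap) (simp add: mult_ac)
    finally show ?thesis .
  qed
  show ?thesis
  proof (rule that[of "C2 + 3/2 * C1 * (1 + M)"])
    show "C2 + 3/2 * C1 * (1 + M) > 0" using C1 C2 M by (intro add_pos_pos mult_pos_pos) auto
    fix x :: real assume x: "x \<ge> 1"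
    hence lx: "ln x \<ge> 0" by simp
    define F where "F = (\<Sum>n\<in>nats_upto x. f n / real n * ln (x / real n))"
    define R1 where "R1 = (\<Sum>m\<in>nats_upto x. f m * (S (x / real m) - 2 * (x / real m) * ln (x / real m)))"
    define R2 where "R2 = (\<Sum>n\<in>nats_upto x. l n * E (x / real n))"
    have R1: "\<bar>R1\<bar> \<le> C2 * x * (1 + ln x)"
    proof -
      have "\<bar>R1\<bar> \<le> (\<Sum>m\<in>nats_upto x. C2 * x * (f m / real m))"
        unfolding R1_def
      proof (rule order_trans[OF sum_abs], rule sum_mono)
        fix m assume "m \<in> nats_upto x"
        hence m: "x / real m \<ge> 1" by (auto simp: mem_nats_upto)
        have "f m * \<bar>S (x / real m) - 2 * (x / real m) * ln (x / real m)\<bar> \<le> f m * (C2 * (x / real m))"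
          unfolding S_def using C2(2)[OF m] by (intro mult_left_mono f_range)
        thus "\<bar>f m * (S (x / real m) - 2 * (x / real m) * ln (x / real m))\<bar> \<le> C2 * x * (f m / real m)"
          unfolding abs_mult using f_range[of m] by (simp add: mult_ac)
      qed
      also have "\<dots> \<le> C2 * x * (1 + ln x)"
        unfolding sum_distrib_left[symmetric] using x C2 by (intro mult_left_mono sum_f_over_n_le) auto
      finally show ?thesis .
    qed
    have R2: "\<bar>R2\<bar> \<le> C1 * x * (M + ln x)"
    proof -
      have "\<bar>R2\<bar> \<le> (\<Sum>n\<in>nats_upto x. C1 * x * (l n / real n))"
        unfolding R2_def
      proof (rule order_trans[OF sum_abs], rule sum_mono)
        fix m assume "m \<in> nats_upto x"
        hence m: "x / real m \<ge> 1" by (auto simp: mem_nats_upto)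
        have "l m * \<bar>E (x / real m)\<bar> \<le> l m * (C1 * (x / real m))"
          unfolding E_def T_def using C1(2)[OF m] by (intro mult_left_mono l_nonneg)
        thus "\<bar>l m * E (x / real m)\<bar> \<le> C1 * x * (l m / real m)"
          unfolding abs_mult using l_nonneg[of m] by (simp add: mult_ac)
      qed
      also have "\<dots> \<le> C1 * x * (M + ln x)"
        unfolding sum_distrib_left[symmetric] using M(2)[OF x] x C1 by (intro mult_left_mono) auto
      finally show ?thesis .
    qed
    \<comment> \<open>Splitting ln x = ln n + ln(x/n) yields \<open>V\<close> and a sum over B(x/n)
      ln(x/n), where the first-order relation is inserted once more with error
      \<open>E\<close>.\<close>
    have lnT: "T x * ln x = V x + (\<Sum>n\<in>nats_upto x. l n * (B (x / real n) * ln (x / real n)))"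
      unfolding T_def V_def sum_distrib_right sum.distrib[symmetric]
      by (intro sum.cong refl) (use x in \<open>auto simp: mem_nats_upto ln_div algebra_simps\<close>)
    also have "(\<Sum>n\<in>nats_upto x. l n * (B (x / real n) * ln (x / real n)))
       = 1/2 * (\<Sum>n\<in>nats_upto x. l n * T (x / real n)) + R2"
      unfolding R2_def E_def by (simp add: algebra_simps sum.distrib sum_subtractf sum_distrib_left)
    finally have lnT: "T x * ln x = V x + 1/2 * (\<Sum>n\<in>nats_upto x. l n * T (x / real n)) + R2" by simp
    have R1': "(\<Sum>n\<in>nats_upto x. l n * T (x / real n)) = R1 + 2 * x * F - V x"
    proof -
      have "(\<Sum>m\<in>nats_upto x. f m * S (x / real m)) = R1 + 2 * x * F"
        unfolding R1_def F_def by (simp add: algebra_simps sum_subtractf sum_distrib_left)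
      thus ?thesis using fS[of x] by linarith
    qed
    \<comment> \<open>Eliminating the convolution of \<open>l\<close> with \<open>T\<close> by
      Selberg's formula leaves \<open>V\<close> with coefficient 1/2 - 1/4 and x * F with
      coefficient 1/2.\<close>
    have "B x * ln x ^ 2 = 1/2 * (T x * ln x) + E x * ln x"
      unfolding E_def by (simp add: power2_eq_square algebra_simps)
    also have "\<dots> = 1/2 * x * F + 1/4 * V x + (1/4 * R1 + 1/2 * R2 + E x * ln x)"
      unfolding lnT R1' by (simp add: field_simps)
    finally have eq: "B x * ln x ^ 2 - 1/2 * x * F - 1/4 * V x = 1/4 * R1 + 1/2 * R2 + E x * ln x" by simp
    have 3: "\<bar>E x * ln x\<bar> \<le> C1 * x * ln x"
      unfolding abs_mult using C1(2)[OF x] lx by (simp add: E_def T_def mult_right_mono)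
    have "0 \<le> C2 * x * (1 + ln x)" "0 \<le> C1 * x * (M + ln x)" "0 \<le> C1 * x * ln x"
      using x lx C1 C2 M by auto
    hence "\<bar>1/4 * R1 + 1/2 * R2 + E x * ln x\<bar> \<le> C2 * x * (1 + ln x) + 1/2 * (C1 * x * (M + ln x)) + C1 * x * ln x"
      using R1 R2 3 by linarith
    also have "\<dots> \<le> (C2 + C1 * (1 + M)) * x * (1 + ln x) + 1/2 * (C1 * x * (1 + M) * (1 + ln x))"
    proof -
      have "M + ln x \<le> (1 + M) * (1 + ln x)" using lx M by (simp add: algebra_simps)
      hence a: "C1 * x * (M + ln x) \<le> C1 * x * ((1 + M) * (1 + ln x))" using C1 x by (intro mult_left_mono) auto
      have "ln x \<le> (1 + M) * (1 + ln x)" using lx M by (simp add: algebra_simps)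
      hence b: "C1 * x * ln x \<le> C1 * x * ((1 + M) * (1 + ln x))" using C1 x by (intro mult_left_mono) auto
      show ?thesis using a b by (simp add: algebra_simps)
    qed
    finally have "\<bar>1/4 * R1 + 1/2 * R2 + E x * ln x\<bar> \<le> (C2 + 3/2 * C1 * (1 + M)) * x * (1 + ln x)"
      by (simp add: algebra_simps add_divide_distrib)
    thus "\<bar>B x * ln x ^ 2 - 1/2 * x * (\<Sum>n\<in>nats_upto x. f n / real n * ln (x / real n))
      - 1/4 * (\<Sum>m\<in>nats_upto x. l m * ln (real m) * B (x / real m))\<bar> \<le> (C2 + 3/2 * C1 * (1 + M)) * x * (1 + ln x)"
      using eq unfolding F_def V_def by simp
  qed
qed

text \<open>An a priori bound: in the first-order relation the sum over \<open>l\<close> is read as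
  a sum of f(m) psi(x/m) and estimated by Chebyshev. It later supplies the boundedness with which
  the contraction starts.\<close>

lemma B_le_log_mean:
  obtains C where "C > 0" "\<And>x. x \<ge> 1 \<Longrightarrow> B x * ln x \<le> C * x * (\<Sum>n\<in>nats_upto x. f n / real n)"
proof -
  obtain C1 where C1: "C1 > 0" "\<And>x. x \<ge> 1 \<Longrightarrow> \<bar>B x * ln x - 1/2 * (\<Sum>n\<in>nats_upto x. l n * B (x / real n))\<bar> \<le> C1 * x"
    by (rule B_ln_bound) auto
  obtain C2 where C2: "C2 > 0" "\<And>x. x \<ge> 0 \<Longrightarrow> psi x \<le> C2 * x" by (rule chebyshev) auto
  show ?thesis
  proof (rule that[of "C1 + C2"])
    fix x :: real assume x: "x \<ge> 1"
    define Lm where "Lm = (\<Sum>n\<in>nats_upto x. f n / real n)"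
    have "f 1 = 1" by (simp add: f_def admissible_def)
    hence "1 = (\<Sum>n\<in>{1}. f n / real n)" by simp
    also have "\<dots> \<le> Lm" unfolding Lm_def using x f_range by (intro sum_mono2) (auto simp: mem_nats_upto)
    finally have L1: "Lm \<ge> 1" .
    have "(\<Sum>n\<in>nats_upto x. l n * B (x / real n)) = (\<Sum>m\<in>nats_upto x. f m * psi (x / real m))"
      unfolding B_def psi_def sum_distrib_left
      by (subst sum_nats_upto_swap) (simp add: mult.commute)
    also have "\<dots> \<le> (\<Sum>m\<in>nats_upto x. f m * (C2 * (x / real m)))"
      using x by (intro sum_mono mult_left_mono C2 f_range) auto
    also have "\<dots> = C2 * x * Lm" by (simp add: Lm_def sum_distrib_left mult_ac)
    finally have "B x * ln x \<le> 1/2 * (C2 * x * Lm) + C1 * x" using C1(2)[OF x] by linarith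
    moreover have "C1 * x \<le> C1 * x * Lm" using mult_left_mono[OF L1, of "C1 * x"] x C1 by simp
    moreover have "0 \<le> C2 * x * Lm" using C2 x L1 by simp
    ultimately have "B x * ln x \<le> (C1 + C2) * x * Lm" unfolding distrib_right by linarith
    thus "B x * ln x \<le> (C1 + C2) * x * (\<Sum>n\<in>nats_upto x. f n / real n)" unfolding Lm_def .
  qed (use C1 C2 in auto)
qed

end

section \<open>Karamata's theorem for a tent function\<close>

text \<open>Gamma(1/2) after the substitution t -> (k + 1) t: the moments, in the variable exp(-t),
  of the measure exp(-t) t^(-1/2) dt.\<close>

lemma half_moment_has_integral:
  "((\<lambda>t. indicator {0..} t * (exp (-t) ^ k * (exp (-t) * t powr (-1/2)))) has_integral sqrt pi / sqrt (real (Suc k))) UNIV"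
proof -
  define F :: "real \<Rightarrow> real" where "F t = indicator {0..} t * t powr (1/2 - 1) / exp t" for t
  define c where "c = real (Suc k)"
  have c: "c > 0" by (simp add: c_def)
  have [measurable]: "F \<in> borel_measurable borel" unfolding F_def by measurable
  have "has_bochner_integral lborel F (Gamma (1/2))"
  proof (rule has_bochner_integral_nn_integral)
    show "(\<integral>\<^sup>+ t. ennreal (F t) \<partial>lborel) = ennreal (Gamma (1/2))"
      using Gamma_conv_nn_integral_real[of "1/2"] by (simp add: F_def)
  qed (auto simp: F_def Gamma_one_half_real)
  hence "has_bochner_integral lborel (\<lambda>t. F (0 + c * t)) (Gamma (1/2) /\<^sub>R \<bar>c\<bar>)"
    using c by (subst (asm) lborel_has_bochner_integral_real_affine_iff[of c _ _ 0]) auto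
  hence "has_bochner_integral lborel (\<lambda>t. sqrt c * F (0 + c * t)) (sqrt c * (Gamma (1/2) /\<^sub>R \<bar>c\<bar>))"
    by (intro has_bochner_integral_mult_right) auto
  also have "(\<lambda>t. sqrt c * F (0 + c * t)) = (\<lambda>t. indicator {0..} t * (exp (-t) ^ k * (exp (-t) * t powr (-1/2))))"
  proof
    fix t :: real
    show "sqrt c * F (0 + c * t) = indicator {0..} t * (exp (-t) ^ k * (exp (-t) * t powr (-1/2)))"
    proof (cases "t \<ge> 0")
      case True
      have "sqrt c * c powr (-1/2) = 1"
        using c by (simp add: powr_half_sqrt[symmetric] flip: powr_add)
      moreover have "(c * t) powr (-1/2) = c powr (-1/2) * t powr (-1/2)"
        by (rule powr_mult)
      ultimately have "sqrt c * (c * t) powr (-1/2) = t powr (-1/2)"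
        by (simp only: mult.assoc[symmetric])
      moreover have "exp (-t) ^ k * exp (-t) = inverse (exp (c * t))"
        unfolding c_def by (simp add: exp_of_nat_mult[symmetric] exp_minus[symmetric] exp_add[symmetric] algebra_simps)
      ultimately show ?thesis using True c
        by (simp add: F_def field_simps)
    next
      case False
      hence "c * t < 0" using c by (simp add: mult_pos_neg)
      thus ?thesis using False by (simp add: F_def)
    qed
  qed
  also have "sqrt c * (Gamma (1/2) /\<^sub>R \<bar>c\<bar>) = sqrt pi / sqrt c"
    using c by (simp add: Gamma_one_half_real field_simps)
  finally have hb: "integrable lborel (\<lambda>t::real. indicator {0..} t * (exp (-t) ^ k * (exp (-t) * t powr (-1/2))))"
    "integral\<^sup>L lborel (\<lambda>t::real. indicator {0..} t * (exp (-t) ^ k * (exp (-t) * t powr (-1/2)))) = sqrt pi / sqrt c"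
    unfolding has_bochner_integral_iff by auto
  show ?thesis using has_integral_integral_lborel[OF hb(1)] unfolding hb(2) c_def .
qed

text \<open>The value Beta(1/2, 2), with antiderivative 2 t^(1/2) - 2/3 t^(3/2).\<close>

lemma tent_has_integral:
  "((\<lambda>t::real. if t \<in> {0..1} then (1 - t) * t powr (-1/2) else 0) has_integral 4/3) UNIV"
proof -
  define G :: "real \<Rightarrow> real" where "G t = 2 * sqrt t - 2/3 * (t * sqrt t)" for t
  have "((\<lambda>t. (1 - t) * t powr (-1/2)) has_integral (G 1 - G 0)) {0..1}"
  proof (rule fundamental_theorem_of_calculus_interior)
    show "continuous_on {0..1} G" unfolding G_def by (intro continuous_intros)
    fix t :: real assume t: "t \<in> {0<..<1}"
    have sq: "sqrt t * sqrt t = t" "sqrt t > 0" using t by auto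
    have "(G has_real_derivative (2 * (inverse (sqrt t) / 2) - 2/3 * (1 * sqrt t + inverse (sqrt t) / 2 * t))) (at t)"
      unfolding G_def using t by (auto intro!: derivative_eq_intros simp: field_simps)
    also have "2 * (inverse (sqrt t) / 2) - 2/3 * (1 * sqrt t + inverse (sqrt t) / 2 * t) = (1 - t) * t powr (-1/2)"
    proof -
      have "t powr (-1/2) = inverse (sqrt t)" using t by (simp add: powr_minus powr_half_sqrt)
      moreover have "t * inverse (sqrt t) = sqrt t" using sq by (simp add: field_simps)
      ultimately show ?thesis by (simp add: algebra_simps)
    qed
    finally show "(G has_vector_derivative (1 - t) * t powr (-1/2)) (at t)"
      by (simp add: has_real_derivative_iff_has_vector_derivative)
  qed simp
  also have "G 1 - G 0 = 4/3" by (simp add: G_def)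
  finally show ?thesis by (subst has_integral_restrict_UNIV)
qed

text \<open>Karamata's Tauberian argument: the test function is continuous, so approximating it uniformly
  by polynomials, whose transforms are known, suffices.\<close>

lemma karamata_tent:
  fixes a :: "nat \<Rightarrow> real"
  assumes a: "\<And>n. a n \<ge> 0" and a0: "a 0 = 0"
    and sm: "\<And>d. d > 0 \<Longrightarrow> summable (\<lambda>n. a n * real n powr (-d))"
    and lim: "((\<lambda>d. sqrt d * (\<Sum>n. a n * real n powr (-d))) \<longlongrightarrow> C) (at_right 0)"
  shows "((\<lambda>x. (\<Sum>n\<in>nats_upto x. a n * ln (x / real n)) / ln x powr (3/2)) \<longlongrightarrow> 4/3 * C / sqrt pi) at_top"
proof -
  define \<Phi> where "\<Phi> d = (\<Sum>n. a n * real n powr (-d))" for d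
  define q where "q d n = real n powr (-d)" for d and n :: nat
  \<comment> \<open>For u = exp(-t) the product u * g(u) is the tent 1 - t on [0, 1] and 0 beyond.
    As the tent vanishes at the cutoff t = 1, \<open>g\<close> is continuous on the unit
    interval.\<close>
  define g :: "real \<Rightarrow> real" where "g u = (if u \<le> exp (-1) then 0 else (1 + ln u) / u)" for u
  define W where "W d p = sqrt d * (\<Sum>n. a n * q d n * p (q d n))" for d and p :: "real \<Rightarrow> real"
  define \<kappa> where "\<kappa> = 4/3 / sqrt pi"
  have q01: "q d n \<in> {0..1}" if "d > 0" for d n
  proof (cases "n = 0")
    case False
    hence "real n powr (-d) \<le> real n powr 0" using that by (intro powr_mono) auto
    thus ?thesis using False by (simp add: q_def)
  qed (simp add: q_def)
  have \<Phi>0: "\<Phi> d \<ge> 0" if "d > 0" for d unfolding \<Phi>_def by (intro suminf_nonneg sm that) (simp add: a)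
  have C0: "C \<ge> 0"
    by (rule tendsto_lowerbound[OF lim])
       (auto simp: eventually_at_right_field \<Phi>0[unfolded \<Phi>_def] intro!: exI[of _ 1])
  have g_cont: "continuous_on {0..1} g"
  proof -
    have "u > 0" if "u \<in> {exp (-1)..1}" for u :: real
      using that less_le_trans[OF exp_gt_zero[of "-1::real"]] by auto
    hence "continuous_on {exp (-1)..1} (\<lambda>u::real. (1 + ln u) / u)"
      by (intro continuous_intros) force+
    hence "continuous_on ({0..exp (-1)} \<union> {exp (-1)..1}) (\<lambda>u::real. if u \<le> exp (-1) then 0 else (1 + ln u) / u)"
      by (intro continuous_on_cases) auto
    moreover have "0 \<le> exp (-1::real)" "exp (-1::real) \<le> 1" by auto
    moreover have "{0..exp (-1)} \<union> {exp (-1)..1} = {0..1::real}"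
      by (rule ivl_disj_un_two_touch) auto
    ultimately show ?thesis unfolding g_def by simp
  qed
  have W_lim: "((\<lambda>d. W d g) \<longlongrightarrow> C * \<kappa>) (at_right 0)"
  proof (rule tendstoI)
    fix e :: real assume e: "e > 0"
    \<comment> \<open>Three errors will appear, \<epsilon> (C + 1), \<epsilon> and C \<epsilon>;
      together they stay below e.\<close>
    define \<epsilon> where "\<epsilon> = e / (2 * C + 3)"
    have \<epsilon>: "\<epsilon> > 0" using e C0 by (simp add: \<epsilon>_def)
    obtain p where p: "real_polynomial_function p" "\<And>u. u \<in> {0..1} \<Longrightarrow> \<bar>g u - p u\<bar> < \<epsilon>"
      using Stone_Weierstrass_real_polynomial_function[OF compact_Icc g_cont \<epsilon>] by blast
    then obtain c N where pc: "p = (\<lambda>x. \<Sum>i\<le>N. c i * x ^ i)"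
      using real_polynomial_function_iff_sum by blast
    define J where "J = (\<Sum>i\<le>N. c i / sqrt (real (Suc i)))"
    have qpow: "q d n * q d n ^ i = real n powr (- (real (Suc i) * d))" for d n i
    proof -
      have "q d n ^ Suc i = real n powr (- (real (Suc i) * d))"
        unfolding q_def by (cases "n = 0") (simp_all add: powr_powr[symmetric] powr_realpow[symmetric] powr_powr mult_ac del: power_Suc of_nat_Suc)
      thus ?thesis by simp
    qed
    \<comment> \<open>The monomial u^i replaces d by (i + 1) d, and the factor sqrt d turns this
      into the weight 1 / sqrt(i + 1), the same as in the moment integrals up to sqrt pi.\<close>
    have WP: "W d p = (\<Sum>i\<le>N. c i / sqrt (real (Suc i)) * (sqrt (real (Suc i) * d) * \<Phi> (real (Suc i) * d)))" if d: "d > 0" for d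
    proof -
      have "(\<lambda>n. \<Sum>i\<le>N. c i * (a n * real n powr (- (real (Suc i) * d)))) sums (\<Sum>i\<le>N. c i * \<Phi> (real (Suc i) * d))"
        unfolding \<Phi>_def using d by (intro sums_sum sums_mult summable_sums sm) auto
      also have "(\<lambda>n. \<Sum>i\<le>N. c i * (a n * real n powr (- (real (Suc i) * d)))) = (\<lambda>n. a n * q d n * p (q d n))"
        unfolding pc qpow[symmetric] by (simp add: sum_distrib_left mult_ac)
      finally have "W d p = sqrt d * (\<Sum>i\<le>N. c i * \<Phi> (real (Suc i) * d))" unfolding W_def by (simp add: sums_iff)
      also have "\<dots> = (\<Sum>i\<le>N. c i / sqrt (real (Suc i)) * (sqrt (real (Suc i) * d) * \<Phi> (real (Suc i) * d)))"
        unfolding sum_distrib_left by (intro sum.cong refl) (simp add: real_sqrt_mult del: of_nat_Suc)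
      finally show ?thesis .
    qed
    have WP_lim: "((\<lambda>d. W d p) \<longlongrightarrow> C * J) (at_right 0)"
    proof -
      have "((\<lambda>d. \<Sum>i\<le>N. c i / sqrt (real (Suc i)) * (sqrt (real (Suc i) * d) * \<Phi> (real (Suc i) * d)))
          \<longlongrightarrow> (\<Sum>i\<le>N. c i / sqrt (real (Suc i)) * C)) (at_right 0)"
      proof (intro tendsto_sum tendsto_mult tendsto_const)
        fix i
        have "filterlim (\<lambda>d. real (Suc i) * d) (at_right 0) (at_right (0::real))"
          by (intro filterlim_at_withinI tendsto_eq_intros)
             (auto simp: eventually_at_right_field intro!: exI[of _ 1])
        from filterlim_compose[OF lim[folded \<Phi>_def] this]
        show "((\<lambda>d. sqrt (real (Suc i) * d) * \<Phi> (real (Suc i) * d)) \<longlongrightarrow> C) (at_right 0)" .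
      qed
      also have "(\<Sum>i\<le>N. c i / sqrt (real (Suc i)) * C) = C * J" by (simp add: J_def sum_distrib_left mult_ac)
      finally show ?thesis
        by (rule Lim_transform_eventually) (auto simp: eventually_at_right_field WP intro!: exI[of _ 1])
    qed
    \<comment> \<open>The uniform bound |g - p| < \<epsilon> is integrated against a measure of
      total mass sqrt pi; this compares the polynomial's constant with the tent's.\<close>
    have J: "\<bar>J - \<kappa>\<bar> \<le> \<epsilon>"
    proof -
      define w where "w t = indicator {0..} t * (exp (-t) * t powr (-1/2))" for t :: real
      have w0: "w t \<ge> 0" for t by (simp add: w_def)
      have w: "((\<lambda>t. \<epsilon> * w t) has_integral (\<epsilon> * sqrt pi)) UNIV"
        using half_moment_has_integral[of 0] unfolding w_def by (intro has_integral_mult_right) simp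
      have "((\<lambda>t. \<Sum>i\<le>N. c i * (exp (-t) ^ i * w t)) has_integral (\<Sum>i\<le>N. c i * (sqrt pi / sqrt (real (Suc i))))) UNIV"
        by (intro has_integral_sum has_integral_mult_right)
           (use half_moment_has_integral in \<open>auto simp: w_def mult_ac\<close>)
      also have "(\<lambda>t. \<Sum>i\<le>N. c i * (exp (-t) ^ i * w t)) = (\<lambda>t. p (exp (-t)) * w t)"
        by (simp add: pc sum_distrib_left sum_distrib_right mult_ac)
      also have "(\<Sum>i\<le>N. c i * (sqrt pi / sqrt (real (Suc i)))) = sqrt pi * J"
        by (simp add: J_def sum_distrib_left mult_ac)
      finally have P: "((\<lambda>t. p (exp (-t)) * w t) has_integral (sqrt pi * J)) UNIV" .
      have G: "((\<lambda>t. g (exp (-t)) * w t) has_integral 4/3) UNIV"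
      proof -
        have "g (exp (-t)) * w t = (if t \<in> {0..1} then (1 - t) * t powr (-1/2) else 0)" for t
        proof (cases "0 \<le> t \<and> t < 1")
          case True
          hence "g (exp (-t)) = (1 - t) / exp (-t)" by (simp add: g_def)
          thus ?thesis using True by (simp add: w_def)
        next
          case False
          thus ?thesis by (cases "t = 1") (auto simp: g_def w_def)
        qed
        thus ?thesis using tent_has_integral by simp
      qed
      have D: "((\<lambda>t. p (exp (-t)) * w t - g (exp (-t)) * w t) has_integral (sqrt pi * J - 4/3)) UNIV"
        by (intro has_integral_diff P G)
      have bound: "\<bar>p (exp (-t)) * w t - g (exp (-t)) * w t\<bar> \<le> \<epsilon> * w t" for t
      proof (cases "t \<ge> 0")
        case True
        hence "\<bar>g (exp (-t)) - p (exp (-t))\<bar> \<le> \<epsilon>" using p(2)[of "exp (-t)"] by auto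
        hence "\<bar>g (exp (-t)) - p (exp (-t))\<bar> * w t \<le> \<epsilon> * w t" by (intro mult_right_mono w0)
        also have "\<bar>g (exp (-t)) - p (exp (-t))\<bar> * w t = \<bar>p (exp (-t)) * w t - g (exp (-t)) * w t\<bar>"
          using w0[of t] by (simp add: abs_mult abs_minus_commute flip: left_diff_distrib)
        finally show ?thesis .
      qed (simp add: w_def)
      have "sqrt pi * J - 4/3 \<le> \<epsilon> * sqrt pi"
        using bound by (intro has_integral_le[OF D w]) (simp add: abs_le_iff)
      moreover have "- (\<epsilon> * sqrt pi) \<le> sqrt pi * J - 4/3"
      proof (rule has_integral_le[OF has_integral_neg[OF w] D])
        show "- (\<epsilon> * w t) \<le> p (exp (-t)) * w t - g (exp (-t)) * w t" for t
          using bound[of t] by linarith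
      qed
      ultimately have "\<bar>sqrt pi * J - 4/3\<bar> \<le> \<epsilon> * sqrt pi" by linarith
      also have "sqrt pi * J - 4/3 = sqrt pi * (J - \<kappa>)" by (simp add: \<kappa>_def algebra_simps)
      finally show ?thesis by (simp add: abs_mult)
    qed
    have diff: "\<bar>W d g - W d p\<bar> \<le> \<epsilon> * (sqrt d * \<Phi> d)" if d: "d > 0" for d
    proof -
      have s: "summable (\<lambda>n. \<epsilon> * (a n * q d n))" unfolding q_def using sm[OF d] by (intro summable_mult)
      have b: "\<bar>a n * q d n * g (q d n) - a n * q d n * p (q d n)\<bar> \<le> \<epsilon> * (a n * q d n)" for n
      proof -
        have "\<bar>g (q d n) - p (q d n)\<bar> * (a n * q d n) \<le> \<epsilon> * (a n * q d n)"
          using p(2)[OF q01[OF d, of n]] q01[OF d, of n] a[of n] by (intro mult_right_mono) auto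
        thus ?thesis using a[of n] q01[OF d, of n] by (simp add: abs_mult mult_ac flip: right_diff_distrib)
      qed
      have sp: "summable (\<lambda>n. a n * q d n * p (q d n))"
      proof -
        have "summable (\<lambda>n. \<Sum>i\<le>N. c i * (a n * real n powr (- (real (Suc i) * d))))"
          using d by (intro summable_sum summable_mult sm) auto
        also have "(\<lambda>n. \<Sum>i\<le>N. c i * (a n * real n powr (- (real (Suc i) * d)))) = (\<lambda>n. a n * q d n * p (q d n))"
          unfolding pc qpow[symmetric] by (simp add: sum_distrib_left mult_ac)
        finally show ?thesis .
      qed
      have sd: "summable (\<lambda>n. a n * q d n * g (q d n) - a n * q d n * p (q d n))"
        by (rule summable_comparison_test'[OF s, of 0]) (use b in auto)
      have sg: "summable (\<lambda>n. a n * q d n * g (q d n))"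
        using summable_add[OF sd sp] by simp
      have "W d g - W d p = sqrt d * (\<Sum>n. a n * q d n * g (q d n) - a n * q d n * p (q d n))"
        unfolding W_def suminf_diff[OF sg sp, symmetric] by (simp add: right_diff_distrib)
      also have "\<bar>\<dots>\<bar> \<le> sqrt d * (\<Sum>n. \<epsilon> * (a n * q d n))"
      proof -
        have "norm (\<Sum>n. a n * q d n * g (q d n) - a n * q d n * p (q d n)) \<le> (\<Sum>n. \<epsilon> * (a n * q d n))"
          by (rule norm_suminf_le[OF _ s]) (use b in auto)
        thus ?thesis using d by (simp add: abs_mult mult_left_mono)
      qed
      also have "(\<Sum>n. \<epsilon> * (a n * q d n)) = \<epsilon> * \<Phi> d"
        unfolding \<Phi>_def q_def using sm[OF d] by (rule suminf_mult)
      finally show ?thesis by (simp add: mult_ac)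
    qed
    have "\<forall>\<^sub>F d in at_right 0. sqrt d * \<Phi> d < C + 1"
      using lim unfolding \<Phi>_def[symmetric] by (rule order_tendstoD) simp
    moreover have "\<forall>\<^sub>F d in at_right 0. dist (W d p) (C * J) < \<epsilon>" using WP_lim \<epsilon> by (rule tendstoD)
    moreover have "\<forall>\<^sub>F d in at_right (0::real). d > 0" by (simp add: eventually_at_right_less)
    ultimately show "\<forall>\<^sub>F d in at_right 0. dist (W d g) (C * \<kappa>) < e"
    proof eventually_elim
      case (elim d)
      have 1: "\<bar>W d g - W d p\<bar> \<le> \<epsilon> * (C + 1)"
        using diff[of d] elim mult_left_mono[of "sqrt d * \<Phi> d" "C + 1" \<epsilon>] \<epsilon> by linarith
      have 2: "\<bar>C * J - C * \<kappa>\<bar> \<le> C * \<epsilon>"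
        using mult_left_mono[OF J C0] C0 by (simp add: abs_mult flip: right_diff_distrib)
      have "\<bar>W d g - C * \<kappa>\<bar> < \<epsilon> * (C + 1) + \<epsilon> + C * \<epsilon>"
        using 1 2 elim unfolding dist_real_def by linarith
      also have "\<dots> \<le> \<epsilon> * (2 * C + 3)" using \<epsilon> by (simp add: algebra_simps)
      also have "\<dots> = e" using C0 by (simp add: \<epsilon>_def)
      finally show ?case by (simp add: dist_real_def)
    qed
  qed
  \<comment> \<open>For d = 1 / ln x the index n sits at t = ln n / ln x, so the tent becomes
    ln(x/n) / ln x and is cut off at n = x.\<close>
  have "filterlim (\<lambda>x::real. 1 / ln x) (at_right 0) at_top" by real_asymp
  from filterlim_compose[OF W_lim this]
  have "((\<lambda>x. W (1 / ln x) g) \<longlongrightarrow> C * \<kappa>) at_top" .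
  moreover have "\<forall>\<^sub>F x in at_top. W (1 / ln x) g = (\<Sum>n\<in>nats_upto x. a n * ln (x / real n)) / ln x powr (3/2)"
    using eventually_gt_at_top[of 1]
  proof eventually_elim
    case (elim x)
    define u where "u = ln x"
    have u: "u > 0" using elim by (simp add: u_def)
    have bnd: "a n * q (1 / u) n * g (q (1 / u) n) = (if n \<in> nats_upto x then a n * ln (x / real n) / u else 0)" for n
    proof (cases "n = 0")
      case False
      hence q: "q (1 / u) n = exp (- (ln (real n) / u))" "q (1 / u) n > 0" by (simp_all add: q_def powr_def)
      have "q (1 / u) n \<le> exp (-1) \<longleftrightarrow> u \<le> ln (real n)" unfolding q(1) exp_le_cancel_iff using u by (simp add: field_simps)
      also have "\<dots> \<longleftrightarrow> x \<le> real n" unfolding u_def using elim False by simp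
      finally have iff: "q (1 / u) n \<le> exp (-1) \<longleftrightarrow> x \<le> real n" .
      have lnq: "ln (q (1 / u) n) = - (ln (real n) / u)" unfolding q(1) by simp
      have lnx: "ln (x / real n) / u = 1 + ln (q (1 / u) n)"
        unfolding lnq using u elim False by (simp add: ln_div u_def field_simps)
      show ?thesis
      proof (cases "x \<le> real n")
        case True
        hence "g (q (1 / u) n) = 0" using iff by (simp add: g_def)
        moreover have "n \<in> nats_upto x \<Longrightarrow> x = real n" using True by (auto simp: mem_nats_upto)
        ultimately show ?thesis using elim by auto
      next
        case False
        hence "g (q (1 / u) n) = (ln (x / real n) / u) / q (1 / u) n" using iff lnx by (simp add: g_def)
        moreover have "n \<in> nats_upto x" using False \<open>n \<noteq> 0\<close> by (simp add: mem_nats_upto)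
        ultimately show ?thesis using q(2) by simp
      qed
    qed (simp add: a0 mem_nats_upto)
    have "W (1 / u) g = sqrt (1 / u) * (\<Sum>n\<in>nats_upto x. a n * ln (x / real n) / u)"
      unfolding W_def bnd by (subst suminf_finite[of "nats_upto x"]) auto
    also have "\<dots> = (\<Sum>n\<in>nats_upto x. a n * ln (x / real n)) / (u * sqrt u)"
      by (simp add: sum_divide_distrib[symmetric] real_sqrt_divide)
    also have "u * sqrt u = u powr (3/2)"
      using u powr_add[of u 1 "1/2"] by (simp add: powr_half_sqrt)
    finally show ?case unfolding u_def .
  qed
  ultimately have "((\<lambda>x. (\<Sum>n\<in>nats_upto x. a n * ln (x / real n)) / ln x powr (3/2)) \<longlongrightarrow> C * \<kappa>) at_top"
    by (rule Lim_transform_eventually)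
  thus ?thesis by (simp add: \<kappa>_def mult_ac)
qed

section \<open>Euler products\<close>

lemma nonneg_summable_has_sum:
  fixes a :: "nat \<Rightarrow> real"
  assumes "\<And>n. a n \<ge> 0" "summable a"
  shows "(a has_sum suminf a) UNIV"
  using assms by (intro norm_summable_imp_has_sum) (auto simp: summable_sums)

text \<open>When N is prime, each (N + 1)-smooth number is N^k m for a unique k and a unique m free
  of N, so the sum factors. Unordered sums of nonnegative terms justify the rearrangement over this
  infinite set.\<close>

lemma smooth_infsum_eq_prod:
  fixes a :: "nat \<Rightarrow> real"
  assumes a: "\<And>n. a n \<ge> 0" and a1: "a 1 = 1" and sm: "summable a"
    and mult: "\<And>p k m. prime p \<Longrightarrow> \<not> p dvd m \<Longrightarrow> m > 0 \<Longrightarrow> a (p ^ k * m) = a (p ^ k) * a m"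
  shows "infsum a {n. n > 0 \<and> (\<forall>p. prime p \<longrightarrow> p dvd n \<longrightarrow> p < N)}
    = (\<Prod>p<N. if prime p then (\<Sum>k. a (p ^ k)) else 1)"
proof (induction N)
  define S where "S N = {n::nat. n > 0 \<and> (\<forall>p. prime p \<longrightarrow> p dvd n \<longrightarrow> p < N)}" for N
  have aU: "a summable_on A" for A
    using nonneg_summable_has_sum[OF a sm] summable_on_subset_banach[of a UNIV A]
    by (auto simp: summable_on_def)
  {
    case 0
    have "S 0 = {1}" unfolding S_def using prime_factor_nat by auto
    thus ?case using a1 by (simp add: S_def)
  next
    case (Suc N)
    show ?case
    proof (cases "prime N")
      case False
      hence "S (Suc N) = S N" unfolding S_def by (auto simp: less_Suc_eq)
      thus ?thesis using Suc False by (simp add: S_def)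
    next
      case True
      define g where "g = (\<lambda>(k, m). N ^ k * m)"
      have N_S: "\<not> N dvd m" "m > 0" if "m \<in> S N" for m using that True by (auto simp: S_def)
      have inj: "inj_on g (UNIV \<times> S N)"
      proof (rule inj_onI, clarify)
        fix i m j m' assume h: "m \<in> S N" "m' \<in> S N" "g (i, m) = g (j, m')"
        have "multiplicity N (N ^ i * m) = i" "multiplicity N (N ^ j * m') = j"
          using h N_S multiplicity_prime_power_mult[of N _ N] True by auto
        hence "i = j" using h by (simp add: g_def)
        thus "i = j \<and> m = m'" using h True by (auto simp: g_def)
      qed
      have img: "g ` (UNIV \<times> S N) = S (Suc N)"
      proof (intro equalityI subsetI)
        fix n assume "n \<in> g ` (UNIV \<times> S N)"
        then obtain k m where n: "n = N ^ k * m" "m \<in> S N" by (auto simp: g_def)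
        have "p < Suc N" if p: "prime p" "p dvd n" for p
        proof -
          have "p dvd N ^ k \<or> p dvd m" using p n by (simp add: prime_dvd_mult_iff)
          thus ?thesis
          proof
            assume "p dvd N ^ k"
            hence "p = N" using p True prime_dvd_power primes_dvd_imp_eq by blast
            thus ?thesis by simp
          next
            assume "p dvd m"
            thus ?thesis using n p by (auto simp: S_def less_Suc_eq)
          qed
        qed
        moreover have "n > 0" using n(1) N_S(2)[OF n(2)] prime_gt_0_nat[OF True] by simp
        ultimately show "n \<in> S (Suc N)" unfolding S_def by blast
      next
        fix n assume n: "n \<in> S (Suc N)"
        obtain m where m: "n = N ^ multiplicity N n * m" "\<not> N dvd m"
          using multiplicity_decompose'[of n N] prime_gt_1_nat[OF True] n by (auto simp: S_def)
        have "p < N" if "prime p" "p dvd m" for p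
        proof -
          have "p dvd n" using that m(1) by (metis dvd_mult)
          hence "p < Suc N" using n that by (auto simp: S_def)
          moreover have "p \<noteq> N" using that m by auto
          ultimately show ?thesis by simp
        qed
        moreover have "m > 0" using n m by (cases m) (auto simp: S_def)
        ultimately have "m \<in> S N" by (auto simp: S_def)
        hence "g (multiplicity N n, m) \<in> g ` (UNIV \<times> S N)" by blast
        thus "n \<in> g ` (UNIV \<times> S N)" using m(1) by (simp add: g_def)
      qed
      have eq: "a (g (k, m)) = a (N ^ k) * a m" if "m \<in> S N" for k m
        unfolding g_def using mult[OF True N_S[OF that]] by simp
      have "infsum a (S (Suc N)) = infsum (a \<circ> g) (UNIV \<times> S N)"
        unfolding img[symmetric] by (rule infsum_reindex[OF inj])
      also have "\<dots> = infsum (\<lambda>k. infsum (\<lambda>m. (a \<circ> g) (k, m)) (S N)) UNIV"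
        by (rule infsum_Sigma_banach[symmetric]) (use aU summable_on_reindex[OF inj] img in auto)
      also have "\<dots> = infsum (\<lambda>k. infsum (\<lambda>m. a (N ^ k) * a m) (S N)) UNIV"
        by (intro infsum_cong) (auto simp: eq)
      also have "\<dots> = infsum (\<lambda>k. a (N ^ k)) UNIV * infsum a (S N)"
        by (simp add: infsum_cmult_right' infsum_cmult_left')
      also have "infsum (\<lambda>k. a (N ^ k)) UNIV = (\<Sum>k. a (N ^ k))"
      proof -
        have inj': "inj (\<lambda>k. N ^ k)" using prime_gt_1_nat[OF True] by (auto intro!: injI)
        have "(\<lambda>k. a (N ^ k)) summable_on UNIV"
          using aU summable_on_reindex[OF inj', of a] by (auto simp: o_def)
        hence "((\<lambda>k. a (N ^ k)) has_sum infsum (\<lambda>k. a (N ^ k)) UNIV) UNIV" by (rule has_sum_infsum)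
        thus ?thesis by (metis has_sum_imp_sums sums_unique)
      qed
      finally show ?thesis using Suc True by (simp add: S_def mult.commute)
    qed
  }
qed

text \<open>The N-th partial product is the sum over numbers whose prime factors are below N,
  squeezed between the sum over all n < N and the full sum.\<close>

lemma euler_product:
  fixes a :: "nat \<Rightarrow> real"
  assumes a: "\<And>n. a n \<ge> 0" and a0: "a 0 = 0" and a1: "a 1 = 1" and sm: "summable a"
    and mult: "\<And>p k m. prime p \<Longrightarrow> \<not> p dvd m \<Longrightarrow> m > 0 \<Longrightarrow> a (p ^ k * m) = a (p ^ k) * a m"
  shows "(\<lambda>N. \<Prod>p<N. if prime p then (\<Sum>k. a (p ^ k)) else 1) \<longlonglongrightarrow> suminf a"
proof (rule tendsto_sandwich)
  define S where "S N = {n::nat. n > 0 \<and> (\<forall>p. prime p \<longrightarrow> p dvd n \<longrightarrow> p < N)}" for N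
  have aU: "a summable_on A" for A
    using nonneg_summable_has_sum[OF a sm] summable_on_subset_banach[of a UNIV A]
    by (auto simp: summable_on_def)
  have eq: "infsum a (S N) = (\<Prod>p<N. if prime p then (\<Sum>k. a (p ^ k)) else 1)" for N
    unfolding S_def by (rule smooth_infsum_eq_prod[OF a a1 sm mult])
  have "sum a {..<N} \<le> infsum a (S N)" for N
  proof -
    have "sum a {..<N} = sum a ({..<N} - {0})" by (rule sum.mono_neutral_right) (auto simp: a0)
    also have "\<dots> \<le> infsum a (S N)"
    proof (rule finite_sum_le_infsum[OF aU])
      show "{..<N} - {0} \<subseteq> S N" by (auto simp: S_def dest: dvd_imp_le)
    qed (auto simp: a)
    finally show ?thesis .
  qed
  thus "\<forall>\<^sub>F N in sequentially. sum a {..<N} \<le> (\<Prod>p<N. if prime p then (\<Sum>k. a (p ^ k)) else 1)"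
    unfolding eq[symmetric] by (intro always_eventually allI)
  have "infsum a (S N) \<le> suminf a" for N
    using infsum_mono2[OF aU aU, of "S N" UNIV] a nonneg_summable_has_sum[OF a sm] by (simp add: infsumI)
  thus "\<forall>\<^sub>F N in sequentially. (\<Prod>p<N. if prime p then (\<Sum>k. a (p ^ k)) else 1) \<le> suminf a"
    unfolding eq[symmetric] by (intro always_eventually allI)
  show "(\<lambda>N. sum a {..<N}) \<longlonglongrightarrow> suminf a" using summable_LIMSEQ[OF sm] .
qed simp

section \<open>Behaviour of the Dirichlet series near s = 1\<close>

lemma powr_diff_bounds:
  fixes y \<alpha> :: real
  assumes y: "y \<ge> 1" and \<alpha>: "\<alpha> > 0"
  shows "\<alpha> * (y + 1) powr (-\<alpha> - 1) \<le> y powr (-\<alpha>) - (y + 1) powr (-\<alpha>)"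
    and "y powr (-\<alpha>) - (y + 1) powr (-\<alpha>) \<le> \<alpha> * y powr (-\<alpha> - 1)"
proof -
  have "\<exists>z>y. z < y + 1 \<and> (y + 1) powr (-\<alpha>) - y powr (-\<alpha>) = (y + 1 - y) * (-\<alpha> * z powr (-\<alpha> - 1))"
    using y by (intro MVT2) (auto intro!: derivative_eq_intros)
  then obtain z where z: "y < z" "z < y + 1" "y powr (-\<alpha>) - (y + 1) powr (-\<alpha>) = \<alpha> * z powr (-\<alpha> - 1)"
    by (auto simp: algebra_simps)
  have "(y + 1) powr (-\<alpha> - 1) \<le> z powr (-\<alpha> - 1)" "z powr (-\<alpha> - 1) \<le> y powr (-\<alpha> - 1)"
    using z y \<alpha> by (intro powr_mono2'; simp)+
  thus "\<alpha> * (y + 1) powr (-\<alpha> - 1) \<le> y powr (-\<alpha>) - (y + 1) powr (-\<alpha>)"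
    "y powr (-\<alpha>) - (y + 1) powr (-\<alpha>) \<le> \<alpha> * y powr (-\<alpha> - 1)"
    unfolding z(3) using \<alpha> by auto
qed

text \<open>Telescoping n^(-d) traps d zeta(1 + d) between 1 and 1 + d, an explicit form of the
  simple pole.\<close>

lemma zeta_bounds:
  fixes d :: real
  assumes d: "d > 0"
  shows "summable (\<lambda>n. real (Suc n) powr (-(1 + d)))"
    and "\<bar>d * (\<Sum>n. real (Suc n) powr (-(1 + d))) - 1\<bar> \<le> d"
proof -
  have s: "summable (\<lambda>n. real n powr (-(1 + d)))" using d by (simp add: summable_real_powr_iff)
  show sm: "summable (\<lambda>n. real (Suc n) powr (-(1 + d)))"
    using summable_ignore_initial_segment[OF s, of 1] by simp
  define Z where "Z = (\<Sum>n. real (Suc n) powr (-(1 + d)))"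
  have "(\<lambda>n. real (Suc n) powr (-d)) \<longlonglongrightarrow> 0" using d by real_asymp
  from telescope_sums'[OF this] have tel: "(\<lambda>n. real (Suc n) powr (-d) - real (Suc (Suc n)) powr (-d)) sums 1"
    by simp
  have e: "-(1 + d) = -d - 1" "real (Suc (Suc n)) = real (Suc n) + 1" for n by auto
  have "1 \<le> d * Z"
  proof (rule sums_le[OF _ tel])
    show "(\<lambda>n. d * real (Suc n) powr (-(1 + d))) sums (d * Z)"
      unfolding Z_def by (intro sums_mult summable_sums sm)
    show "real (Suc n) powr (-d) - real (Suc (Suc n)) powr (-d) \<le> d * real (Suc n) powr (-(1 + d))" for n
      unfolding e using d by (intro powr_diff_bounds) auto
  qed
  moreover have "d * (Z - 1) \<le> 1"
  proof (rule sums_le[OF _ _ tel])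
    have "(\<lambda>n. real (Suc (Suc n)) powr (-(1 + d))) sums (Z - 1)"
      unfolding Z_def using summable_sums[OF sm] by (subst sums_Suc_iff) simp
    thus "(\<lambda>n. d * real (Suc (Suc n)) powr (-(1 + d))) sums (d * (Z - 1))" by (intro sums_mult)
    show "d * real (Suc (Suc n)) powr (-(1 + d)) \<le> real (Suc n) powr (-d) - real (Suc (Suc n)) powr (-d)" for n
      unfolding e using d by (intro powr_diff_bounds) auto
  qed
  ultimately show "\<bar>d * Z - 1\<bar> \<le> d" using d by (simp add: abs_le_iff right_diff_distrib)
qed

context real_character begin

text \<open>Write r(n + 1) = L + e(n) with e(n) the increments of \<open>err\<close>: the constant
  part gives L zeta(1 + d), and the rest stays bounded as d -> 0, so the residue is
  \<open>L\<close>.\<close>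

lemma zeta_K_asymp:
  shows "d > 0 \<Longrightarrow> summable (\<lambda>n. r n * real n powr (-(1 + d)))"
    and "((\<lambda>d. d * (\<Sum>n. r n * real n powr (-(1 + d)))) \<longlongrightarrow> L) (at_right 0)"
proof -
  define K where "K = 4 * D + 1"
  have K: "K \<ge> 0" using D_nonneg by (simp add: K_def)
  define c where "c n = 2 * real (Suc n) powr (-3/2)" for n
  have c0: "c n \<ge> 0" for n by (simp add: c_def)
  have "summable (\<lambda>n. real n powr (-3/2))" by (simp add: summable_real_powr_iff)
  from summable_ignore_initial_segment[OF this, of 1] have cs: "summable c"
    unfolding c_def by (intro summable_mult) simp
  define M where "M = K * (1 + suminf c)"
  define e where "e n = err (Suc n) - err n" for n
  have e: "r (Suc n) = L + e n" for n unfolding e_def err_Suc by simp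
  have err0: "err 0 = 0" by (simp add: err_def)
  \<comment> \<open>Abel summation: \<open>err\<close> is O(sqrt n) and the differences of n^(-(1 +
    d)) are O(n^(-2)), so the terms are O(n^(-3/2)) uniformly for d in (0, 1].\<close>
  have bound: "\<bar>\<Sum>n<N. e n * real (Suc n) powr (-(1 + d))\<bar> \<le> M" if d: "0 < d" "d \<le> 1" for d N
  proof -
    define \<phi> where "\<phi> n = real (Suc n) powr (-(1 + d))" for n
    have abel: "(\<Sum>n<N. e n * \<phi> n) = err N * \<phi> N + (\<Sum>n<N. err (Suc n) * (\<phi> n - \<phi> (Suc n)))" for N
      by (induction N) (auto simp: e_def err0 algebra_simps)
    have "\<bar>err N * \<phi> N\<bar> \<le> K * 1"
    proof -
      have "sqrt (real N) * \<phi> N \<le> 1"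
      proof -
        have "\<phi> N \<le> real (Suc N) powr (-(1/2))" unfolding \<phi>_def using d by (intro powr_mono) auto
        hence "sqrt (real N) * \<phi> N \<le> real (Suc N) powr (1/2) * real (Suc N) powr (-(1/2))"
          by (intro mult_mono) (auto simp: powr_half_sqrt \<phi>_def)
        also have "\<dots> = 1" by (simp flip: powr_add)
        finally show ?thesis .
      qed
      hence "K * (sqrt (real N) * \<phi> N) \<le> K * 1" by (intro mult_left_mono K)
      moreover have "\<bar>err N * \<phi> N\<bar> \<le> K * sqrt (real N) * \<phi> N"
        unfolding abs_mult using err_bound[of N] by (intro mult_mono) (auto simp: \<phi>_def K_def)
      ultimately show ?thesis by (simp add: mult.assoc)
    qed
    moreover have "\<bar>\<Sum>n<N. err (Suc n) * (\<phi> n - \<phi> (Suc n))\<bar> \<le> (\<Sum>n<N. K * c n)"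
    proof (rule order_trans[OF sum_abs], rule sum_mono)
      fix n
      have e2: "real (Suc (Suc n)) = real (Suc n) + 1" by simp
      have 0: "0 \<le> \<phi> n - \<phi> (Suc n)"
        unfolding \<phi>_def using d by (simp add: powr_mono2')
      have "\<phi> n - \<phi> (Suc n) \<le> (1 + d) * real (Suc n) powr (-(1 + d) - 1)"
        unfolding \<phi>_def e2 using d by (intro powr_diff_bounds) auto
      also have "\<dots> \<le> 2 * real (Suc n) powr (-2)"
        using d by (intro mult_mono powr_mono) auto
      finally have 1: "\<phi> n - \<phi> (Suc n) \<le> 2 * real (Suc n) powr (-2)" .
      have "\<bar>err (Suc n) * (\<phi> n - \<phi> (Suc n))\<bar> \<le> K * real (Suc n) powr (1/2) * (2 * real (Suc n) powr (-2))"
        unfolding abs_mult using err_bound[of "Suc n"] 0 1 K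
        by (intro mult_mono) (auto simp: K_def powr_half_sqrt)
      also have "\<dots> = K * (2 * (real (Suc n) powr (1/2) * real (Suc n) powr (-2)))" by simp
      also have "real (Suc n) powr (1/2) * real (Suc n) powr (-2) = real (Suc n) powr (-3/2)"
        by (simp flip: powr_add)
      finally show "\<bar>err (Suc n) * (\<phi> n - \<phi> (Suc n))\<bar> \<le> K * c n" by (simp add: c_def)
    qed
    moreover have "(\<Sum>n<N. K * c n) \<le> K * suminf c"
      unfolding sum_distrib_left[symmetric] using cs c0 K by (intro mult_left_mono sum_le_suminf) auto
    ultimately show ?thesis unfolding M_def \<phi>_def[symmetric] abel distrib_left by linarith
  qed
  have sm1: "summable (\<lambda>n. r (Suc n) * real (Suc n) powr (-(1 + d)))"
    and bd: "\<bar>(\<Sum>n. r (Suc n) * real (Suc n) powr (-(1 + d))) - L * (\<Sum>n. real (Suc n) powr (-(1 + d)))\<bar> \<le> M"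
    if d: "0 < d" "d \<le> 1" for d
  proof -
    define z where "z n = real (Suc n) powr (-(1 + d))" for n
    have z: "summable z" unfolding z_def using d by (intro zeta_bounds) auto
    have split: "(\<Sum>n<N. r (Suc n) * z n) = L * (\<Sum>n<N. z n) + (\<Sum>n<N. e n * z n)" for N
      by (simp add: e distrib_right sum.distrib sum_distrib_left)
    have "(\<Sum>n<N. r (Suc n) * z n) \<le> L * suminf z + M" for N
    proof -
      have "L * (\<Sum>n<N. z n) \<le> L * suminf z"
        using L_pos by (intro mult_left_mono sum_le_suminf z) (auto simp: z_def)
      thus ?thesis unfolding split using bound[OF d, of N] by (simp add: z_def)
    qed
    thus s: "summable (\<lambda>n. r (Suc n) * real (Suc n) powr (-(1 + d)))"
      unfolding z_def[symmetric] by (intro summableI_nonneg_bounded) (auto simp: z_def r_nonneg)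
    have "(\<lambda>N. (\<Sum>n<N. r (Suc n) * z n) - L * (\<Sum>n<N. z n)) \<longlonglongrightarrow> (\<Sum>n. r (Suc n) * z n) - L * suminf z"
      using s z unfolding z_def[symmetric] by (intro tendsto_intros summable_LIMSEQ)
    moreover have "(\<Sum>n<N. r (Suc n) * z n) - L * (\<Sum>n<N. z n) = (\<Sum>n<N. e n * z n)" for N
      using split[of N] by simp
    ultimately have "(\<lambda>N. \<Sum>n<N. e n * z n) \<longlonglongrightarrow> (\<Sum>n. r (Suc n) * z n) - L * suminf z" by simp
    hence "\<bar>(\<Sum>n. r (Suc n) * z n) - L * suminf z\<bar> \<le> M"
      by (intro tendsto_upperbound[OF tendsto_rabs]) (use bound[OF d] in \<open>auto simp: z_def\<close>)
    thus "\<bar>(\<Sum>n. r (Suc n) * real (Suc n) powr (-(1 + d))) - L * (\<Sum>n. real (Suc n) powr (-(1 + d)))\<bar> \<le> M"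
      unfolding z_def .
  qed
  have shift: "summable (\<lambda>n. r n * real n powr (-(1 + d))) \<longleftrightarrow> summable (\<lambda>n. r (Suc n) * real (Suc n) powr (-(1 + d)))" for d
    using summable_Suc_iff[of "\<lambda>n. r n * real n powr (-(1 + d))"] by simp
  \<comment> \<open>The uniform bound covers d <= 1; larger d follow by comparison.\<close>
  show sm: "summable (\<lambda>n. r n * real n powr (-(1 + d)))" if "d > 0" for d
  proof (rule summable_comparison_test'[of "\<lambda>n. r n * real n powr (-(1 + min d 1))" 1])
    show "summable (\<lambda>n. r n * real n powr (-(1 + min d 1)))" unfolding shift using that by (intro sm1) auto
    fix n :: nat assume "n \<ge> 1"
    hence "real n powr (-(1 + d)) \<le> real n powr (-(1 + min d 1))" by (intro powr_mono) auto
    thus "norm (r n * real n powr (-(1 + d))) \<le> r n * real n powr (-(1 + min d 1))"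
      using r_nonneg[of n] by (simp add: mult_left_mono)
  qed
  have ev: "\<forall>\<^sub>F d in at_right 0. \<bar>d * (\<Sum>n. r n * real n powr (-(1 + d))) - L\<bar> \<le> (M + L) * d"
  proof -
    have "\<bar>d * (\<Sum>n. r n * real n powr (-(1 + d))) - L\<bar> \<le> (M + L) * d" if d: "0 < d" "d < 1" for d
    proof -
      define X Z where "X = (\<Sum>n. r (Suc n) * real (Suc n) powr (-(1 + d)))"
        and "Z = (\<Sum>n. real (Suc n) powr (-(1 + d)))"
      have "(\<Sum>n. r n * real n powr (-(1 + d))) = X"
        unfolding X_def using suminf_split_head[OF sm[OF d(1)]] by simp
      moreover have "d * X - L = d * (X - L * Z) + L * (d * Z - 1)" by (simp add: algebra_simps)
      moreover have "\<bar>d * (X - L * Z)\<bar> \<le> d * M"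
        using bd[of d] d by (simp add: abs_mult X_def Z_def mult_left_mono)
      moreover have "\<bar>L * (d * Z - 1)\<bar> \<le> L * d"
        using zeta_bounds(2)[OF d(1)] L_pos by (simp add: abs_mult Z_def mult_left_mono)
      ultimately show ?thesis by (simp add: algebra_simps)
    qed
    thus ?thesis by (auto simp: eventually_at_right_field intro!: exI[of _ 1])
  qed
  have z: "((\<lambda>d. (M + L) * d) \<longlongrightarrow> 0) (at_right 0)" by (auto intro!: tendsto_eq_intros)
  have "((\<lambda>d. d * (\<Sum>n. r n * real n powr (-(1 + d))) - L) \<longlongrightarrow> 0) (at_right 0)"
    by (rule Lim_null_comparison[OF _ z]) (unfold real_norm_def, rule ev)
  thus "((\<lambda>d. d * (\<Sum>n. r n * real n powr (-(1 + d)))) \<longlongrightarrow> L) (at_right 0)"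
    by (rule LIM_zero_cancel)
qed

end

text \<open>Partial summation against Mertens' theorem: the sum is the integral of
  \<open>\<phi>\<close> over [0, ln N], with antiderivative \<open>\<Psi>\<close>. Monotonicity
  makes the variation of \<open>\<phi>\<close> telescope, so the error is a multiple of its last
  value.\<close>

lemma logarithmic_sum_mono_weight:
  fixes a :: "nat \<Rightarrow> real" and \<phi> \<Psi> :: "real \<Rightarrow> real"
  assumes M: "\<And>n. n \<ge> 1 \<Longrightarrow> \<bar>(\<Sum>m=1..n. a m) - ln (real n)\<bar> \<le> M"
    and deriv: "\<And>v. 0 \<le> v \<Longrightarrow> v \<le> V \<Longrightarrow> (\<Psi> has_real_derivative \<phi> v) (at v)"
    and mono: "\<And>v w. 0 \<le> v \<Longrightarrow> v \<le> w \<Longrightarrow> w \<le> V \<Longrightarrow> \<phi> v \<le> \<phi> w"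
    and nonneg: "\<phi> 0 \<ge> 0"
    and N: "N \<ge> 1" "ln (real N) \<le> V"
  shows "\<bar>(\<Sum>m=1..N. a m * \<phi> (ln (real m))) - (\<Psi> (ln (real N)) - \<Psi> 0)\<bar> \<le> (2 * M + 1) * \<phi> (ln (real N))"
proof -
  define E where "E n = (\<Sum>m=1..n. a m) - ln (real n)" for n
  \<comment> \<open>Removing the boundary term E * \<open>\<phi>\<close> makes each increment of D
    at most (M + 1) times that of \<open>\<phi>\<close>.\<close>
  define D where "D n = (\<Sum>m=1..n. a m * \<phi> (ln (real m))) - (\<Psi> (ln (real n)) - \<Psi> 0) - E n * \<phi> (ln (real n))" for n
  have M0: "M \<ge> 0" using M[of 1] by simp
  have EM: "\<bar>E n\<bar> \<le> M" if "n \<ge> 1" for n using M[OF that] by (simp add: E_def)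
  have "\<bar>D n\<bar> \<le> (M + 1) * (\<phi> (ln (real n)) - \<phi> 0)" if "1 \<le> n" "n \<le> N" for n
    using that
  proof (induction n rule: dec_induct)
    case base
    show ?case by (simp add: D_def E_def)
  next
    case (step n)
    define s t where "s = ln (real n)" and "t = ln (real (Suc n))"
    have "t - s = ln (real (Suc n) / real n)" using step unfolding s_def t_def by (subst ln_div) auto
    also have "\<dots> \<le> real (Suc n) / real n - 1" using step by (intro ln_le_minus_one) auto
    also have "\<dots> = 1 / real n" using step by (simp add: field_simps)
    also have "\<dots> \<le> 1" using step by simp
    finally have ts: "t - s \<le> 1" .
    have st: "0 \<le> s" "s < t" using step by (auto simp: s_def t_def)
    have tV: "t \<le> V"
    proof -
      have "t \<le> ln (real N)" unfolding t_def using step by (intro ln_mono) auto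
      thus ?thesis using N by simp
    qed
    have "\<exists>z>s. z < t \<and> \<Psi> t - \<Psi> s = (t - s) * \<phi> z"
      using st tV by (intro MVT2 deriv) auto
    then obtain z where z: "s < z" "z < t" "\<Psi> t - \<Psi> s = (t - s) * \<phi> z" by blast
    have zz: "\<phi> s \<le> \<phi> z" "\<phi> z \<le> \<phi> t" using z st tV by (auto intro!: mono)
    have a: "a (Suc n) = E (Suc n) - E n + (t - s)" by (simp add: E_def s_def t_def)
    have "D (Suc n) = (\<Sum>m=1..n. a m * \<phi> (ln (real m))) + a (Suc n) * \<phi> t - (\<Psi> t - \<Psi> 0) - E (Suc n) * \<phi> t"
      by (simp add: D_def t_def)
    also have "\<dots> = D n - E n * (\<phi> t - \<phi> s) + ((t - s) * \<phi> t - (\<Psi> t - \<Psi> s))"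
      unfolding a by (simp add: D_def s_def[symmetric] algebra_simps)
    also have "(t - s) * \<phi> t - (\<Psi> t - \<Psi> s) = (t - s) * (\<phi> t - \<phi> z)" unfolding z(3) by (simp add: algebra_simps)
    finally have eq: "D (Suc n) = D n - E n * (\<phi> t - \<phi> s) + (t - s) * (\<phi> t - \<phi> z)" .
    have aux: "\<bar>d - x + y\<bar> \<le> c + b + w" if "\<bar>x\<bar> \<le> b" "0 \<le> y" "y \<le> w" "\<bar>d\<bar> \<le> c" for d x y b c w :: real
      using that by linarith
    have "\<bar>E n * (\<phi> t - \<phi> s)\<bar> \<le> M * (\<phi> t - \<phi> s)"
      unfolding abs_mult using EM[of n] step zz by (intro mult_mono) auto
    moreover have "0 \<le> (t - s) * (\<phi> t - \<phi> z)" using st zz by auto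
    moreover have "(t - s) * (\<phi> t - \<phi> z) \<le> \<phi> t - \<phi> s"
      using st zz ts mult_mono[of "t - s" 1 "\<phi> t - \<phi> z" "\<phi> t - \<phi> s"] by simp
    moreover have "\<bar>D n\<bar> \<le> (M + 1) * (\<phi> s - \<phi> 0)" using step by (simp add: s_def)
    ultimately have "\<bar>D (Suc n)\<bar> \<le> (M + 1) * (\<phi> s - \<phi> 0) + M * (\<phi> t - \<phi> s) + (\<phi> t - \<phi> s)"
      unfolding eq by (intro aux)
    also have "\<dots> = (M + 1) * (\<phi> t - \<phi> 0)" by (simp add: algebra_simps)
    finally show ?case unfolding t_def .
  qed
  from this[of N] have "\<bar>D N\<bar> \<le> (M + 1) * (\<phi> (ln (real N)) - \<phi> 0)" using N by simp
  also have "\<dots> \<le> (M + 1) * \<phi> (ln (real N))" using nonneg M0 by (intro mult_left_mono) auto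
  finally have 1: "\<bar>D N\<bar> \<le> (M + 1) * \<phi> (ln (real N))" .
  have "\<phi> (ln (real N)) \<ge> 0" using nonneg mono[of 0 "ln (real N)"] N by simp
  hence "\<bar>E N * \<phi> (ln (real N))\<bar> \<le> M * \<phi> (ln (real N))"
    unfolding abs_mult using EM[of N] N by (intro mult_mono) auto
  moreover have "(\<Sum>m=1..N. a m * \<phi> (ln (real m))) - (\<Psi> (ln (real N)) - \<Psi> 0) = D N + E N * \<phi> (ln (real N))"
    by (simp add: D_def)
  moreover have "(2 * M + 1) * \<phi> (ln (real N)) = (M + 1) * \<phi> (ln (real N)) + M * \<phi> (ln (real N))"
    by (simp add: algebra_simps)
  ultimately show ?thesis using 1 by linarith
qed

lemma power_three_halves: "u \<ge> 0 \<Longrightarrow> u powr (3/2) = u * sqrt u" for u :: real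
  using powr_add[of u 1 "1/2"] by (simp add: powr_half_sqrt)

section \<open>Euler factors of f and the logarithmic mean\<close>

context real_character begin

text \<open>Euler factor of \<open>(\<Sum> f(n) n powr -s)\<^sup>2 / (\<Sum> r(n) n powr -s)\<close> at \<open>t = p powr -s\<close>.\<close>

definition G_fac :: "nat \<Rightarrow> real \<Rightarrow> real" where
  "G_fac p t = (if chr p = 0 then 1 / (1 - t) else if chr p = -1 then 1 / (1 - t ^ 2) else 1)"

lemma f_prime_power_mult:
  assumes "prime p" "\<not> p dvd m" "m > 0"
  shows "f (p ^ k * m) = (if chr p = -1 \<and> odd k then 0 else 1) * f m"
proof -
  have z: "multiplicity p m = 0" using assms by (simp add: not_dvd_imp_multiplicity_0)
  have "(\<forall>q. prime q \<longrightarrow> chr q = -1 \<longrightarrow> even (multiplicity q (p ^ k * m)))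
      \<longleftrightarrow> (\<forall>q. prime q \<longrightarrow> chr q = -1 \<longrightarrow> even (if q = p then k else multiplicity q m))"
    using multiplicity_prime_power_mult[OF assms] by auto
  also have "\<dots> \<longleftrightarrow> (chr p = -1 \<longrightarrow> even k) \<and> (\<forall>q. prime q \<longrightarrow> chr q = -1 \<longrightarrow> even (multiplicity q m))"
  proof (intro iffI conjI allI impI)
    fix q assume h: "\<forall>q. prime q \<longrightarrow> chr q = -1 \<longrightarrow> even (if q = p then k else multiplicity q m)" "prime q" "chr q = -1"
    show "even (multiplicity q m)" using h z by (cases "q = p") auto
  qed (use assms(1) in auto)
  finally show ?thesis using assms by (auto simp: f_def admissible_def prime_gt_0_nat)
qed

lemma f_1: "f 1 = 1" by (simp add: f_def admissible_def)

lemma f_prime_power: "prime p \<Longrightarrow> f (p ^ k) = (if chr p = -1 \<and> odd k then 0 else 1)"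
  using f_prime_power_mult[of p 1 k] f_1 prime_gt_1_nat[of p] by simp

text \<open>At split, ramified and inert primes the factor of \<open>f\<close> is 1/(1 - t), 1/(1 -
  t), 1/(1 - t^2), and that of \<open>r\<close> is 1/(1 - t)^2, 1/(1 - t), 1/(1 - t^2). The quotient
  is thus trivial at split primes and 1 + O(t^2) at inert ones.\<close>

lemma local_factor:
  assumes p: "prime p" and t: "0 < t" "t < 1"
  shows "(\<Sum>k. f (p ^ k) * t ^ k)\<^sup>2 = (\<Sum>k. r (p ^ k) * t ^ k) * G_fac p t"
    and "(\<Sum>k. r (p ^ k) * t ^ k) \<noteq> 0"
proof -
  have r: "r (p ^ k) = rho p k" for k
    using r_prime_power_mult[of p 1 k] p r_1 prime_gt_1_nat[of p] by simp
  have geo: "(\<lambda>k. t ^ k) sums (1 / (1 - t))" "(\<lambda>k. (-t) ^ k) sums (1 / (1 + t))"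
    using geometric_sums[of t] geometric_sums[of "-t"] t by simp_all
  have sq: "1 - t ^ 2 = (1 - t) * (1 + t)" by (simp add: power2_eq_square algebra_simps)
  consider "chr p = 1" | "chr p = 0" | "chr p = -1" using chi_range[of p] by blast
  hence "(\<Sum>k. f (p ^ k) * t ^ k)\<^sup>2 = (\<Sum>k. r (p ^ k) * t ^ k) * G_fac p t \<and> (\<Sum>k. r (p ^ k) * t ^ k) \<noteq> 0"
  proof cases
    case 1
    have "(\<Sum>k. f (p ^ k) * t ^ k) = 1 / (1 - t)" using geo 1 p by (simp add: f_prime_power sums_iff)
    moreover have "(\<Sum>k. r (p ^ k) * t ^ k) = 1 / (1 - t)\<^sup>2"
      using geometric_deriv_sums[of t] t 1 by (simp add: r rho_cases sums_iff)
    ultimately show ?thesis using 1 t by (simp add: G_fac_def power_one_over)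
  next
    case 2
    have "(\<Sum>k. f (p ^ k) * t ^ k) = 1 / (1 - t)" using geo 2 p by (simp add: f_prime_power sums_iff)
    moreover have "(\<Sum>k. r (p ^ k) * t ^ k) = 1 / (1 - t)" using geo 2 by (simp add: r rho_cases sums_iff)
    ultimately show ?thesis using 2 t by (simp add: G_fac_def power2_eq_square)
  next
    case 3
    have "(\<lambda>k. (t ^ k + (-t) ^ k) / 2) sums ((1 / (1 - t) + 1 / (1 + t)) / 2)"
      by (intro sums_divide sums_add geo)
    also have "(\<lambda>k. (t ^ k + (-t) ^ k) / 2) = (\<lambda>k. (if even k then 1 else 0) * t ^ k)" by auto
    also have "(1 / (1 - t) + 1 / (1 + t)) / 2 = 1 / (1 - t ^ 2)"
    proof -
      have "1 / (1 - t) + 1 / (1 + t) = ((1 + t) + (1 - t)) / ((1 - t) * (1 + t))"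
        using t by (subst add_frac_eq) (auto simp: algebra_simps)
      thus ?thesis unfolding sq by simp
    qed
    finally have s: "(\<lambda>k. (if even k then 1 else 0) * t ^ k) sums (1 / (1 - t ^ 2))" .
    have "t ^ 2 < 1" using t by (simp add: power_less_one_iff)
    moreover have "(\<Sum>k. f (p ^ k) * t ^ k) = 1 / (1 - t ^ 2)"
    proof -
      have "f (p ^ k) = (if even k then 1 else 0)" for k using 3 p by (simp add: f_prime_power)
      thus ?thesis using s by (simp only: sums_iff)
    qed
    moreover have "(\<Sum>k. r (p ^ k) * t ^ k) = 1 / (1 - t ^ 2)"
    proof -
      have "r (p ^ k) = (if even k then 1 else 0)" for k using 3 by (simp add: r rho_cases)
      thus ?thesis using s by (simp only: sums_iff)
    qed
    ultimately show ?thesis using 3 by (simp add: G_fac_def power2_eq_square)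
  qed
  thus "(\<Sum>k. f (p ^ k) * t ^ k)\<^sup>2 = (\<Sum>k. r (p ^ k) * t ^ k) * G_fac p t"
    and "(\<Sum>k. r (p ^ k) * t ^ k) \<noteq> 0" by auto
qed

lemma G_fac_bounds:
  assumes "0 \<le> t" "t \<le> t'" "t' < 1"
  shows "1 \<le> G_fac p t" "G_fac p t \<le> G_fac p t'"
proof -
  have sq: "0 \<le> t ^ 2" "t ^ 2 \<le> t' ^ 2" "t' ^ 2 < 1"
    using assms by (auto intro: power_mono simp: power_less_one_iff)
  have *: "1 \<le> 1 / (1 - u)" "1 / (1 - u) \<le> 1 / (1 - u')" if "0 \<le> u" "u \<le> u'" "u' < 1" for u u' :: real
    using that by (auto intro: divide_left_mono simp: le_divide_eq)
  show "1 \<le> G_fac p t" "G_fac p t \<le> G_fac p t'"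
    unfolding G_fac_def using *[OF assms] *[OF sq] by auto
qed

lemma summable_f_powr: "d > 0 \<Longrightarrow> summable (\<lambda>n. f n * real n powr (-(1 + d)))"
proof (rule summable_comparison_test'[of "\<lambda>n. real n powr (-(1 + d))" 0])
  assume "d > 0" thus "summable (\<lambda>n. real n powr (-(1 + d)))" by (simp add: summable_real_powr_iff)
qed (use f_range in \<open>auto intro: mult_left_le_one_le\<close>)

lemma euler_quotient:
  assumes d: "d > 0"
  shows "(\<lambda>N. \<Prod>p<N. if prime p then G_fac p (real p powr (-(1 + d))) else 1)
    \<longlonglongrightarrow> (\<Sum>n. f n * real n powr (-(1 + d)))\<^sup>2 / (\<Sum>n. r n * real n powr (-(1 + d)))"
proof -
  define F Z where "F = (\<Sum>n. f n * real n powr (-(1 + d)))" and "Z = (\<Sum>n. r n * real n powr (-(1 + d)))"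
  define t where "t p = real p powr (-(1 + d))" for p :: nat
  have tk: "real (p ^ k) powr (-(1 + d)) = t p ^ k" if "prime p" for p k
    using prime_gt_0_nat[OF that] unfolding t_def
    by (simp add: powr_realpow[symmetric] powr_powr mult.commute)
  have t01: "0 < t p" "t p < 1" if "prime p" for p
    using prime_gt_1_nat[OF that] d unfolding t_def by (auto intro: powr_less_one)
  have mult_powr: "real (a * b) powr s = real a powr s * real b powr s" for a b :: nat and s
    by (simp add: powr_mult)
  have F: "(\<lambda>N. \<Prod>p<N. if prime p then (\<Sum>k. f (p ^ k) * real (p ^ k) powr (-(1 + d))) else 1) \<longlonglongrightarrow> F"
    unfolding F_def
  proof (rule euler_product)
    fix p k m :: nat assume h: "prime p" "\<not> p dvd m" "m > 0"
    have "f (p ^ k * m) = f (p ^ k) * f m" using f_prime_power_mult[OF h] f_prime_power[OF h(1)] by simp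
    thus "f (p ^ k * m) * real (p ^ k * m) powr (-(1 + d))
      = f (p ^ k) * real (p ^ k) powr (-(1 + d)) * (f m * real m powr (-(1 + d)))"
      by (simp only: mult_powr mult_ac)
  qed (use d f_1 summable_f_powr[OF d] in \<open>auto simp: f_range\<close>)
  have Z: "(\<lambda>N. \<Prod>p<N. if prime p then (\<Sum>k. r (p ^ k) * real (p ^ k) powr (-(1 + d))) else 1) \<longlonglongrightarrow> Z"
    unfolding Z_def
  proof (rule euler_product)
    fix p k m :: nat assume h: "prime p" "\<not> p dvd m" "m > 0"
    have "r (p ^ k) = rho p k"
      using r_prime_power_mult[of p 1 k] h r_1 prime_gt_1_nat[of p] by simp
    thus "r (p ^ k * m) * real (p ^ k * m) powr (-(1 + d))
      = r (p ^ k) * real (p ^ k) powr (-(1 + d)) * (r m * real m powr (-(1 + d)))"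
      using r_prime_power_mult[OF h] by (simp only: mult_powr mult_ac)
  qed (use d r_1 zeta_K_asymp(1) in \<open>auto simp: r_nonneg\<close>)
  have Zpos: "Z \<noteq> 0"
  proof -
    have "(\<Sum>n\<in>{1}. r n * real n powr (-(1 + d))) \<le> Z"
      unfolding Z_def using zeta_K_asymp(1)[OF d] by (intro sum_le_suminf) (auto simp: r_nonneg)
    thus ?thesis using r_1 by simp
  qed
  have eq: "(if prime p then G_fac p (t p) else 1)
     = (if prime p then (\<Sum>k. f (p ^ k) * real (p ^ k) powr (-(1 + d))) else 1) ^ 2
       / (if prime p then (\<Sum>k. r (p ^ k) * real (p ^ k) powr (-(1 + d))) else 1)" for p
  proof (cases "prime p")
    case True
    show ?thesis using local_factor[OF True t01[OF True]] True by (simp only: tk[OF True] if_True) simp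
  qed simp
  have "(\<lambda>N. (\<Prod>p<N. if prime p then (\<Sum>k. f (p ^ k) * real (p ^ k) powr (-(1 + d))) else 1) ^ 2
      / (\<Prod>p<N. if prime p then (\<Sum>k. r (p ^ k) * real (p ^ k) powr (-(1 + d))) else 1)) \<longlonglongrightarrow> F ^ 2 / Z"
    by (intro tendsto_divide tendsto_power F Z Zpos)
  hence "(\<lambda>N. \<Prod>p<N. if prime p then G_fac p (t p) else 1) \<longlonglongrightarrow> F ^ 2 / Z"
    unfolding eq prod_dividef prod_power_distrib .
  thus ?thesis by (simp only: t_def F_def Z_def)
qed

text \<open>The limit d -> 0 passes through the infinite product by monotonicity: the factors are at
  least 1 and decrease in d, so \<open>G\<close> bounds the quotient from above and finite partial
  products bound it from below. A square root then transfers the pole of the series of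
  \<open>r\<close> to \<open>f\<close>.\<close>

lemma sum_f_powr_asymp:
  assumes G: "(\<lambda>N. \<Prod>p<N. if prime p then G_fac p (1 / real p) else 1) \<longlonglongrightarrow> G"
  shows "((\<lambda>d. sqrt d * (\<Sum>n. f n * real n powr (-(1 + d)))) \<longlongrightarrow> sqrt (L * G)) (at_right 0)"
proof -
  define F Z where "F d = (\<Sum>n. f n * real n powr (-(1 + d)))" and "Z d = (\<Sum>n. r n * real n powr (-(1 + d)))" for d
  define PG where "PG s N = (\<Prod>p<N. if prime p then G_fac p (real p powr (-s)) else 1)" for s :: real and N :: nat
  have PG1: "PG 1 N = (\<Prod>p<N. if prime p then G_fac p (1 / real p) else 1)" for N
    unfolding PG_def by (intro prod.cong refl) (auto simp: powr_minus field_simps)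
  have quot: "PG (1 + d) \<longlonglongrightarrow> F d ^ 2 / Z d" if "d > 0" for d
    unfolding PG_def F_def Z_def by (rule euler_quotient[OF that])
  have fac: "1 \<le> G_fac p (real p powr (-s))" "G_fac p (real p powr (-s)) \<le> G_fac p (real p powr (-1))"
    if "prime p" "s \<ge> 1" for p s
  proof -
    have "real p powr (-s) \<le> real p powr (-1)" using that prime_ge_1_nat[of p] by (intro powr_mono) auto
    moreover have "real p powr (-1) < 1" using prime_gt_1_nat[OF that(1)] by (intro powr_less_one) auto
    ultimately show "1 \<le> G_fac p (real p powr (-s))" "G_fac p (real p powr (-s)) \<le> G_fac p (real p powr (-1))"
      by (auto intro!: G_fac_bounds)
  qed
  have mono: "PG s N \<le> PG s M" if "N \<le> M" "s \<ge> 1" for s N M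
  proof -
    have "PG s N * 1 \<le> PG s N * (\<Prod>p\<in>{N..<M}. if prime p then G_fac p (real p powr (-s)) else 1)"
      unfolding PG_def using fac that by (intro mult_left_mono prod_ge_1 prod_nonneg) (auto intro: order_trans[OF zero_le_one])
    also have "\<dots> = PG s M" unfolding PG_def lessThan_atLeast0 using that
      by (intro prod.atLeastLessThan_concat) auto
    finally show ?thesis by simp
  qed
  have lim1: "PG 1 \<longlonglongrightarrow> G" using G by (simp add: PG1[abs_def])
  have le1: "PG 1 N \<le> G" for N
    by (rule tendsto_lowerbound[OF lim1]) (use mono in \<open>auto simp: eventually_sequentially\<close>)
  have upper: "F d ^ 2 / Z d \<le> G" if "d > 0" for d
  proof (rule tendsto_upperbound[OF quot[OF that]])
    have "PG (1 + d) N \<le> PG 1 N" for N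
      unfolding PG_def
    proof (rule prod_mono)
      fix p
      show "0 \<le> (if prime p then G_fac p (real p powr (-(1 + d))) else 1) \<and>
        (if prime p then G_fac p (real p powr (-(1 + d))) else 1) \<le> (if prime p then G_fac p (real p powr (-1)) else 1)"
        using fac[of p "1 + d"] that by (auto intro: order_trans[OF zero_le_one])
    qed
    thus "\<forall>\<^sub>F N in sequentially. PG (1 + d) N \<le> G" using le1 by (intro always_eventually allI) (meson order_trans)
  qed simp
  have lower: "PG (1 + d) N \<le> F d ^ 2 / Z d" if "d > 0" for d N
    by (rule tendsto_lowerbound[OF quot[OF that]])
       (use that in \<open>auto simp: eventually_sequentially intro!: exI[of _ N] mono\<close>)
  have Q: "((\<lambda>d. F d ^ 2 / Z d) \<longlongrightarrow> G) (at_right 0)"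
  proof (rule order_tendstoI)
    fix a assume "a < G"
    hence "\<forall>\<^sub>F N in sequentially. a < PG 1 N" using lim1 by (intro order_tendstoD)
    \<comment> \<open>One fixed finite product already exceeds a at s = 1, and by continuity also
      for small d.\<close>
    then obtain N where N: "a < PG 1 N" by (auto simp: eventually_sequentially)
    have "((\<lambda>d. PG (1 + d) N) \<longlongrightarrow> PG (1 + 0) N) (at_right 0)"
      unfolding PG_def
    proof (intro tendsto_prod)
      fix p
      show "((\<lambda>d. if prime p then G_fac p (real p powr (-(1 + d))) else 1)
        \<longlongrightarrow> (if prime p then G_fac p (real p powr (-(1 + 0))) else 1)) (at_right 0)"
      proof (cases "prime p")
        case True
        define t where "t = real p powr (-(1 + 0))"
        have t: "0 < t" "t < 1" using prime_gt_1_nat[OF True] unfolding t_def by (auto intro!: powr_less_one)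
        have "t ^ 2 < 1" using t by (simp add: power_less_one_iff)
        have lim: "((\<lambda>d. real p powr (-(1 + d))) \<longlongrightarrow> t) (at_right 0)"
          unfolding t_def using prime_gt_0_nat[OF True] by (intro tendsto_intros) auto
        have "((\<lambda>d. G_fac p (real p powr (-(1 + d)))) \<longlongrightarrow> G_fac p t) (at_right 0)"
          unfolding G_fac_def using t \<open>t ^ 2 < 1\<close>
          by (cases "chr p = 0"; cases "chr p = -1") (auto intro!: tendsto_intros lim simp del: minus_add_distrib)
        thus ?thesis using True by (simp add: t_def)
      qed simp
    qed
    hence "\<forall>\<^sub>F d in at_right 0. a < PG (1 + d) N" using N by (intro order_tendstoD) auto
    moreover have "\<forall>\<^sub>F d in at_right (0::real). d > 0" by (simp add: eventually_at_right_less)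
    ultimately show "\<forall>\<^sub>F d in at_right 0. a < F d ^ 2 / Z d"
      by eventually_elim (use lower in \<open>auto intro: less_le_trans\<close>)
  next
    fix a assume "G < a"
    moreover have "\<forall>\<^sub>F d in at_right (0::real). d > 0" by (simp add: eventually_at_right_less)
    ultimately show "\<forall>\<^sub>F d in at_right 0. F d ^ 2 / Z d < a"
      by (auto elim!: eventually_mono intro: le_less_trans[OF upper])
  qed
  have "((\<lambda>d. sqrt ((d * Z d) * (F d ^ 2 / Z d))) \<longlongrightarrow> sqrt (L * G)) (at_right 0)"
    unfolding Z_def by (intro tendsto_intros zeta_K_asymp(2) Q[unfolded Z_def])
  moreover have "\<forall>\<^sub>F d in at_right (0::real). d > 0" by (simp add: eventually_at_right_less)
  hence "\<forall>\<^sub>F d in at_right 0. sqrt ((d * Z d) * (F d ^ 2 / Z d)) = sqrt d * F d"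
  proof eventually_elim
    case (elim d)
    have "(\<Sum>n\<in>{1}. r n * real n powr (-(1 + d))) \<le> Z d"
      unfolding Z_def using zeta_K_asymp(1)[OF elim] by (intro sum_le_suminf) (auto simp: r_nonneg)
    hence "Z d \<noteq> 0" using r_1 by simp
    moreover have "F d \<ge> 0" unfolding F_def using elim by (intro suminf_nonneg summable_f_powr) (auto simp: f_range)
    ultimately show ?case by (simp add: real_sqrt_mult)
  qed
  ultimately show ?thesis unfolding F_def by (rule Lim_transform_eventually)
qed

lemma log_mean_tent_asymp:
  assumes G: "(\<lambda>N. \<Prod>p<N. if prime p then G_fac p (1 / real p) else 1) \<longlonglongrightarrow> G"
  shows "((\<lambda>x. (\<Sum>n\<in>nats_upto x. f n / real n * ln (x / real n)) / ln x powr (3/2))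
    \<longlongrightarrow> 4/3 * sqrt (L * G) / sqrt pi) at_top"
proof (rule karamata_tent)
  have e: "f n / real n * real n powr (-d) = f n * real n powr (-(1 + d))" for n d
    by (cases "n = 0") (simp_all add: powr_diff powr_minus field_simps)
  show "d > 0 \<Longrightarrow> summable (\<lambda>n. f n / real n * real n powr (-d))" for d
    unfolding e by (rule summable_f_powr)
  show "((\<lambda>d. sqrt d * (\<Sum>n. f n / real n * real n powr (-d))) \<longlongrightarrow> sqrt (L * G)) (at_right 0)"
    unfolding e by (rule sum_f_powr_asymp[OF G])
qed (auto simp: f_range)

end

section \<open>The contraction argument\<close>

context real_character begin

text \<open>With u = ln x this is the integral of v / sqrt(u - v), which is Beta(2, 1/2) u^(3/2).
  Stopping at x / y0 with y0 >= e keeps ln(x/m) >= 1, away from the singularity at v = u.\<close>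

lemma log_weight_asymp:
  assumes y0: "y0 \<ge> exp 1"
  shows "((\<lambda>x. (\<Sum>m\<in>nats_upto (x / y0). l m * ln (real m) / (real m * sqrt (ln (x / real m)))) / ln x powr (3/2))
    \<longlongrightarrow> 4/3) at_top"
proof -
  obtain M where M: "M > 0" "\<And>x. x \<ge> 1 \<Longrightarrow> \<bar>(\<Sum>n\<in>nats_upto x. l n / real n) - ln x\<bar> \<le> M"
    by (rule mertens) auto
  have M': "\<bar>(\<Sum>m=1..n. l m / real m) - ln (real n)\<bar> \<le> M" if "n \<ge> 1" for n
    using M(2)[of "real n"] that by simp
  \<comment> \<open>Since N is the floor of x / y0, it is at least x / (2 y0), whence the additional
    ln 2.\<close>
  define k where "k = ln y0 + ln 2"
  have y0pos: "y0 > 0" using y0 less_le_trans[OF exp_gt_zero] by blast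
  have lny0: "ln y0 \<ge> 1" using y0 y0pos by (simp add: ln_ge_iff)
  hence k0: "k \<ge> 0" by (simp add: k_def)
  define U where "U x = (\<Sum>m\<in>nats_upto (x / y0). l m * ln (real m) / (real m * sqrt (ln (x / real m))))" for x
  have main: "\<bar>U x - 4/3 * ln x powr (3/2)\<bar> \<le> (2 * M + 1 + 2 * sqrt k) * ln x + k * sqrt k" if x: "x \<ge> y0" for x
  proof -
    define u where "u = ln x"
    have xpos: "x > 0" using x y0pos by linarith
    have u1: "u \<ge> 1" unfolding u_def using lny0 x y0pos by (meson ln_mono order_trans)
    define \<phi> where "\<phi> v = v / sqrt (u - v)" for v
    \<comment> \<open>The antiderivative of \<open>\<phi>\<close>, found by writing v = u - (u -
      v).\<close>
    define \<Psi> where "\<Psi> v = -2 * u * sqrt (u - v) + 2/3 * ((u - v) * sqrt (u - v))" for v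
    have xy: "x / y0 \<ge> 1" using x y0pos by simp
    obtain N where N: "N \<ge> 1" "nats_upto (x / y0) = {1..N}" "real N \<le> x / y0" "x / y0 < real N + 1"
      using floor_sandwich[OF xy] by blast
    have lnN: "ln (real N) \<le> u - 1"
    proof -
      have "ln (real N) \<le> ln (x / y0)" using N by simp
      also have "\<dots> = u - ln y0" using xpos y0pos by (simp add: ln_div u_def)
      finally show ?thesis using lny0 by simp
    qed
    have lnN': "u - ln (real N) \<le> k"
    proof -
      have "x / y0 \<le> 2 * real N" using N by linarith
      hence "ln (x / y0) \<le> ln (2 * real N)" using xy by simp
      thus ?thesis using N xpos y0pos by (simp add: ln_div ln_mult u_def k_def)
    qed
    have U: "U x = (\<Sum>m=1..N. (l m / real m) * \<phi> (ln (real m)))"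
      unfolding U_def N(2)
    proof (intro sum.cong refl)
      fix m assume "m \<in> {1..N}"
      hence "ln (x / real m) = u - ln (real m)" using xpos by (simp add: ln_div u_def)
      thus "l m * ln (real m) / (real m * sqrt (ln (x / real m))) = (l m / real m) * \<phi> (ln (real m))"
        by (simp add: \<phi>_def)
    qed
    have "\<bar>(\<Sum>m=1..N. (l m / real m) * \<phi> (ln (real m))) - (\<Psi> (ln (real N)) - \<Psi> 0)\<bar> \<le> (2 * M + 1) * \<phi> (ln (real N))"
    proof (rule logarithmic_sum_mono_weight[OF M'])
      show "(\<Psi> has_real_derivative \<phi> v) (at v)" if "0 \<le> v" "v \<le> u - 1" for v
      proof -
        define s where "s = sqrt (u - v)"
        have s: "s > 0" "s * s = u - v" using that by (auto simp: s_def)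
        define q where "q v = sqrt (u - v)" for v
        have q: "(q has_real_derivative (inverse s / 2 * (-1))) (at v)"
          unfolding s_def q_def[abs_def] using that by (auto intro!: derivative_eq_intros)
        have "\<Psi> = (\<lambda>v. -2 * u * q v + 2/3 * ((u - v) * q v))" by (simp add: \<Psi>_def q_def fun_eq_iff)
        moreover have "((\<lambda>v. -2 * u * q v + 2/3 * ((u - v) * q v)) has_real_derivative
            (-2 * u * (inverse s / 2 * (-1)) + 2/3 * ((0 - 1) * q v + (inverse s / 2 * (-1)) * (u - v)))) (at v)"
          by (intro DERIV_add DERIV_cmult DERIV_mult DERIV_diff DERIV_const DERIV_ident q)
        ultimately have "(\<Psi> has_real_derivative
            (-2 * u * (inverse s / 2 * (-1)) + 2/3 * ((-1) * s + (inverse s / 2 * (-1)) * (u - v)))) (at v)"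
          by (simp add: q_def s_def)
        also have "-2 * u * (inverse s / 2 * (-1)) + 2/3 * ((-1) * s + (inverse s / 2 * (-1)) * (u - v)) = \<phi> v"
        proof -
          have "\<phi> v = v / s" by (simp add: \<phi>_def s_def)
          moreover have uv: "u = v + s * s" using s by simp
          have "-2 * u * (inverse s / 2 * (-1)) + 2/3 * ((-1) * s + (inverse s / 2 * (-1)) * (u - v)) = v / s"
            unfolding uv using s(1) by (simp add: field_simps)
          ultimately show ?thesis by simp
        qed
        finally show ?thesis .
      qed
      show "\<phi> v \<le> \<phi> w" if "0 \<le> v" "v \<le> w" "w \<le> u - 1" for v w
        unfolding \<phi>_def using that by (intro frac_le) auto
      show "\<phi> 0 \<ge> 0" by (simp add: \<phi>_def)
    qed (use N lnN in auto)
    moreover have "\<phi> (ln (real N)) \<le> u"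
    proof -
      have "ln (real N) / sqrt (u - ln (real N)) \<le> u / 1"
        using lnN N u1 by (intro frac_le) auto
      thus ?thesis by (simp add: \<phi>_def)
    qed
    hence "(2 * M + 1) * \<phi> (ln (real N)) \<le> (2 * M + 1) * u" using M by (intro mult_left_mono) auto
    moreover have "\<Psi> 0 = -4/3 * u powr (3/2)"
      using u1 by (simp add: \<Psi>_def power_three_halves)
    moreover have "\<bar>\<Psi> (ln (real N))\<bar> \<le> 2 * u * sqrt k + k * sqrt k"
    proof -
      define w where "w = u - ln (real N)"
      have w: "0 \<le> w" "w \<le> k" using lnN lnN' by (auto simp: w_def)
      have "u * sqrt w \<le> u * sqrt k" using w u1 by (intro mult_left_mono) auto
      moreover have "w * sqrt w \<le> k * sqrt k" using w by (intro mult_mono) auto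
      moreover have "0 \<le> u * sqrt w" "0 \<le> w * sqrt w" using w u1 by auto
      ultimately show ?thesis unfolding \<Psi>_def w_def[symmetric] by linarith
    qed
    ultimately have "\<bar>U x - 4/3 * u powr (3/2)\<bar> \<le> (2 * M + 1) * u + (2 * u * sqrt k + k * sqrt k)"
      unfolding U by linarith
    thus ?thesis unfolding u_def by (simp add: algebra_simps)
  qed
  have "((\<lambda>x. (2 * M + 1 + 2 * sqrt k) * (ln x / ln x powr (3/2)) + (k * sqrt k) * (1 / ln x powr (3/2))) \<longlongrightarrow>
      (2 * M + 1 + 2 * sqrt k) * 0 + (k * sqrt k) * 0) at_top"
  proof (intro tendsto_intros)
    show "((\<lambda>x. ln x / ln x powr (3/2)) \<longlongrightarrow> 0) (at_top :: real filter)" by real_asymp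
    show "((\<lambda>x. 1 / ln x powr (3/2)) \<longlongrightarrow> 0) (at_top :: real filter)" by real_asymp
  qed
  hence z: "((\<lambda>x. (2 * M + 1 + 2 * sqrt k) * (ln x / ln x powr (3/2)) + (k * sqrt k) * (1 / ln x powr (3/2))) \<longlongrightarrow> 0) at_top"
    by simp
  have "((\<lambda>x. U x / ln x powr (3/2) - 4/3) \<longlongrightarrow> 0) at_top"
  proof (rule Lim_null_comparison[OF _ z])
    show "\<forall>\<^sub>F x in at_top. norm (U x / ln x powr (3/2) - 4/3) \<le> (2 * M + 1 + 2 * sqrt k) * (ln x / ln x powr (3/2)) + (k * sqrt k) * (1 / ln x powr (3/2))"
      using eventually_ge_at_top[of y0] eventually_gt_at_top[of 1]
    proof eventually_elim
      case (elim x)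
      define P where "P = ln x powr (3/2)"
      have P: "P > 0" using elim by (simp add: P_def)
      have "U x / P - 4/3 = (U x - 4/3 * P) / P" using P by (simp add: field_simps)
      hence "norm (U x / P - 4/3) = \<bar>U x - 4/3 * P\<bar> / P" using P by simp
      also have "\<dots> \<le> ((2 * M + 1 + 2 * sqrt k) * ln x + k * sqrt k) / P"
        using main[OF elim(1)] P unfolding P_def by (intro divide_right_mono) auto
      finally show ?case unfolding P_def by (simp add: add_divide_distrib)
    qed
  qed
  thus ?thesis unfolding U_def by (rule LIM_zero_cancel)
qed

text \<open>For m beyond x / y0 nothing is known about \<open>beta\<close> at x/m, but the trivial
  B(y) <= y suffices: by Mertens at both ends the weights l(m) / m sum to ln y0 + O(1), and O(x ln
  x) is negligible.\<close>

lemma tail_weight_bound: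
  obtains C where "C > 0" "\<And>x y0. y0 \<ge> 1 \<Longrightarrow> x \<ge> y0 \<Longrightarrow>
    (\<Sum>m\<in>nats_upto x - nats_upto (x / y0). l m * ln (real m) * B (x / real m)) \<le> x * ln x * (ln y0 + C)"
proof -
  obtain M where M: "M > 0" "\<And>x. x \<ge> 1 \<Longrightarrow> \<bar>(\<Sum>n\<in>nats_upto x. l n / real n) - ln x\<bar> \<le> M"
    by (rule mertens) auto
  show ?thesis
  proof (rule that[of "2 * M"])
    fix x y0 :: real assume y0: "y0 \<ge> 1" and x: "x \<ge> y0"
    have x1: "x \<ge> 1" "x / y0 \<ge> 1" using x y0 by auto
    have sub: "nats_upto (x / y0) \<subseteq> nats_upto x" using x1 y0 by (intro nats_upto_mono) (simp add: field_simps)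
    have "(\<Sum>m\<in>nats_upto x - nats_upto (x / y0). l m * ln (real m) * B (x / real m))
      \<le> (\<Sum>m\<in>nats_upto x - nats_upto (x / y0). x * ln x * (l m / real m))"
    proof (rule sum_mono)
      fix m assume "m \<in> nats_upto x - nats_upto (x / y0)"
      hence m: "0 < m" "real m \<le> x" by (auto simp: mem_nats_upto)
      have "l m * ln (real m) * B (x / real m) \<le> l m * ln x * (x / real m)"
        using m x1 l_nonneg[of m] by (intro mult_mono mult_left_mono B_le B_nonneg) auto
      thus "l m * ln (real m) * B (x / real m) \<le> x * ln x * (l m / real m)" by (simp add: mult_ac)
    qed
    also have "\<dots> = x * ln x * ((\<Sum>m\<in>nats_upto x. l m / real m) - (\<Sum>m\<in>nats_upto (x / y0). l m / real m))"
      unfolding sum_distrib_left[symmetric] by (subst sum_diff[OF _ sub]) auto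
    also have "\<dots> \<le> x * ln x * (ln y0 + 2 * M)"
    proof -
      have "ln (x / y0) = ln x - ln y0" using x1 y0 by (simp add: ln_div)
      thus ?thesis using M(2)[OF x1(1)] M(2)[OF x1(2)] x1 by (intro mult_left_mono) (linarith, simp)
    qed
    finally show "(\<Sum>m\<in>nats_upto x - nats_upto (x / y0). l m * ln (real m) * B (x / real m)) \<le> x * ln x * (ln y0 + 2 * M)" .
  qed (use M in auto)
qed

definition beta :: "real \<Rightarrow> real" where "beta x = B x * sqrt (ln x) / x"

text \<open>In the iterated relation two thirds of the main term are known exactly and the remaining
  third is an average of \<open>beta\<close> itself, so the oscillation of \<open>beta\<close> about its limit contracts.\<close>

lemma beta_contraction:
  assumes G: "(\<lambda>N. \<Prod>p<N. if prime p then G_fac p (1 / real p) else 1) \<longlonglongrightarrow> G"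
    and c: "c = sqrt (L * G) / sqrt pi" and dev: "dev > 0"
    and ev: "\<forall>\<^sub>F x in at_top. \<bar>beta x - c\<bar> \<le> dev"
  shows "\<forall>\<^sub>F x in at_top. \<bar>beta x - c\<bar> \<le> dev / 2"
proof -
  obtain y1 where y1: "\<And>y. y \<ge> y1 \<Longrightarrow> \<bar>beta y - c\<bar> \<le> dev"
    using ev by (auto simp: eventually_at_top_linorder)
  \<comment> \<open>Beyond y1 the deviation bound holds; beyond e the square root of the logarithm
    is at least 1.\<close>
  define y0 where "y0 = max y1 (exp 1)"
  have y0: "y0 \<ge> exp 1" "y0 \<ge> 1" "y0 > 0"
    unfolding y0_def using one_le_exp_iff[of 1] by (auto simp: le_max_iff_disj less_max_iff_disj simp del: one_le_exp_iff)
  obtain C1 where C1: "C1 > 0" "\<And>x. x \<ge> 1 \<Longrightarrow>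
    \<bar>B x * ln x ^ 2 - 1/2 * x * (\<Sum>n\<in>nats_upto x. f n / real n * ln (x / real n))
      - 1/4 * (\<Sum>m\<in>nats_upto x. l m * ln (real m) * B (x / real m))\<bar> \<le> C1 * x * (1 + ln x)"
    by (rule B_ln2_bound) auto
  obtain C2 where C2: "C2 > 0" "\<And>x y0. y0 \<ge> 1 \<Longrightarrow> x \<ge> y0 \<Longrightarrow>
    (\<Sum>m\<in>nats_upto x - nats_upto (x / y0). l m * ln (real m) * B (x / real m)) \<le> x * ln x * (ln y0 + C2)"
    by (rule tail_weight_bound) auto
  define F where "F x = (\<Sum>n\<in>nats_upto x. f n / real n * ln (x / real n))" for x
  define U where "U x = (\<Sum>m\<in>nats_upto (x / y0). l m * ln (real m) / (real m * sqrt (ln (x / real m))))" for x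
  define P where "P x = ln x powr (3/2)" for x :: real
  \<comment> \<open>All terms but the third tend to 0; the third tends to dev/4 * 4/3 = dev/3,
    leaving room below dev/2.\<close>
  define R where "R x = 1/2 * \<bar>F x / P x - 4/3 * c\<bar> + 1/4 * (\<bar>c\<bar> * \<bar>U x / P x - 4/3\<bar>) + dev/4 * (U x / P x)
     + (1/4 * (ln y0 + C2)) * (ln x / P x) + C1 * ((1 + ln x) / P x)" for x
  have FP: "((\<lambda>x. F x / P x) \<longlongrightarrow> 4/3 * c) at_top"
    using log_mean_tent_asymp[OF G] unfolding F_def P_def c by simp
  have UP: "((\<lambda>x. U x / P x) \<longlongrightarrow> 4/3) at_top"
    unfolding U_def P_def by (rule log_weight_asymp[OF y0(1)])
  have "(R \<longlongrightarrow> 1/2 * \<bar>4/3 * c - 4/3 * c\<bar> + 1/4 * (\<bar>c\<bar> * \<bar>4/3 - 4/3\<bar>) + dev/4 * (4/3)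
     + (1/4 * (ln y0 + C2)) * 0 + C1 * 0) at_top"
    unfolding R_def
  proof (intro tendsto_add tendsto_mult_left tendsto_rabs tendsto_diff tendsto_const FP UP)
    show "((\<lambda>x. ln x / P x) \<longlongrightarrow> 0) at_top" unfolding P_def by real_asymp
    show "((\<lambda>x. (1 + ln x) / P x) \<longlongrightarrow> 0) at_top" unfolding P_def by real_asymp
  qed
  hence "(R \<longlongrightarrow> dev / 3) at_top" by simp
  hence "\<forall>\<^sub>F x in at_top. R x < dev / 2" by (rule order_tendstoD) (use dev in simp)
  moreover have "\<forall>\<^sub>F x in at_top. \<bar>beta x - c\<bar> \<le> R x"
    using eventually_ge_at_top[of y0] eventually_gt_at_top[of 1]
  proof eventually_elim
    case (elim x)
    define u where "u = ln x"
    have u: "u > 0" using elim by (simp add: u_def)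
    have Pu: "P x = u * sqrt u" "P x > 0" using u by (simp_all add: P_def u_def power_three_halves)
    define V where "V = (\<Sum>m\<in>nats_upto x. l m * ln (real m) * B (x / real m))"
    define V1 where "V1 = (\<Sum>m\<in>nats_upto (x / y0). l m * ln (real m) * B (x / real m))"
    define T where "T = (\<Sum>m\<in>nats_upto x - nats_upto (x / y0). l m * ln (real m) * B (x / real m))"
    have "nats_upto (x / y0) \<subseteq> nats_upto x" using elim y0 by (intro nats_upto_mono) (simp add: field_simps)
    hence V: "V = V1 + T" unfolding V_def V1_def T_def by (subst sum.subset_diff) (auto simp: add.commute)
    have T: "0 \<le> T" "T \<le> x * u * (ln y0 + C2)"
    proof -
      show "0 \<le> T" unfolding T_def
        by (intro sum_nonneg mult_nonneg_nonneg l_nonneg B_nonneg) (auto simp: mem_nats_upto)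
      show "T \<le> x * u * (ln y0 + C2)" unfolding T_def u_def using C2(2)[OF y0(2) elim(1)] .
    qed
    have V1: "\<bar>V1 - c * x * U x\<bar> \<le> dev * x * U x"
    proof -
      have eq: "V1 - c * x * U x = (\<Sum>m\<in>nats_upto (x / y0). l m * ln (real m) * (B (x / real m) - c * (x / real m / sqrt (ln (x / real m)))))"
        unfolding V1_def U_def by (simp add: sum_distrib_left sum_subtractf right_diff_distrib mult_ac)
      have le: "\<bar>(\<Sum>m\<in>nats_upto (x / y0). l m * ln (real m) * (B (x / real m) - c * (x / real m / sqrt (ln (x / real m)))))\<bar> \<le> (\<Sum>m\<in>nats_upto (x / y0). dev * x * (l m * ln (real m) / (real m * sqrt (ln (x / real m)))))"
      proof (rule order_trans[OF sum_abs], rule sum_mono)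
        fix m assume m: "m \<in> nats_upto (x / y0)"
        define y where "y = x / real m"
        have m0: "m > 0" "real m \<le> x / y0" using m by (auto simp: mem_nats_upto)
        hence yy: "y \<ge> y0" unfolding y_def using y0 by (simp add: field_simps)
        have "ln y \<ge> 1" using yy y0 by (meson ln_ge_iff less_le_trans order_trans)
        hence s: "sqrt (ln y) > 0" by simp
        have y: "y > 0" using yy y0 by linarith
        have "\<bar>beta y - c\<bar> \<le> dev" using yy y1 by (simp add: y0_def)
        moreover have "B y - c * (y / sqrt (ln y)) = (beta y - c) * (y / sqrt (ln y))"
          using s y by (simp add: beta_def field_simps)
        ultimately have "\<bar>B y - c * (y / sqrt (ln y))\<bar> \<le> dev * (y / sqrt (ln y))"
          using s y by (simp add: abs_mult mult_right_mono divide_right_mono)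
        moreover have ll: "l m * ln (real m) \<ge> 0" using l_nonneg[of m] m0 by simp
        ultimately have "(l m * ln (real m)) * \<bar>B y - c * (y / sqrt (ln y))\<bar> \<le> (l m * ln (real m)) * (dev * (y / sqrt (ln y)))"
          by (intro mult_left_mono)
        moreover have "(l m * ln (real m)) * (dev * (y / sqrt (ln y))) = dev * x * (l m * ln (real m) / (real m * sqrt (ln y)))"
          by (simp add: y_def)
        ultimately show "\<bar>l m * ln (real m) * (B (x / real m) - c * (x / real m / sqrt (ln (x / real m))))\<bar>
          \<le> dev * x * (l m * ln (real m) / (real m * sqrt (ln (x / real m))))"
          unfolding y_def[symmetric] abs_mult[of "l m * ln (real m)"] using ll by (simp only: abs_of_nonneg)
      qed
      have "(\<Sum>m\<in>nats_upto (x / y0). dev * x * (l m * ln (real m) / (real m * sqrt (ln (x / real m))))) = dev * x * U x"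
        by (simp only: U_def sum_distrib_left)
      with le show ?thesis unfolding eq by (simp only:)
    qed
    have main: "\<bar>B x * u ^ 2 - 1/2 * x * F x - 1/4 * V\<bar> \<le> C1 * x * (1 + u)"
      using C1(2)[of x] elim by (simp add: F_def V_def u_def)
    have x: "x > 0" using elim by simp
    have beta: "beta x = B x * u ^ 2 / (x * P x)"
    proof -
      have "sqrt u * sqrt u = u" "sqrt u > 0" using u by auto
      hence "u ^ 2 = sqrt u * (u * sqrt u)" by (simp add: power2_eq_square)
      thus ?thesis unfolding beta_def u_def[symmetric] Pu(1) using u x by simp
    qed
    have "\<bar>B x * u ^ 2 - c * x * P x\<bar> \<le> x * P x * R x"
    proof -
      define A1 where "A1 = \<bar>F x / P x - 4/3 * c\<bar>"
      define A2 where "A2 = \<bar>U x / P x - 4/3\<bar>"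
      have a1: "\<bar>F x - 4/3 * c * P x\<bar> = A1 * P x"
      proof -
        have "F x - 4/3 * c * P x = (F x / P x - 4/3 * c) * P x" using Pu(2) by (simp add: left_diff_distrib)
        thus ?thesis using Pu(2) by (simp add: A1_def abs_mult)
      qed
      have a2: "\<bar>U x - 4/3 * P x\<bar> = A2 * P x"
      proof -
        have "U x - 4/3 * P x = (U x / P x - 4/3) * P x" using Pu(2) by (simp add: left_diff_distrib)
        thus ?thesis using Pu(2) by (simp add: A2_def abs_mult)
      qed
      have b1: "\<bar>1/2 * x * (F x - 4/3 * c * P x)\<bar> = 1/2 * x * (A1 * P x)"
        using a1 x by (simp add: abs_mult)
      have b2: "\<bar>1/4 * c * x * (U x - 4/3 * P x)\<bar> = 1/4 * \<bar>c\<bar> * x * (A2 * P x)"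
        using a2 x by (simp add: abs_mult)
      \<comment> \<open>The main terms cancel because 1/2 * 4/3 + 1/4 * 4/3 = 1.\<close>
      have "B x * u ^ 2 - c * x * P x = (B x * u ^ 2 - 1/2 * x * F x - 1/4 * V) + 1/2 * x * (F x - 4/3 * c * P x)
         + 1/4 * c * x * (U x - 4/3 * P x) + 1/4 * (V1 - c * x * U x) + 1/4 * T"
        unfolding V by (simp add: algebra_simps)
      moreover have "\<bar>p + q + r + 1/4 * s + 1/4 * t\<bar> \<le> a + b + d + 1/4 * e + 1/4 * g"
        if "\<bar>p\<bar> \<le> a" "\<bar>q\<bar> = b" "\<bar>r\<bar> = d" "\<bar>s\<bar> \<le> e" "0 \<le> t" "t \<le> g" for p q r s t a b d e g :: real
        using that by linarith
      from this[OF main b1 b2 V1 T]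
      have "\<bar>(B x * u ^ 2 - 1/2 * x * F x - 1/4 * V) + 1/2 * x * (F x - 4/3 * c * P x)
         + 1/4 * c * x * (U x - 4/3 * P x) + 1/4 * (V1 - c * x * U x) + 1/4 * T\<bar>
        \<le> C1 * x * (1 + u) + 1/2 * x * (A1 * P x) + 1/4 * \<bar>c\<bar> * x * (A2 * P x)
           + 1/4 * (dev * x * U x) + 1/4 * (x * u * (ln y0 + C2))" .
      moreover have "x * P x * R x = C1 * x * (1 + u) + 1/2 * x * (A1 * P x) + 1/4 * \<bar>c\<bar> * x * (A2 * P x)
           + 1/4 * (dev * x * U x) + 1/4 * (x * u * (ln y0 + C2))"
        unfolding R_def A1_def[symmetric] A2_def[symmetric] u_def[symmetric] distrib_left
        using Pu(2) by (simp add: algebra_simps add_divide_distrib)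
      ultimately show ?thesis by simp
    qed
    hence "\<bar>B x * u ^ 2 - c * x * P x\<bar> / (x * P x) \<le> R x"
      using x Pu(2) by (simp add: pos_divide_le_eq mult_ac)
    moreover have "\<bar>beta x - c\<bar> = \<bar>B x * u ^ 2 - c * x * P x\<bar> / (x * P x)"
    proof -
      have "beta x - c = (B x * u ^ 2 - c * x * P x) / (x * P x)" unfolding beta using x Pu(2) by (simp add: field_simps)
      thus ?thesis using x Pu(2) by (simp add: abs_divide)
    qed
    ultimately show ?case by simp
  qed
  ultimately show ?thesis by eventually_elim linarith
qed

text \<open>The logarithmic mean up to x is controlled by the tent mean up to x^2, because ln(x^2 /
  n) >= ln x for n <= x. This starts the contraction with a finite deviation.\<close>

lemma beta_bounded:
  assumes G: "(\<lambda>N. \<Prod>p<N. if prime p then G_fac p (1 / real p) else 1) \<longlonglongrightarrow> G"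
  obtains K where "\<forall>\<^sub>F x in at_top. \<bar>beta x\<bar> \<le> K"
proof -
  obtain C where C: "C > 0" "\<And>x. x \<ge> 1 \<Longrightarrow> B x * ln x \<le> C * x * (\<Sum>n\<in>nats_upto x. f n / real n)"
    by (rule B_le_log_mean) auto
  define F where "F x = (\<Sum>n\<in>nats_upto x. f n / real n * ln (x / real n))" for x
  define c where "c = 4/3 * sqrt (L * G) / sqrt pi"
  have "((\<lambda>x. F x / ln x powr (3/2)) \<longlongrightarrow> c) at_top" using log_mean_tent_asymp[OF G] by (simp add: F_def c_def)
  hence "\<forall>\<^sub>F x in at_top. F x / ln x powr (3/2) < c + 1" by (rule order_tendstoD) simp
  moreover have "filterlim (\<lambda>x::real. x ^ 2) at_top at_top" by real_asymp
  ultimately have "\<forall>\<^sub>F x in at_top. F (x ^ 2) / ln (x ^ 2) powr (3/2) < c + 1"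
    by (rule eventually_compose_filterlim)
  hence "\<forall>\<^sub>F x in at_top. \<bar>beta x\<bar> \<le> C * (c + 1) * 2 powr (3/2)"
    using eventually_gt_at_top[of 1]
  proof eventually_elim
    case (elim x)
    define u where "u = ln x"
    have u: "u > 0" using elim by (simp add: u_def)
    have x2: "ln (x ^ 2) = 2 * u" using elim by (simp add: u_def ln_realpow)
    define Lm where "Lm = (\<Sum>n\<in>nats_upto x. f n / real n)"
    have "u * Lm = (\<Sum>n\<in>nats_upto x. f n / real n * u)" by (simp add: Lm_def sum_distrib_left mult.commute)
    also have "\<dots> \<le> (\<Sum>n\<in>nats_upto x. f n / real n * ln (x ^ 2 / real n))"
    proof (intro sum_mono mult_left_mono)
      fix n assume n: "n \<in> nats_upto x"
      have "x * 1 \<le> x * (x / real n)" using n elim by (intro mult_left_mono) (auto simp: mem_nats_upto)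
      hence "x \<le> x ^ 2 / real n" by (simp add: power2_eq_square)
      thus "u \<le> ln (x ^ 2 / real n)" unfolding u_def using elim by (intro ln_mono) auto
    qed (auto simp: f_range)
    also have "\<dots> \<le> F (x ^ 2)"
      unfolding F_def
    proof (intro sum_mono2 nats_upto_mono)
      show "x \<le> x ^ 2" using elim by (simp add: power2_eq_square)
      show "0 \<le> f n / real n * ln (x ^ 2 / real n)" if "n \<in> nats_upto (x ^ 2) - nats_upto x" for n
        using that by (intro mult_nonneg_nonneg divide_nonneg_nonneg f_range) (auto simp: mem_nats_upto)
    qed auto
    also have "\<dots> \<le> (c + 1) * (2 * u) powr (3/2)"
      using elim(1) u unfolding x2 by (simp add: field_simps)
    also have "(2 * u) powr (3/2) = 2 powr (3/2) * (u * sqrt u)"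
      using u by (simp add: powr_mult power_three_halves)
    finally have "u * Lm \<le> u * ((c + 1) * 2 powr (3/2) * sqrt u)" by (simp add: mult_ac)
    hence Lm: "Lm \<le> (c + 1) * 2 powr (3/2) * sqrt u" using u by simp
    have "B x * u \<le> C * x * Lm" using C(2)[of x] elim by (simp add: u_def Lm_def)
    also have "\<dots> \<le> C * x * ((c + 1) * 2 powr (3/2) * sqrt u)" using Lm C elim by (intro mult_left_mono) auto
    finally have "B x * (sqrt u * sqrt u) \<le> (C * (c + 1) * 2 powr (3/2) * x) * sqrt u" using u by (simp add: mult_ac)
    hence "(B x * sqrt u) * sqrt u \<le> (C * (c + 1) * 2 powr (3/2) * x) * sqrt u" by (simp only: mult.assoc)
    hence "B x * sqrt u \<le> C * (c + 1) * 2 powr (3/2) * x" using u by (simp only: mult_le_cancel_right) simp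
    hence "beta x \<le> C * (c + 1) * 2 powr (3/2)"
      unfolding beta_def u_def[symmetric] using elim by (simp add: pos_divide_le_eq)
    moreover have "beta x \<ge> 0" unfolding beta_def using elim by (intro divide_nonneg_nonneg mult_nonneg_nonneg B_nonneg) auto
    ultimately show ?case by simp
  qed
  thus ?thesis by (rule that)
qed

theorem beta_tendsto:
  assumes G: "(\<lambda>N. \<Prod>p<N. if prime p then G_fac p (1 / real p) else 1) \<longlonglongrightarrow> G"
  shows "(beta \<longlongrightarrow> sqrt (L * G) / sqrt pi) at_top"
proof -
  define c where "c = sqrt (L * G) / sqrt pi"
  obtain K where K: "\<forall>\<^sub>F x in at_top. \<bar>beta x\<bar> \<le> K" by (rule beta_bounded[OF G]) auto
  define dev where "dev = \<bar>K\<bar> + \<bar>c\<bar> + 1"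
  have dev: "dev > 0" by (simp add: dev_def)
  \<comment> \<open>The threshold for x depends on j; a given precision takes only finitely many
    halvings.\<close>
  have "\<forall>\<^sub>F x in at_top. \<bar>beta x - c\<bar> \<le> dev / 2 ^ j" for j
  proof (induction j)
    case 0
    show ?case using K by eventually_elim (simp add: dev_def)
  next
    case (Suc j)
    have "\<forall>\<^sub>F x in at_top. \<bar>beta x - c\<bar> \<le> (dev / 2 ^ j) / 2"
    proof (rule beta_contraction[OF G c_def])
      show "dev / 2 ^ j > 0" using dev by simp
      show "\<forall>\<^sub>F x in at_top. \<bar>beta x - c\<bar> \<le> dev / 2 ^ j" by (rule Suc)
    qed
    thus ?case by (simp add: mult.commute)
  qed
  note ev = this
  show ?thesis unfolding c_def[symmetric]
  proof (rule tendstoI)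
    fix e :: real assume e: "e > 0"
    obtain j where j: "dev / e < 2 ^ j" using real_arch_pow[of 2 "dev / e"] by auto
    hence "dev / 2 ^ j < e" using e by (simp add: field_simps)
    with ev[of j] show "\<forall>\<^sub>F x in at_top. dist (beta x) c < e"
      by (auto elim!: eventually_mono simp: dist_real_def)
  qed
qed

end

section \<open>Binary forms\<close>

text \<open>The norm of a + b w where w^2 = t w - 1: w is i for t = 0 and a primitive sixth root of
  unity for t = 1. Multiplicativity of the form is that of the norm.\<close>

definition qform :: "int \<Rightarrow> int \<Rightarrow> int \<Rightarrow> int" where
  "qform t a b = a ^ 2 + t * a * b + b ^ 2"

lemma qform_mult: "qform t a b * qform t c d = qform t (a * c - b * d) (a * d + b * c + t * b * d)"
  unfolding qform_def by (simp add: power2_eq_square algebra_simps)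

section \<open>Representation of primes and of admissible integers\<close>

lemma int_fermat:
  fixes a :: int assumes "prime p" "\<not> int p dvd a" shows "[a ^ (p - 1) = 1] (mod int p)"
proof -
  define c where "c = nat (a mod int p)"
  have p0: "int p > 0" using assms by (simp add: prime_gt_0_nat)
  have c: "int c = a mod int p" using p0 by (simp add: c_def)
  have "\<not> p dvd c"
  proof
    assume "p dvd c"
    hence "int p dvd a mod int p" by (simp add: c[symmetric])
    thus False using assms by (simp add: dvd_mod_iff)
  qed
  hence "[c ^ (p - 1) = 1] (mod p)" using fermat_theorem assms by blast
  hence "[int c ^ (p - 1) = 1] (mod int p)" by (metis cong_int_iff of_nat_1 of_nat_power)
  moreover have "[a = int c] (mod int p)" unfolding c by (simp add: cong_def)
  ultimately show ?thesis using cong_pow cong_trans by blast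
qed

text \<open>Pigeonhole: the (s + 1)^2 > p pairs with entries in 0..s cannot have distinct values of
  i - x j modulo p, and the difference of two colliding pairs is as small as required.\<close>

lemma thue:
  assumes p: "prime p"
  obtains a b :: int where "(a, b) \<noteq> (0, 0)" "a ^ 2 < int p" "b ^ 2 < int p" "int p dvd a - x * b"
proof -
  define s where "s = nat \<lfloor>sqrt (real p)\<rfloor>"
  have p0: "p > 1" using p by (rule prime_gt_1_nat)
  have s1: "s ^ 2 < p"
  proof -
    have "real s \<le> sqrt (real p)" unfolding s_def by simp
    hence "(real s)\<^sup>2 \<le> (sqrt (real p))\<^sup>2" by (intro power_mono) auto
    hence "real (s ^ 2) \<le> real p" by simp
    hence "s ^ 2 \<le> p" by linarith
    \<comment> \<open>A prime is not a perfect square, which makes the size bounds strict.\<close>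
    moreover have "s ^ 2 \<noteq> p" using p prime_power_iff[of s 2] by auto
    ultimately show ?thesis by simp
  qed
  have s2: "p < (s + 1) ^ 2"
  proof -
    have "sqrt (real p) < real (s + 1)" unfolding s_def by (simp add: of_nat_nat) linarith
    hence "(sqrt (real p))\<^sup>2 < (real (s + 1))\<^sup>2" by (intro power_strict_mono) auto
    hence "real p < real ((s + 1) ^ 2)" by simp
    thus ?thesis by linarith
  qed
  define S where "S = {0..int s} \<times> {0..int s}"
  define g where "g = (\<lambda>(i, j). (i - x * j) mod int p)"
  have "card (g ` S) \<le> card {0..<int p}" using p0 by (intro card_mono) (auto simp: g_def)
  also have "\<dots> = p" by simp
  also have "p < card S" using s2 by (simp add: S_def card_cartesian_product power2_eq_square nat_add_distrib)
  finally have "\<not> inj_on g S" using pigeonhole by blast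
  then obtain i j i' j' where ij: "(i, j) \<in> S" "(i', j') \<in> S" "g (i, j) = g (i', j')" "(i, j) \<noteq> (i', j')"
    unfolding inj_on_def by fast
  have bound: "d ^ 2 < int p" if "\<bar>d\<bar> \<le> int s" for d
  proof -
    have "d ^ 2 \<le> int s ^ 2" using that by (metis abs_of_nat abs_le_square_iff)
    also have "\<dots> < int p" using s1 by (metis of_nat_less_iff of_nat_power)
    finally show ?thesis .
  qed
  show ?thesis
  proof (rule that[of "i - i'" "j - j'"])
    show "(i - i', j - j') \<noteq> (0, 0)" using ij by auto
    show "(i - i')\<^sup>2 < int p" "(j - j')\<^sup>2 < int p" using ij by (auto simp: S_def intro!: bound)
    have "int p dvd (i - x * j) - (i' - x * j')"
      using ij(3) by (simp add: g_def mod_eq_dvd_iff)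
    thus "int p dvd (i - i') - x * (j - j')" by (simp add: algebra_simps)
  qed
qed

text \<open>A primitive root modulo p raised to the power (p - 1) / q has order exactly q.\<close>

lemma ex_power_order:
  fixes p k q :: nat
  assumes p: "prime p" and pk: "p - 1 = q * k" and k: "k > 0" and q: "q > 1"
  obtains y :: int where "int p dvd y ^ q - 1" "\<And>j. 0 < j \<Longrightarrow> j < q \<Longrightarrow> \<not> int p dvd y ^ j - 1"
proof -
  obtain g where g: "ord p g = p - 1" using residue_prime_has_primroot[OF p] by blast
  have iff: "int p dvd (int g ^ k) ^ j - 1 \<longleftrightarrow> q dvd j" for j
  proof -
    have "int p dvd (int g ^ k) ^ j - 1 \<longleftrightarrow> [int (g ^ (k * j)) = int 1] (mod int p)"
      by (simp add: cong_iff_dvd_diff power_mult)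
    also have "\<dots> \<longleftrightarrow> [g ^ (k * j) = 1] (mod p)" by (simp only: cong_int_iff)
    also have "\<dots> \<longleftrightarrow> q * k dvd k * j" by (simp only: ord_divides g pk)
    also have "\<dots> \<longleftrightarrow> q dvd j" using k by (simp add: mult.commute)
    finally show ?thesis .
  qed
  show ?thesis
    by (rule that[of "int g ^ k"]) (unfold iff, auto dest: dvd_imp_le)
qed

text \<open>An element of order 4 is a square root of -1 modulo p. Thue's lemma then gives a
  multiple of p strictly between 0 and 2 p of the form a^2 + b^2.\<close>

lemma sum_two_squares_prime:
  assumes p: "prime p" and "p mod 4 = 1"
  shows "\<exists>a b. int p = qform 0 a b"
proof -
  define k where "k = p div 4"
  have pk: "p - 1 = 4 * k" using assms by (simp add: k_def) presburger
  have "k > 0" using pk prime_gt_1_nat[OF p] by (cases k) auto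
  then obtain y where y: "int p dvd y ^ 4 - 1" "\<not> int p dvd y ^ 2 - 1"
    using ex_power_order[OF p pk] by (metis numeral_less_iff one_less_numeral_iff semiring_norm(76) semiring_norm(78) zero_less_numeral)
  have "y ^ 4 - 1 = (y ^ 2 - 1) * (y ^ 2 + 1)" by (simp add: algebra_simps flip: power_add)
  hence y1: "int p dvd y ^ 2 + 1" using y p by (metis prime_dvd_multD prime_nat_int_transfer)
  obtain a b where ab: "(a, b) \<noteq> (0, 0)" "a ^ 2 < int p" "b ^ 2 < int p" "int p dvd a - y * b"
    using thue[OF p] by blast
  have "a ^ 2 + b ^ 2 = (a - y * b) * (a + y * b) + (y ^ 2 + 1) * b ^ 2"
    by (simp add: power2_eq_square algebra_simps)
  hence "int p dvd a ^ 2 + b ^ 2" using ab y1 by simp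
  then obtain c where c: "a ^ 2 + b ^ 2 = int p * c" by auto
  have p0: "int p > 0" using p by (simp add: prime_gt_0_nat)
  have "0 < a ^ 2 + b ^ 2" using ab(1) by (auto simp: sum_power2_gt_zero_iff)
  hence "c > 0" using c p0 by (simp add: zero_less_mult_iff)
  moreover have "int p * c < int p * 2" using ab c by simp
  hence "c < 2" using p0 by simp
  ultimately have "c = 1" by simp
  thus ?thesis using c by (intro exI[of _ a] exI[of _ b]) (simp add: qform_def)
qed

text \<open>An element of order 3 is a root of y^2 + y + 1 modulo p. Thue's lemma now only bounds
  the value below 3 p, so the multiple 2 p has to be excluded separately.\<close>

lemma loeschian_prime:
  assumes p: "prime p" and "p mod 3 = 1"
  shows "\<exists>a b. int p = qform 1 a b"
proof -
  define k where "k = p div 3"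
  have pk: "p - 1 = 3 * k" using assms by (simp add: k_def) presburger
  have "k > 0" using pk prime_gt_1_nat[OF p] by (cases k) auto
  then obtain y where y: "int p dvd y ^ 3 - 1" "\<not> int p dvd y ^ 1 - 1"
    using ex_power_order[OF p pk] by (metis one_less_numeral_iff semiring_norm(77) zero_less_one)
  have "y ^ 3 - 1 = (y ^ 1 - 1) * (y ^ 2 + y + 1)" by (simp add: power2_eq_square power3_eq_cube algebra_simps)
  hence y1: "int p dvd y ^ 2 + y + 1" using y p by (metis prime_dvd_multD prime_nat_int_transfer)
  obtain a b where ab: "(a, b) \<noteq> (0, 0)" "a ^ 2 < int p" "b ^ 2 < int p" "int p dvd a - y * b"
    using thue[OF p] by blast
  have "a ^ 2 + a * b + b ^ 2 = (a - y * b) * (a + y * b + b) + (y ^ 2 + y + 1) * b ^ 2"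
    by (simp add: power2_eq_square algebra_simps)
  hence "int p dvd a ^ 2 + a * b + b ^ 2" using ab y1 by simp
  then obtain c where c: "a ^ 2 + a * b + b ^ 2 = int p * c" by auto
  have p0: "int p > 0" using p by (simp add: prime_gt_0_nat)
  have sq: "4 * (a ^ 2 + a * b + b ^ 2) = (2 * a + b) ^ 2 + 3 * b ^ 2" by (simp add: power2_eq_square algebra_simps)
  have "0 < (2 * a + b) ^ 2 + 3 * b ^ 2"
  proof (cases "b = 0")
    case True thus ?thesis using ab(1) by simp
  next
    case False
    hence "b ^ 2 > 0" by simp
    thus ?thesis using zero_le_power2[of "2 * a + b"] by linarith
  qed
  hence "0 < 4 * (a ^ 2 + a * b + b ^ 2)" unfolding sq .
  hence "0 < a ^ 2 + a * b + b ^ 2" by (rule zero_less_mult_pos) simp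
  hence c0: "c > 0" using c p0 by (simp add: zero_less_mult_iff)
  have "2 * (a * b) \<le> a ^ 2 + b ^ 2" using zero_le_power2[of "a - b"] by (simp add: power2_eq_square algebra_simps)
  hence "int p * c < int p * 3" using ab c by linarith
  hence c3: "c < 3" using p0 by simp
  \<comment> \<open>An even value of a^2 + a b + b^2 forces a and b to be even, so 4 would divide 2
    p.\<close>
  have "c \<noteq> 2"
  proof
    assume "c = 2"
    hence e: "even (a ^ 2 + a * b + b ^ 2)" using c by simp
    hence "even a" "even b" by auto
    then obtain u v where "a = 2 * u" "b = 2 * v" by (auto elim!: evenE)
    hence "int p * 2 = 4 * (u ^ 2 + u * v + v ^ 2)" using c \<open>c = 2\<close> by (simp add: power2_eq_square algebra_simps)
    hence "even p" by presburger
    hence "p = 2" using p by (metis prime_odd_nat prime_ge_2_nat le_neq_implies_less)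
    thus False using assms by simp
  qed
  hence "c = 1" using c0 c3 by simp
  thus ?thesis using c by (intro exI[of _ a] exI[of _ b]) (simp add: qform_def)
qed

text \<open>If p did not divide b, raising a^2 = -b^2 to the odd power (p - 1)/2 would give 1 = -1
  modulo p by Fermat.\<close>

lemma sum_two_squares_inert:
  assumes p: "prime p" and "p mod 4 = 3" and dvd: "int p dvd qform 0 a b"
  shows "int p dvd a \<and> int p dvd b"
proof -
  have pp: "prime (int p)" using p by simp
  define k where "k = p div 4"
  have pk: "p - 1 = 2 * (2 * k + 1)" unfolding k_def using assms(2) by presburger
  have dvd: "int p dvd a ^ 2 + b ^ 2" using dvd by (simp add: qform_def)
  have "int p dvd b"
  proof (rule ccontr)
    assume b: "\<not> int p dvd b"
    have a: "\<not> int p dvd a"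
    proof
      assume "int p dvd a"
      hence "int p dvd b ^ 2" using dvd by (metis dvd_add_right_iff dvd_mult power2_eq_square)
      thus False using b pp prime_dvd_power by blast
    qed
    have "[a ^ 2 = - (b ^ 2)] (mod int p)" using dvd by (simp add: cong_iff_dvd_diff)
    hence "[(a ^ 2) ^ (2 * k + 1) = (- (b ^ 2)) ^ (2 * k + 1)] (mod int p)" by (rule cong_pow)
    hence 1: "[a ^ (p - 1) = - (b ^ (p - 1))] (mod int p)" unfolding pk power_mult by simp
    have 2: "[- (b ^ (p - 1)) = - 1] (mod int p)"
      using int_fermat[OF p b] by (simp only: cong_minus_minus_iff)
    have "[1 = - 1] (mod int p)"
      using cong_trans[OF cong_sym[OF int_fermat[OF p a]] cong_trans[OF 1 2]] .
    hence "int p dvd 2" by (simp add: cong_iff_dvd_diff)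
    hence "p dvd 2" by (metis int_dvd_int_iff of_nat_numeral)
    hence "p \<le> 2" by (rule dvd_imp_le) simp
    thus False using assms(2) prime_ge_2_nat[OF p] by simp
  qed
  moreover from this have "int p dvd a ^ 2" using dvd by (metis dvd_add_left_iff dvd_mult power2_eq_square)
  ultimately show ?thesis using pp prime_dvd_power by blast
qed

text \<open>A zero of the form modulo p gives a^3 = b^3. As p - 1 = 3 k + 1, Fermat then yields a =
  b if p does not divide b, so p divides 3 b^2 and hence p = 3, which is not 2 modulo 3.\<close>

lemma loeschian_inert:
  assumes p: "prime p" and "p mod 3 = 2" and dvd: "int p dvd qform 1 a b"
  shows "int p dvd a \<and> int p dvd b"
proof -
  have pp: "prime (int p)" using p by simp
  define k where "k = p div 3"
  have pk: "p - 1 = 3 * k + 1" unfolding k_def using assms(2) by presburger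
  have dvd: "int p dvd a ^ 2 + a * b + b ^ 2" using dvd by (simp add: qform_def)
  have "int p dvd b"
  proof (rule ccontr)
    assume b: "\<not> int p dvd b"
    have a: "\<not> int p dvd a"
    proof
      assume "int p dvd a"
      hence "int p dvd a ^ 2 + a * b" by (simp add: power2_eq_square)
      hence "int p dvd b ^ 2" using dvd by (metis dvd_add_right_iff)
      thus False using b pp prime_dvd_power by blast
    qed
    have "int p dvd a ^ 3 - b ^ 3"
    proof -
      have "a ^ 3 - b ^ 3 = (a - b) * (a ^ 2 + a * b + b ^ 2)"
        by (simp add: power2_eq_square power3_eq_cube algebra_simps)
      thus ?thesis using dvd by simp
    qed
    hence "[a ^ 3 = b ^ 3] (mod int p)" by (simp add: cong_iff_dvd_diff)
    hence 1: "[a * a ^ (3 * k) = a * b ^ (3 * k)] (mod int p)"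
      unfolding power_mult by (rule cong_scalar_left[OF cong_pow])
    have "[a ^ (3 * k + 1) = b ^ (3 * k + 1)] (mod int p)"
      using cong_trans[OF int_fermat[OF p a] cong_sym[OF int_fermat[OF p b]]] unfolding pk .
    hence "[a * a ^ (3 * k) = b * b ^ (3 * k)] (mod int p)" by simp
    hence "[a * b ^ (3 * k) = b * b ^ (3 * k)] (mod int p)" using cong_trans[OF cong_sym[OF 1]] by blast
    hence "int p dvd (a - b) * b ^ (3 * k)" by (simp add: cong_iff_dvd_diff left_diff_distrib)
    hence "int p dvd a - b" using b pp prime_dvd_power prime_dvd_multD by blast
    moreover have "a ^ 2 + a * b + b ^ 2 = (a - b) * (a + 2 * b) + 3 * b ^ 2"
      by (simp add: power2_eq_square algebra_simps)
    ultimately have "int p dvd 3 * b ^ 2" using dvd by (metis dvd_add_right_iff dvd_mult2)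
    hence "int p dvd 3" using b pp prime_dvd_power prime_dvd_multD by blast
    hence "p dvd 3" by (metis int_dvd_int_iff of_nat_numeral)
    hence "p = 3" using p by (metis primes_dvd_imp_eq two_is_prime_nat prime_nat_numeral_eq numeral_3_eq_3 dvd_imp_le prime_ge_2_nat le_antisym not_less_eq_eq zero_less_Suc dvd_refl odd_numeral dvd_def even_numeral One_nat_def Suc_1 le_SucE)
    thus False using assms(2) by simp
  qed
  moreover from this have "int p dvd a ^ 2"
  proof -
    have "int p dvd a * b + b ^ 2" using calculation by (simp add: power2_eq_square)
    thus ?thesis using dvd by (metis add.assoc dvd_add_left_iff)
  qed
  ultimately show ?thesis using pp prime_dvd_power by blast
qed

context real_character begin

text \<open>Forward: descent, since an inert prime dividing a value divides both arguments and p^2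
  can be split off. Backward: the values are closed under products, and an even power of an inert
  prime is the value at (p^j, 0).\<close>

lemma form_iff_admissible:
  assumes split: "\<And>p. prime p \<Longrightarrow> chr p \<noteq> -1 \<Longrightarrow> \<exists>a b. int p = qform t a b"
    and inert: "\<And>p a b. prime p \<Longrightarrow> chr p = -1 \<Longrightarrow> int p dvd qform t a b \<Longrightarrow> int p dvd a \<and> int p dvd b"
    and m: "m > 0"
  shows "(\<exists>a b. int m = qform t a b) \<longleftrightarrow> admissible m"
proof
  assume "\<exists>a b. int m = qform t a b"
  thus "admissible m" using m
  proof (induction m rule: less_induct)
    case (less m)
    show ?case
    proof (cases "\<exists>p. prime p \<and> chr p = -1 \<and> p dvd m")
      case False
      hence "multiplicity p m = 0" if "prime p" "chr p = -1" for p
        using that not_dvd_imp_multiplicity_0 by blast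
      thus ?thesis using less.prems by (auto simp: admissible_def)
    next
      case True
      then obtain p where p: "prime p" "chr p = -1" "p dvd m" by blast
      obtain a b where ab: "int m = qform t a b" using less.prems by blast
      have "int p dvd a \<and> int p dvd b" using p by (intro inert) (auto simp flip: ab)
      then obtain u v where uv: "a = int p * u" "b = int p * v" by (auto elim!: dvdE)
      have q: "int m = int p ^ 2 * qform t u v"
        unfolding ab uv by (simp add: qform_def power2_eq_square algebra_simps)
      have p1: "p > 1" using prime_gt_1_nat[OF p(1)] .
      define m' where "m' = nat (qform t u v)"
      have "qform t u v > 0" using q less.prems p1
        by (metis of_nat_0_less_iff zero_less_mult_iff zero_le_power2 not_le)
      hence m': "int m' = qform t u v" "m' > 0" by (auto simp: m'_def)
      have "int m = int (p ^ 2 * m')" using q m' by simp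
      hence mm: "m = p ^ 2 * m'" by (simp only: of_nat_eq_iff)
      have "1 * m' < p ^ 2 * m'" using one_less_power[OF p1, of 2] m' by (intro mult_strict_right_mono) auto
      hence "admissible m'" using less.IH[of m'] m' mm by auto
      moreover have "multiplicity q m = (if q = p then 2 else 0) + multiplicity q m'" if "prime q" for q
        unfolding mm using that p p1 m'
        by (subst prime_elem_multiplicity_mult_distrib)
           (auto simp: prime_elem_multiplicity_power_distrib prime_multiplicity_other)
      ultimately show ?thesis using less.prems by (auto simp: admissible_def)
    qed
  qed
next
  have pow: "\<exists>a b. x ^ k = qform t a b" if "\<exists>a b. x = qform t a b" for x k
  proof (induction k)
    case 0
    show ?case by (rule exI[of _ 1], rule exI[of _ 0]) (simp add: qform_def)
  next
    case (Suc k)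
    thus ?case using that by (metis power_Suc qform_mult)
  qed
  assume "admissible m"
  with m show "\<exists>a b. int m = qform t a b"
  proof (induction m rule: prime_power_coprime_induct)
    case one
    show ?case by (rule exI[of _ 1], rule exI[of _ 0]) (simp add: qform_def)
  next
    case (prime_power p k m)
    have "f (p ^ k * m) = 1" using prime_power by (simp add: f_def)
    hence fm: "f m = 1 \<and> \<not> (chr p = -1 \<and> odd k)"
      using f_prime_power_mult[of p m k] prime_power by (auto split: if_splits)
    hence "admissible m" by (simp add: f_def)
    then obtain a b where m: "int m = qform t a b" using prime_power.IH by blast
    have "\<exists>a b. int p ^ k = qform t a b"
    proof (cases "chr p = -1")
      case True
      then obtain j where "k = 2 * j" using fm by (auto elim!: evenE)
      hence "int p ^ k = qform t (int p ^ j) 0" by (simp add: qform_def power_mult mult.commute flip: power_mult)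
      thus ?thesis by blast
    qed (use pow split prime_power in blast)
    then obtain c d where "int p ^ k = qform t c d" by blast
    hence "int (p ^ k * m) = qform t c d * qform t a b" using m by simp
    thus ?case by (metis qform_mult)
  qed
qed

end

section \<open>The characters modulo 4 and 3\<close>

definition chi4 :: "nat \<Rightarrow> real" where
  "chi4 n = (if n mod 4 = 1 then 1 else if n mod 4 = 3 then -1 else 0)"

definition chi3 :: "nat \<Rightarrow> real" where
  "chi3 n = (if n mod 3 = 1 then 1 else if n mod 3 = 2 then -1 else 0)"

lemma chi4_mult: "chi4 (m * n) = chi4 m * chi4 n"
proof -
  define g :: "nat \<Rightarrow> real" where "g k = (if k = 1 then 1 else if k = 3 then -1 else 0)" for k
  have "g (u * v mod 4) = g u * g v" if "u \<in> {0, 1, 2, 3}" "v \<in> {0, 1, 2, 3}" for u v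
    using that by (auto simp: g_def)
  moreover have "k mod 4 \<in> {0, 1, 2, 3}" for k :: nat
    unfolding insert_iff empty_iff by presburger
  ultimately have "g ((m mod 4) * (n mod 4) mod 4) = g (m mod 4) * g (n mod 4)" by metis
  hence "g ((m * n) mod 4) = g (m mod 4) * g (n mod 4)" by (simp only: mod_mult_eq)
  thus ?thesis by (simp only: chi4_def g_def)
qed

lemma chi3_mult: "chi3 (m * n) = chi3 m * chi3 n"
proof -
  define g :: "nat \<Rightarrow> real" where "g k = (if k = 1 then 1 else if k = 2 then -1 else 0)" for k
  have "g (u * v mod 3) = g u * g v" if "u \<in> {0, 1, 2}" "v \<in> {0, 1, 2}" for u v
    using that by (auto simp: g_def)
  moreover have "k mod 3 \<in> {0, 1, 2}" for k :: nat
    unfolding insert_iff empty_iff by presburger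
  ultimately have "g ((m mod 3) * (n mod 3) mod 3) = g (m mod 3) * g (n mod 3)" by metis
  hence "g ((m * n) mod 3) = g (m mod 3) * g (n mod 3)" by (simp only: mod_mult_eq)
  thus ?thesis by (simp only: chi3_def g_def)
qed

lemma sum_chi4: "(\<Sum>n=1..N. chi4 n) = (if N mod 4 = 1 \<or> N mod 4 = 2 then 1 else 0)"
proof (induction N)
  case (Suc N)
  have "N mod 4 \<in> {0, 1, 2, 3}" by auto
  thus ?case using Suc by (auto simp: chi4_def mod_Suc)
qed simp

lemma sum_chi3: "(\<Sum>n=1..N. chi3 n) = (if N mod 3 = 1 then 1 else 0)"
proof (induction N)
  case (Suc N)
  have "N mod 3 \<in> {0, 1, 2}" by auto
  thus ?case using Suc by (auto simp: chi3_def mod_Suc)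
qed simp

text \<open>Leibniz's series. The term at index n belongs to n + 1, so the nonzero terms sit at even
  indices.\<close>

lemma chi4_L_sums: "(\<lambda>n. chi4 (Suc n) / real (Suc n)) sums (pi / 4)"
proof -
  have "summable (\<lambda>k. (-1) ^ k * 1 / real (k * 2 + 1))"
    using summable_arctan_series[of 1] by simp
  hence "(\<lambda>k. (-1) ^ k * 1 / real (k * 2 + 1)) sums (pi / 4)"
    unfolding pi_series by (rule summable_sums)
  also have "(\<lambda>k. (-1) ^ k * 1 / real (k * 2 + 1)) = (\<lambda>k. (\<lambda>n. chi4 (Suc n) / real (Suc n)) (2 * k))"
  proof
    fix k :: nat
    have "chi4 (Suc (2 * k)) = (-1) ^ k"
    proof (cases "even k")
      case True
      then obtain j where "k = 2 * j" by (elim evenE)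
      hence "Suc (2 * k) mod 4 = 1" by presburger
      thus ?thesis using True by (simp add: chi4_def)
    next
      case False
      then obtain j where "k = 2 * j + 1" by (elim oddE)
      hence "Suc (2 * k) mod 4 = 3" by presburger
      thus ?thesis using False by (simp add: chi4_def)
    qed
    thus "(-1) ^ k * 1 / real (k * 2 + 1) = (\<lambda>n. chi4 (Suc n) / real (Suc n)) (2 * k)" by (simp add: mult.commute)
  qed
  finally have "(\<lambda>k. (\<lambda>n. chi4 (Suc n) / real (Suc n)) (2 * k)) sums (pi / 4)" .
  moreover have "chi4 (Suc n) / real (Suc n) = 0" if "n \<notin> range ((*) 2)" for n
  proof -
    have "odd n" using that by (auto elim!: evenE)
    hence "Suc n mod 4 \<noteq> 1" "Suc n mod 4 \<noteq> 3" by presburger+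
    thus ?thesis by (simp add: chi4_def)
  qed
  ultimately show ?thesis
    by (subst (asm) sums_mono_reindex[of "(*) 2"]) (auto simp: strict_mono_def)
qed

text \<open>The polynomial \<open>\<Sum>n<N. chi3 (n + 1) * x ^ n\<close> is within \<open>2 * x ^ N\<close> of \<open>1 / (1 + x + x\<^sup>2)\<close>
  on the unit interval, and both have explicit antiderivatives.\<close>

lemma chi3_L_sums: "(\<lambda>n. chi3 (Suc n) / real (Suc n)) sums (pi / (3 * sqrt 3))"
proof -
  \<comment> \<open>Multiplication by 1 + x + x^2 telescopes because three consecutive values of
    \<open>chi3\<close> add up to 0; the two remaining boundary terms are each at most x^N in
    absolute value.\<close>
  have poly: "(\<Sum>n<N. chi3 (Suc n) * x ^ n) * (1 + x + x ^ 2) = 1 - chi3 (Suc N) * x ^ N + chi3 N * x ^ Suc N" for N and x :: real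
  proof (induction N)
    case (Suc N)
    have "N mod 3 \<in> {0, 1, 2}" by auto
    hence c: "chi3 (Suc (Suc N)) = - chi3 (Suc N) - chi3 N" by (auto simp: chi3_def mod_Suc)
    have "(\<Sum>n<Suc N. chi3 (Suc n) * x ^ n) * (1 + x + x ^ 2)
      = (1 - chi3 (Suc N) * x ^ N + chi3 N * x ^ Suc N) + chi3 (Suc N) * x ^ N * (1 + x + x ^ 2)"
      using Suc by (simp add: distrib_right)
    also have "\<dots> = 1 - chi3 (Suc (Suc N)) * x ^ Suc N + chi3 (Suc N) * x ^ Suc (Suc N)"
      unfolding c by (simp add: algebra_simps power2_eq_square)
    finally show ?case .
  qed (simp add: chi3_def)
  \<comment> \<open>From completing the square: 1 + x + x^2 = 3/4 * (1 + ((2 x + 1) / sqrt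
    3)^2).\<close>
  define A where "A x = 2 / sqrt 3 * arctan ((2 * x + 1) / sqrt 3)" for x :: real
  have A': "(A has_real_derivative 1 / (1 + x + x ^ 2)) (at x)" for x
  proof -
    have "((\<lambda>x. (2 * x + 1) / sqrt 3) has_real_derivative 2 / sqrt 3) (at x)"
      by (intro DERIV_cdivide) (auto intro!: derivative_eq_intros)
    hence "(A has_real_derivative 2 / sqrt 3 * (inverse (1 + ((2 * x + 1) / sqrt 3) ^ 2) * (2 / sqrt 3))) (at x)"
      unfolding A_def[abs_def] by (intro DERIV_cmult DERIV_chain2[OF DERIV_arctan])
    also have "2 / sqrt 3 * (inverse (1 + ((2 * x + 1) / sqrt 3) ^ 2) * (2 / sqrt 3)) = 1 / (1 + x + x ^ 2)"
    proof -
      have q: "1 + ((2 * x + 1) / sqrt 3) ^ 2 = 4 / 3 * (1 + x + x ^ 2)"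
        by (simp add: power_divide power2_eq_square field_simps)
      have "2 / sqrt 3 * (inverse w * (2 / sqrt 3)) = (2 / sqrt 3 * (2 / sqrt 3)) * inverse w" for w
        by (simp only: mult_ac)
      also have "2 / sqrt 3 * (2 / sqrt 3) = 4 / (3 :: real)" by simp
      finally have "2 / sqrt 3 * (inverse w * (2 / sqrt 3)) = 4 / 3 * inverse w" for w .
      moreover have "4 / 3 * inverse (4 / 3 * u) = 1 / u" for u :: real
        by (cases "u = 0") (simp_all add: field_simps)
      ultimately show ?thesis unfolding q by (simp only:)
    qed
    finally show ?thesis .
  qed
  have A01: "A 1 - A 0 = pi / (3 * sqrt 3)"
  proof -
    have 1: "arctan (sqrt 3) = pi / 3"
    proof (rule arctan_unique)
      show "- (pi / 2) < pi / 3" "pi / 3 < pi / 2" using pi_gt_zero by linarith+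
    qed (rule tan_60)
    have 2: "arctan (1 / sqrt 3) = pi / 6"
    proof (rule arctan_unique)
      show "- (pi / 2) < pi / 6" "pi / 6 < pi / 2" using pi_gt_zero by linarith+
    qed (rule tan_30)
    have 3: "(2 * 1 + 1) / sqrt 3 = sqrt 3" by (simp add: real_div_sqrt)
    have 4: "(2 * 0 + 1) / sqrt 3 = 1 / sqrt 3" by simp
    define w where "w = 1 / sqrt 3"
    have "2 / sqrt 3 = 2 * w" "pi / (3 * sqrt 3) = pi / 3 * w" by (simp_all add: w_def)
    thus ?thesis unfolding A_def 3 4 1 2 by (simp add: algebra_simps)
  qed
  have bound: "\<bar>(\<Sum>n<N. chi3 (Suc n) / real (Suc n)) - (A 1 - A 0)\<bar> \<le> 2 / real (Suc N)" for N
  proof -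
    define P where "P x = (\<Sum>n<N. chi3 (Suc n) / real (Suc n) * x ^ Suc n) - A x" for x
    define p where "p x = (\<Sum>n<N. chi3 (Suc n) * x ^ n) - 1 / (1 + x + x ^ 2)" for x
    \<comment> \<open>The antiderivative of 2 x^N. Monotonicity of P + R and of R - P on [0, 1]
      turns the pointwise bound for \<open>p\<close> into the bound for the partial sum.\<close>
    define R where "R x = 2 / real (Suc N) * x ^ Suc N" for x :: real
    have R': "(R has_real_derivative 2 * x ^ N) (at x)" for x
    proof -
      have "2 / real (Suc N) * (real (Suc N) * x ^ (Suc N - Suc 0)) = 2 * x ^ N" by simp
      thus ?thesis unfolding R_def
        using DERIV_cmult[OF DERIV_pow[of "Suc N" x], of "2 / real (Suc N)"] by (simp only:)
    qed
    have P': "(P has_real_derivative p x) (at x)" for x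
    proof -
      have "((\<lambda>x. chi3 (Suc n) / real (Suc n) * x ^ Suc n) has_real_derivative chi3 (Suc n) * x ^ n) (at x)" for n
        using DERIV_cmult[OF DERIV_pow[of "Suc n" x], of "chi3 (Suc n) / real (Suc n)"]
        by (simp del: of_nat_Suc)
      thus ?thesis unfolding P_def p_def by (intro DERIV_diff DERIV_sum A')
    qed
    have p: "\<bar>p x\<bar> \<le> 2 * x ^ N" if x: "0 \<le> x" "x \<le> 1" for x
    proof -
      have pos: "1 + x + x ^ 2 \<ge> 1" using x by simp
      have "p x * (1 + x + x ^ 2) = - chi3 (Suc N) * x ^ N + chi3 N * x ^ Suc N"
      proof -
        have "1 / (1 + x + x ^ 2) * (1 + x + x ^ 2) = 1" using pos by simp
        thus ?thesis using poly[where N = N and x = x] unfolding p_def by (simp add: left_diff_distrib)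
      qed
      also have "\<bar>\<dots>\<bar> \<le> 1 * x ^ N + 1 * x ^ N"
      proof (rule order_trans[OF abs_triangle_ineq], rule add_mono)
        show "\<bar>- chi3 (Suc N) * x ^ N\<bar> \<le> 1 * x ^ N"
          unfolding abs_mult using x by (intro mult_mono) (auto simp: chi3_def)
        show "\<bar>chi3 N * x ^ Suc N\<bar> \<le> 1 * x ^ N"
          unfolding abs_mult using x by (intro mult_mono) (auto simp: chi3_def mult_left_le_one_le)
      qed
      finally have "\<bar>p x\<bar> * (1 + x + x ^ 2) \<le> 2 * x ^ N" using pos by (simp add: abs_mult)
      moreover have "\<bar>p x\<bar> * 1 \<le> \<bar>p x\<bar> * (1 + x + x ^ 2)" using pos by (intro mult_left_mono) auto
      ultimately show ?thesis by simp
    qed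
    have "P 0 + R 0 \<le> P 1 + R 1"
    proof (rule DERIV_nonneg_imp_nondecreasing[of 0 1 "\<lambda>x. P x + R x"])
      fix x :: real assume "0 \<le> x" "x \<le> 1"
      hence "0 \<le> p x + 2 * x ^ N" using p[of x] by linarith
      thus "\<exists>y. ((\<lambda>x. P x + R x) has_real_derivative y) (at x) \<and> 0 \<le> y" using P' R' by (blast intro: DERIV_add)
    qed simp
    moreover have "R 0 - P 0 \<le> R 1 - P 1"
    proof (rule DERIV_nonneg_imp_nondecreasing[of 0 1 "\<lambda>x. R x - P x"])
      fix x :: real assume "0 \<le> x" "x \<le> 1"
      hence "0 \<le> 2 * x ^ N - p x" using p[of x] by linarith
      thus "\<exists>y. ((\<lambda>x. R x - P x) has_real_derivative y) (at x) \<and> 0 \<le> y" using P' R' by (blast intro: DERIV_diff)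
    qed simp
    moreover have "R 0 = 0" "R 1 = 2 / real (Suc N)" "P 0 = - A 0" "P 1 = (\<Sum>n<N. chi3 (Suc n) / real (Suc n)) - A 1"
      by (auto simp: R_def P_def)
    ultimately show ?thesis by linarith
  qed
  have "(\<lambda>N. (\<Sum>n<N. chi3 (Suc n) / real (Suc n)) - (A 1 - A 0)) \<longlonglongrightarrow> 0"
  proof (rule Lim_null_comparison)
    show "\<forall>\<^sub>F N in sequentially. norm ((\<Sum>n<N. chi3 (Suc n) / real (Suc n)) - (A 1 - A 0)) \<le> 2 / real (Suc N)"
      using bound by (intro always_eventually allI) simp
    show "(\<lambda>N. 2 / real (Suc N)) \<longlonglongrightarrow> 0" by real_asymp
  qed
  thus ?thesis unfolding sums_def A01 by (rule LIM_zero_cancel)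
qed

lemma prime_dvd_4: "prime p \<Longrightarrow> p mod 4 \<noteq> 1 \<Longrightarrow> p mod 4 \<noteq> 3 \<Longrightarrow> p = (2::nat)"
proof -
  assume h: "prime p" "p mod 4 \<noteq> 1" "p mod 4 \<noteq> 3"
  hence "even p" by presburger
  thus "p = 2" using h(1) by (metis prime_odd_nat prime_ge_2_nat le_neq_implies_less)
qed

lemma prime_dvd_3: "prime p \<Longrightarrow> p mod 3 \<noteq> 1 \<Longrightarrow> p mod 3 \<noteq> 2 \<Longrightarrow> p = (3::nat)"
proof -
  assume h: "prime p" "p mod 3 \<noteq> 1" "p mod 3 \<noteq> 2"
  hence "3 dvd p" by presburger
  moreover have "prime (3::nat)" by simp
  ultimately show "p = 3" using h(1) by (metis primes_dvd_imp_eq)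
qed

interpretation C4: real_character chi4 1 "pi / 4"
proof
  have "{p. prime p \<and> chi4 p = 0} \<subseteq> {2}" using prime_dvd_4 by (auto simp: chi4_def split: if_splits)
  thus "finite {p. prime p \<and> chi4 p = 0}" by (rule finite_subset) simp
  show "\<bar>\<Sum>n=1..N. chi4 n\<bar> \<le> 1" for N unfolding sum_chi4 by simp
qed (use chi4_mult chi4_L_sums in \<open>auto simp: chi4_def\<close>)

interpretation C3: real_character chi3 1 "pi / (3 * sqrt 3)"
proof
  have "{p. prime p \<and> chi3 p = 0} \<subseteq> {3}" using prime_dvd_3 by (auto simp: chi3_def split: if_splits)
  thus "finite {p. prime p \<and> chi3 p = 0}" by (rule finite_subset) simp
  show "\<bar>\<Sum>n=1..N. chi3 n\<bar> \<le> 1" for N unfolding sum_chi3 by simp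
qed (use chi3_mult chi3_L_sums in \<open>auto simp: chi3_def\<close>)

section \<open>The constants as Euler products and Landau's theorem for both forms\<close>

text \<open>\<open>prodinf\<close> can be used as the limit of its partial products only once
  convergence is known; it holds since the factors differ from 1 by at most 2 / p^2. The lower bound
  1 makes both constants positive.\<close>

lemma prime_product_tendsto:
  fixes Q :: "nat \<Rightarrow> bool"
  defines "F \<equiv> (\<lambda>p. if prime p \<and> Q p then (real p)\<^sup>2 / ((real p)\<^sup>2 - 1) else 1)"
  shows "(\<lambda>N. \<Prod>p<N. F p) \<longlonglongrightarrow> prodinf F" and "prodinf F \<ge> 1"
proof -
  have "summable (\<lambda>p. norm (F p - 1))"
  proof (rule summable_comparison_test'[of "\<lambda>p. 2 * (1 / real p ^ 2)" 0])
    show "summable (\<lambda>p. 2 * (1 / real p ^ 2))" by (intro summable_mult) (use inverse_power_summable[of 2, where ?'a = real] in \<open>simp add: field_simps\<close>)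
    fix p :: nat
    show "norm (norm (F p - 1)) \<le> 2 * (1 / real p ^ 2)"
    proof (cases "prime p \<and> Q p")
      case True
      have "real p \<ge> 2" using True prime_ge_2_nat[of p] by simp
      hence "2 ^ 2 \<le> real p ^ 2" by (intro power_mono) auto
      hence p2: "real p ^ 2 \<ge> 4" by simp
      have "F p - 1 = 1 / (real p ^ 2 - 1)" using True p2 by (simp add: F_def field_simps)
      moreover have "1 / (real p ^ 2 - 1) \<le> 1 / (real p ^ 2 / 2)" by (intro frac_le; use p2 in linarith)
      moreover have "0 \<le> 1 / (real p ^ 2 - 1)" using p2 by simp
      ultimately show ?thesis by simp
    next
      case False
      hence "F p = 1" by (auto simp: F_def)
      thus ?thesis by simp
    qed
  qed
  hence "convergent_prod F"
    by (intro abs_convergent_prod_imp_convergent_prod summable_imp_abs_convergent_prod)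
  hence "(\<lambda>n. \<Prod>p\<le>n. F p) \<longlonglongrightarrow> prodinf F" by (rule convergent_prod_LIMSEQ)
  hence "(\<lambda>n. \<Prod>p<Suc n. F p) \<longlonglongrightarrow> prodinf F" by (simp only: lessThan_Suc_atMost)
  thus lim: "(\<lambda>N. \<Prod>p<N. F p) \<longlonglongrightarrow> prodinf F" by (rule LIMSEQ_imp_Suc)
  have F1: "F p \<ge> 1" for p
  proof (cases "prime p \<and> Q p")
    case True
    have "real p \<ge> 2" using True prime_ge_2_nat[of p] by simp
    hence "2 ^ 2 \<le> real p ^ 2" by (intro power_mono) auto
    thus ?thesis using True by (simp add: F_def field_simps)
  next
    case False
    hence "F p = 1" by (auto simp: F_def)
    thus ?thesis by simp
  qed
  show "prodinf F \<ge> 1"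
    by (rule tendsto_lowerbound[OF lim]) (use F1 in \<open>auto intro!: always_eventually prod_ge_1\<close>)
qed

text \<open>Separates the ramified prime, whose Euler factor is absent from the products defining
  the constants.\<close>

lemma split_one_factor_tendsto:
  fixes F F' :: "nat \<Rightarrow> real"
  assumes "(\<lambda>N. \<Prod>p<N. F p) \<longlonglongrightarrow> P" and "\<And>p. F' p = (if p = q then c * F p else F p)"
  shows "(\<lambda>N. \<Prod>p<N. F' p) \<longlonglongrightarrow> c * P"
proof -
  have "\<forall>\<^sub>F N in sequentially. c * (\<Prod>p<N. F p) = (\<Prod>p<N. F' p)"
    using eventually_gt_at_top[of q]
  proof eventually_elim
    case (elim N)
    have "(\<Prod>p<N. F' p) = F' q * (\<Prod>p\<in>{..<N} - {q}. F' p)" using elim by (intro prod.remove) auto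
    also have "(\<Prod>p\<in>{..<N} - {q}. F' p) = (\<Prod>p\<in>{..<N} - {q}. F p)" by (intro prod.cong) (auto simp: assms(2))
    also have "F' q * \<dots> = c * (F q * (\<Prod>p\<in>{..<N} - {q}. F p))" by (simp add: assms(2))
    also have "F q * (\<Prod>p\<in>{..<N} - {q}. F p) = (\<Prod>p<N. F p)" using elim by (intro prod.remove[symmetric]) auto
    finally show ?case by simp
  qed
  thus ?thesis by (rule Lim_transform_eventually[OF tendsto_mult_left[OF assms(1)]])
qed

lemma sq_ratio: "p > 1 \<Longrightarrow> 1 / (1 - (1 / real p)\<^sup>2) = (real p)\<^sup>2 / ((real p)\<^sup>2 - 1)" for p :: nat
  by (simp add: power_divide divide_simps)

lemma landau_ramanujan_pos: "landau_ramanujan_const > 0"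
  using prime_product_tendsto(2)[of "\<lambda>p. p mod 4 = 3"] unfolding landau_ramanujan_const_def by simp

theorem landau_ramanujan:
  "((\<lambda>x. real (card {m \<in> nats_upto x. \<exists>a b. int m = qform 0 a b}) * sqrt (ln x) / x) \<longlongrightarrow> landau_ramanujan_const) at_top"
proof -
  define P where "P = (\<Prod>p. if prime p \<and> p mod 4 = 3 then (real p)\<^sup>2 / ((real p)\<^sup>2 - 1) else 1)"
  \<comment> \<open>The ramified prime 2 contributes 1 / (1 - 1/2) = 2.\<close>
  have lim: "(\<lambda>N. \<Prod>p<N. if prime p then C4.G_fac p (1 / real p) else 1) \<longlonglongrightarrow> 2 * P"
    unfolding P_def
  proof (rule split_one_factor_tendsto[OF prime_product_tendsto(1)])
    fix p :: nat
    show "(if prime p then C4.G_fac p (1 / real p) else 1) =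
      (if p = 2 then 2 * (if prime p \<and> p mod 4 = 3 then (real p)\<^sup>2 / ((real p)\<^sup>2 - 1) else 1)
       else if prime p \<and> p mod 4 = 3 then (real p)\<^sup>2 / ((real p)\<^sup>2 - 1) else 1)"
    proof (cases "prime p")
      case True
      have sq: "1 / (1 - (1 / real p)\<^sup>2) = (real p)\<^sup>2 / ((real p)\<^sup>2 - 1)"
        using prime_gt_1_nat[OF True] by (rule sq_ratio)
      consider "p = 2" | "p \<noteq> 2" "p mod 4 = 1" | "p \<noteq> 2" "p mod 4 = 3"
        using prime_dvd_4[OF True] by fastforce
      thus ?thesis by cases (use True sq in \<open>simp_all add: C4.G_fac_def chi4_def\<close>)
    qed auto
  qed
  \<comment> \<open>L(1, chi) = pi/4 and G = 2 P give L G / pi = P / 2.\<close>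
  have "sqrt (pi / 4 * (2 * P)) / sqrt pi = landau_ramanujan_const"
    unfolding landau_ramanujan_const_def P_def[symmetric] by (simp flip: real_sqrt_divide)
  hence lim': "(C4.beta \<longlongrightarrow> landau_ramanujan_const) at_top" using C4.beta_tendsto[OF lim] by simp
  have "C4.beta x = real (card {m \<in> nats_upto x. \<exists>a b. int m = qform 0 a b}) * sqrt (ln x) / x" for x
  proof -
    have "(\<exists>a b. int m = qform 0 a b) \<longleftrightarrow> C4.admissible m" if "m \<in> nats_upto x" for m
    proof (rule C4.form_iff_admissible)
      show "\<exists>a b. int p = qform 0 a b" if "prime p" "chi4 p \<noteq> -1" for p
      proof (cases "p mod 4 = 1")
        case False
        hence "p = 2" using that prime_dvd_4[of p] by (auto simp: chi4_def split: if_splits)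
        hence "int p = qform 0 1 1" by (simp add: qform_def)
        thus ?thesis by blast
      qed (use that sum_two_squares_prime in blast)
      show "int p dvd a \<and> int p dvd b" if "prime p" "chi4 p = -1" "int p dvd qform 0 a b" for p a b
        using that by (intro sum_two_squares_inert) (auto simp: chi4_def split: if_splits)
    qed (use that in \<open>simp add: mem_nats_upto\<close>)
    hence "{m \<in> nats_upto x. \<exists>a b. int m = qform 0 a b} = {m \<in> nats_upto x. C4.admissible m}" by blast
    thus ?thesis by (simp add: C4.beta_def C4.B_eq_card)
  qed
  hence "C4.beta = (\<lambda>x. real (card {m \<in> nats_upto x. \<exists>a b. int m = qform 0 a b}) * sqrt (ln x) / x)"
    by (rule ext)
  with lim' show ?thesis by (simp only:)
qed

theorem loeschian_count:
  "((\<lambda>x. real (card {m \<in> nats_upto x. \<exists>a b. int m = qform 1 a b}) * sqrt (ln x) / x) \<longlongrightarrow> tri_const) at_top"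
proof -
  define P where "P = (\<Prod>p. if prime p \<and> p mod 3 = 2 then (real p)\<^sup>2 / ((real p)\<^sup>2 - 1) else 1)"
  \<comment> \<open>The ramified prime 3 contributes 1 / (1 - 1/3) = 3/2.\<close>
  have lim: "(\<lambda>N. \<Prod>p<N. if prime p then C3.G_fac p (1 / real p) else 1) \<longlonglongrightarrow> 3/2 * P"
    unfolding P_def
  proof (rule split_one_factor_tendsto[OF prime_product_tendsto(1)])
    fix p :: nat
    show "(if prime p then C3.G_fac p (1 / real p) else 1) =
      (if p = 3 then 3/2 * (if prime p \<and> p mod 3 = 2 then (real p)\<^sup>2 / ((real p)\<^sup>2 - 1) else 1)
       else if prime p \<and> p mod 3 = 2 then (real p)\<^sup>2 / ((real p)\<^sup>2 - 1) else 1)"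
    proof (cases "prime p")
      case True
      have sq: "1 / (1 - (1 / real p)\<^sup>2) = (real p)\<^sup>2 / ((real p)\<^sup>2 - 1)"
        using prime_gt_1_nat[OF True] by (rule sq_ratio)
      consider "p = 3" | "p \<noteq> 3" "p mod 3 = 1" | "p \<noteq> 3" "p mod 3 = 2"
        using prime_dvd_3[OF True] by fastforce
      thus ?thesis by cases (use True sq in \<open>simp_all add: C3.G_fac_def chi3_def\<close>)
    qed auto
  qed
  \<comment> \<open>Here L G / pi = P / (2 sqrt 3).\<close>
  have "sqrt (pi / (3 * sqrt 3) * (3/2 * P)) / sqrt pi = tri_const"
    unfolding tri_const_def P_def[symmetric] by (simp flip: real_sqrt_divide)
  hence lim': "(C3.beta \<longlongrightarrow> tri_const) at_top" using C3.beta_tendsto[OF lim] by simp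
  have "C3.beta x = real (card {m \<in> nats_upto x. \<exists>a b. int m = qform 1 a b}) * sqrt (ln x) / x" for x
  proof -
    have "(\<exists>a b. int m = qform 1 a b) \<longleftrightarrow> C3.admissible m" if "m \<in> nats_upto x" for m
    proof (rule C3.form_iff_admissible)
      show "\<exists>a b. int p = qform 1 a b" if "prime p" "chi3 p \<noteq> -1" for p
      proof (cases "p mod 3 = 1")
        case False
        hence "p = 3" using that prime_dvd_3[of p] by (auto simp: chi3_def split: if_splits)
        hence "int p = qform 1 1 1" by (simp add: qform_def)
        thus ?thesis by blast
      qed (use that loeschian_prime in blast)
      show "int p dvd a \<and> int p dvd b" if "prime p" "chi3 p = -1" "int p dvd qform 1 a b" for p a b
        using that by (intro loeschian_inert) (auto simp: chi3_def split: if_splits)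
    qed (use that in \<open>simp add: mem_nats_upto\<close>)
    hence "{m \<in> nats_upto x. \<exists>a b. int m = qform 1 a b} = {m \<in> nats_upto x. C3.admissible m}" by blast
    thus ?thesis by (simp add: C3.beta_def C3.B_eq_card)
  qed
  hence "C3.beta = (\<lambda>x. real (card {m \<in> nats_upto x. \<exists>a b. int m = qform 1 a b}) * sqrt (ln x) / x)"
    by (rule ext)
  with lim' show ?thesis by (simp only:)
qed

section \<open>Lattice points and distances\<close>

text \<open>Rectangular bricks serve the triangular lattice as well, its rows being shifted copies
  of the integers. Half-open sides make neighbouring bricks disjoint.\<close>

definition cell :: "real \<Rightarrow> real \<times> real \<Rightarrow> (real \<times> real) set" where
  "cell h v = {fst v..<fst v + 1} \<times> {snd v..<snd v + h}"

lemma cell_measure: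
  assumes "h > 0"
  shows "cell h v \<in> sets lborel" "emeasure lborel (cell h v) = ennreal h"
proof -
  show "cell h v \<in> sets lborel" unfolding cell_def by (simp add: borel_Times)
  have "emeasure (lborel \<Otimes>\<^sub>M lborel) ({fst v..<fst v + 1} \<times> {snd v..<snd v + h})
     = emeasure lborel {fst v..<fst v + 1} * emeasure lborel {snd v..<snd v + h}"
    by (intro lborel.emeasure_pair_measure_Times) auto
  thus "emeasure lborel (cell h v) = ennreal h" using assms by (simp add: cell_def lborel_prod)
qed

lemma norm_le_of_cell:
  assumes "z \<in> cell h v" "h \<le> 1" shows "norm (z - v) \<le> 2"
proof -
  have "norm (z - v) \<le> \<bar>fst (z - v)\<bar> + \<bar>snd (z - v)\<bar>"
    using norm_Pair_le[of "fst (z - v)" "snd (z - v)"] unfolding prod.collapse real_norm_def .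
  thus ?thesis using assms by (auto simp: cell_def)
qed

lemma disc_area: "\<rho> \<ge> 0 \<Longrightarrow> measure lborel (cball (0 :: real \<times> real) \<rho>) = pi * \<rho> ^ 2"
  using content_cball[of \<rho> "0 :: real \<times> real"] by (simp add: unit_ball_vol_2 power2_eq_square)

text \<open>Gauss's area argument: a brick stays within distance 2 of its corner, so the bricks of
  the lattice points in the disc lie in the disc of radius \<rho> + 2 and cover the one of radius
  \<rho> - 2.\<close>

lemma brick_tiling_count:
  assumes h: "0 < h" "h \<le> 1" and \<rho>: "\<rho> \<ge> 0"
    and tiling: "\<And>z. \<exists>!v. v \<in> S \<and> z \<in> cell h v"
  shows "finite (S \<inter> cball 0 \<rho>)"
    and "real (card (S \<inter> cball 0 \<rho>)) * h \<le> pi * (\<rho> + 2) ^ 2"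
    and "\<rho> \<ge> 2 \<Longrightarrow> pi * (\<rho> - 2) ^ 2 \<le> real (card (S \<inter> cball 0 \<rho>)) * h"
proof -
  have area: "measure lborel (\<Union>v\<in>T. cell h v) = real (card T) * h" if "finite T" "T \<subseteq> S" for T
  proof -
    have "disjoint_family_on (cell h) T"
      unfolding disjoint_family_on_def using tiling that by (metis (no_types, lifting) Int_emptyI subsetD)
    hence "measure lborel (\<Union>v\<in>T. cell h v) = (\<Sum>v\<in>T. measure lborel (cell h v))"
      using that cell_measure[OF h(1)] by (intro measure_finite_Union) auto
    also have "\<dots> = (\<Sum>v\<in>T. h)" using cell_measure(2)[OF h(1)] h by (simp add: measure_def)
    finally show ?thesis by simp
  qed
  have fm: "cball 0 r \<in> fmeasurable (lborel :: (real \<times> real) measure)" for r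
    using emeasure_bounded_finite[of "cball 0 r"] by (intro fmeasurableI) auto
  have meas: "(\<Union>v\<in>T. cell h v) \<in> sets lborel" if "finite T" for T
    using that cell_measure[OF h(1)] by (intro sets.finite_UN) auto
  \<comment> \<open>Stated for finite subsets first, because this bound is also what proves the set
    of lattice points finite.\<close>
  have upper: "real (card T) * h \<le> pi * (\<rho> + 2) ^ 2" if "finite T" "T \<subseteq> S \<inter> cball 0 \<rho>" for T
  proof -
    have "(\<Union>v\<in>T. cell h v) \<subseteq> cball 0 (\<rho> + 2)"
    proof
      fix z assume "z \<in> (\<Union>v\<in>T. cell h v)"
      then obtain v where v: "v \<in> T" "z \<in> cell h v" by blast
      hence "norm v \<le> \<rho>" "norm (z - v) \<le> 2" using that norm_le_of_cell h by auto
      thus "z \<in> cball 0 (\<rho> + 2)" using norm_triangle_ineq[of "z - v" v] by simp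
    qed
    hence "measure lborel (\<Union>v\<in>T. cell h v) \<le> measure lborel (cball (0 :: real \<times> real) (\<rho> + 2))"
      by (intro measure_mono_fmeasurable meas fm that)
    thus ?thesis using area[OF that(1)] that disc_area[of "\<rho> + 2"] \<rho> by auto
  qed
  show fin: "finite (S \<inter> cball 0 \<rho>)"
  proof (rule ccontr)
    assume inf: "infinite (S \<inter> cball 0 \<rho>)"
    obtain N :: nat where N: "pi * (\<rho> + 2) ^ 2 / h < real N" using reals_Archimedean2 by blast
    obtain T where T: "T \<subseteq> S \<inter> cball 0 \<rho>" "finite T" "card T = N"
      using infinite_arbitrarily_large[OF inf, of N] by blast
    show False using upper[OF T(2,1)] N T(3) h by (simp add: field_simps)
  qed
  show "real (card (S \<inter> cball 0 \<rho>)) * h \<le> pi * (\<rho> + 2) ^ 2" by (rule upper[OF fin]) simp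
  assume \<rho>2: "\<rho> \<ge> 2"
  have "cball 0 (\<rho> - 2) \<subseteq> (\<Union>v\<in>S \<inter> cball 0 \<rho>. cell h v)"
  proof
    fix z :: "real \<times> real" assume z: "z \<in> cball 0 (\<rho> - 2)"
    obtain v where v: "v \<in> S" "z \<in> cell h v" using tiling[of z] by blast
    have "norm (v - z) \<le> 2" using norm_le_of_cell[OF v(2) h(2)] by (simp add: norm_minus_commute)
    hence "norm v \<le> \<rho>" using z norm_triangle_ineq[of "v - z" z] by simp
    thus "z \<in> (\<Union>v\<in>S \<inter> cball 0 \<rho>. cell h v)" using v by auto
  qed
  moreover have "(\<Union>v\<in>S \<inter> cball 0 \<rho>. cell h v) \<in> fmeasurable lborel"
    using fin cell_measure[OF h(1)] by (intro fmeasurable.finite_UN) (auto simp: fmeasurable_def)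
  ultimately have "measure lborel (cball (0 :: real \<times> real) (\<rho> - 2)) \<le> measure lborel (\<Union>v\<in>S \<inter> cball 0 \<rho>. cell h v)"
    by (intro measure_mono_fmeasurable) auto
  thus "pi * (\<rho> - 2) ^ 2 \<le> real (card (S \<inter> cball 0 \<rho>)) * h"
    using area[OF fin] disc_area[of "\<rho> - 2"] \<rho>2 by auto
qed

lemma brick_tiling_count_asymp:
  assumes h: "0 < h" "h \<le> 1"
    and tiling: "\<And>z. \<exists>!v. v \<in> S \<and> z \<in> cell h v"
  shows "(\<lambda>n::nat. real (card (S \<inter> cball 0 (sqrt (h * real n / pi)))) - real n) \<in> o(\<lambda>n. real n)"
proof (rule smalloI_tendsto)
  define \<rho> where "\<rho> n = sqrt (h * real n / pi)" for n :: nat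
  define s where "s = sqrt (h / pi)"
  have s: "s > 0" using h by (simp add: s_def)
  have \<rho>: "\<rho> n = s * sqrt (real n)" for n by (simp add: \<rho>_def s_def flip: real_sqrt_mult)
  have \<rho>2: "pi * \<rho> n ^ 2 = h * real n" for n using h by (simp add: \<rho>_def)
  have ev: "\<forall>\<^sub>F n in sequentially. norm ((real (card (S \<inter> cball 0 (\<rho> n))) - real n) / real n)
      \<le> 4 * pi / h * (s * (sqrt (real n) / real n) + 1 / real n)"
  proof -
    have "filterlim (\<lambda>n. s * sqrt (real n)) at_top sequentially"
      using s by (intro filterlim_tendsto_pos_mult_at_top[OF tendsto_const]) (auto intro: filterlim_compose[OF sqrt_at_top filterlim_real_sequentially])
    hence "\<forall>\<^sub>F n in sequentially. s * sqrt (real n) \<ge> 2" by (simp add: filterlim_at_top)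
    thus ?thesis using eventually_gt_at_top[of 0]
    proof eventually_elim
      case (elim n)
      define N where "N = real (card (S \<inter> cball 0 (\<rho> n)))"
      have p0: "\<rho> n \<ge> 0" "\<rho> n \<ge> 2" using elim by (auto simp: \<rho>)
      have "N * h \<le> pi * (\<rho> n + 2) ^ 2" "pi * (\<rho> n - 2) ^ 2 \<le> N * h"
        unfolding N_def using brick_tiling_count(2,3)[OF h p0(1) tiling] p0 by auto
      moreover have "pi * (\<rho> n + 2) ^ 2 = h * real n + 4 * pi * (\<rho> n + 1)"
        "pi * (\<rho> n - 2) ^ 2 = h * real n - 4 * pi * \<rho> n + 4 * pi"
        using \<rho>2[of n] by (simp_all add: power2_eq_square algebra_simps)
      moreover have "0 \<le> 4 * pi * \<rho> n" "4 * pi * (\<rho> n + 1) = 4 * pi * \<rho> n + 4 * pi" using p0 by (auto simp: algebra_simps)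
      ultimately have "\<bar>N * h - h * real n\<bar> \<le> 4 * pi * (\<rho> n + 1)" using pi_gt_zero by linarith
      also have "N * h - h * real n = h * (N - real n)" by (simp add: algebra_simps)
      finally have "\<bar>N - real n\<bar> * h \<le> 4 * pi * (\<rho> n + 1)" using h by (simp add: abs_mult mult.commute)
      hence "\<bar>N - real n\<bar> \<le> 4 * pi * (\<rho> n + 1) / h" by (simp only: pos_le_divide_eq[OF h(1)])
      hence "\<bar>N - real n\<bar> / real n \<le> 4 * pi * (\<rho> n + 1) / h / real n" by (intro divide_right_mono) auto
      also have "\<dots> = 4 * pi / h * (s * (sqrt (real n) / real n) + 1 / real n)"
        unfolding \<rho> by (simp add: add_divide_distrib algebra_simps)
      finally show ?case by (simp add: N_def abs_divide)
    qed
  qed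
  have z: "(\<lambda>n. 4 * pi / h * (s * (sqrt (real n) / real n) + 1 / real n)) \<longlonglongrightarrow> 4 * pi / h * (s * 0 + 0)"
  proof (intro tendsto_mult_left tendsto_add)
    show "(\<lambda>n. sqrt (real n) / real n) \<longlonglongrightarrow> 0" by real_asymp
    show "(\<lambda>n. 1 / real n) \<longlonglongrightarrow> 0" by real_asymp
  qed
  show "(\<lambda>n. (real (card (S \<inter> cball 0 (sqrt (h * real n / pi)))) - real n) / real n) \<longlonglongrightarrow> 0"
    unfolding \<rho>_def[symmetric] by (rule Lim_null_comparison[OF ev]) (use z in simp)
  show "\<forall>\<^sub>F n in sequentially. real n \<noteq> 0" using eventually_gt_at_top[of 0] by eventually_elim simp
qed

text \<open>Squared distances are nonzero values of the form, and \<open>sqrt\<close> is injective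
  on them, so counting distances is counting values.\<close>

lemma num_distances_bounds:
  fixes e1 e2 :: "real \<times> real"
  assumes norm: "\<And>a b. norm (of_int a *\<^sub>R e1 + of_int b *\<^sub>R e2) ^ 2 = of_int (qform t a b)"
    and S: "S = {of_int a *\<^sub>R e1 + of_int b *\<^sub>R e2 | a b. True}"
    and \<rho>: "\<rho> \<ge> 1"
  shows "card {m \<in> nats_upto ((2 * \<rho> - 2)\<^sup>2). \<exists>a b. int m = qform t a b} \<le> num_distances (S \<inter> cball 0 \<rho>)"
    and "num_distances (S \<inter> cball 0 \<rho>) \<le> card {m \<in> nats_upto (4 * \<rho>\<^sup>2). \<exists>a b. int m = qform t a b}"
proof -
  define P where "P a b = of_int a *\<^sub>R e1 + of_int b *\<^sub>R e2" for a b :: int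
  define V where "V x = {m \<in> nats_upto x. \<exists>a b. int m = qform t a b}" for x
  define T where "T = {norm (A - B) | A B. A \<in> S \<inter> cball 0 \<rho> \<and> B \<in> S \<inter> cball 0 \<rho> \<and> A \<noteq> B}"
  have S': "S = {P a b | a b. True}" unfolding S P_def ..
  have normP: "norm (P a b) ^ 2 = of_int (qform t a b)" for a b unfolding P_def by (rule norm)
  have diff: "P a b - P c d = P (a - c) (b - d)" for a b c d
    by (simp add: P_def algebra_simps)
  have inj: "inj_on (\<lambda>m. sqrt (real m)) X" for X by (auto intro: inj_onI)
  have finV: "finite (V x)" for x by (simp add: V_def)
  have up: "T \<subseteq> (\<lambda>m. sqrt (real m)) ` V (4 * \<rho>\<^sup>2)"
  proof
    fix d assume "d \<in> T"
    then obtain A B where AB: "d = norm (A - B)" "A \<in> S" "B \<in> S" "norm A \<le> \<rho>" "norm B \<le> \<rho>" "A \<noteq> B"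
      by (auto simp: T_def)
    obtain a b where ab: "A - B = P a b" using AB(2,3) diff unfolding S' by auto
    have d0: "d > 0" using AB by simp
    have dsq: "d ^ 2 = of_int (qform t a b)" using AB(1) ab normP by simp
    have "of_int (qform t a b) > (0::real)" using d0 dsq by (metis zero_less_power)
    hence q: "qform t a b > 0" by simp
    define m where "m = nat (qform t a b)"
    have m: "int m = qform t a b" "m > 0" using q by (auto simp: m_def)
    have rm: "real m = d ^ 2" using dsq m(1) by (metis of_int_of_nat_eq)
    have "d \<le> 2 * \<rho>" using AB norm_triangle_ineq4[of A B] by simp
    hence "d ^ 2 \<le> (2 * \<rho>) ^ 2" using d0 by (intro power_mono) auto
    hence "real m \<le> 4 * \<rho>\<^sup>2" using rm by (simp add: power_mult_distrib)
    hence "m \<in> V (4 * \<rho>\<^sup>2)" using m by (auto simp: V_def mem_nats_upto)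
    moreover have "d = sqrt (real m)" using rm d0 by simp
    ultimately show "d \<in> (\<lambda>m. sqrt (real m)) ` V (4 * \<rho>\<^sup>2)" by blast
  qed
  have lo: "(\<lambda>m. sqrt (real m)) ` V ((2 * \<rho> - 2)\<^sup>2) \<subseteq> T"
  proof
    fix d assume "d \<in> (\<lambda>m. sqrt (real m)) ` V ((2 * \<rho> - 2)\<^sup>2)"
    then obtain m a b where m: "d = sqrt (real m)" "m > 0" "real m \<le> (2 * \<rho> - 2)\<^sup>2" "int m = qform t a b"
      by (auto simp: V_def mem_nats_upto)
    have "norm (P a b) ^ 2 = real m" using normP[of a b] m(4) by (metis of_int_of_nat_eq)
    hence d: "norm (P a b) = d" using m(1) by (metis norm_ge_zero real_sqrt_unique)
    have "d ^ 2 \<le> (2 * \<rho> - 2)\<^sup>2" using m by simp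
    hence d2: "d \<le> 2 * \<rho> - 2" by (rule power2_le_imp_le) (use \<rho> in simp)
    have "norm e1 = 1" by (rule power2_eq_imp_eq) (use norm[of 1 0] in \<open>simp_all add: qform_def\<close>)
    moreover have "norm e2 = 1" by (rule power2_eq_imp_eq) (use norm[of 0 1] in \<open>simp_all add: qform_def\<close>)
    ultimately have e1: "norm e1 = 1" "norm e2 = 1" by simp_all
    \<comment> \<open>The vector P a b is realized as the difference of A and A - P a b. Rounding
      moves each coordinate by at most 1/2 along a unit vector, so both points lie within 1 of plus
      or minus half the vector.\<close>
    define A where "A = P (a div 2) (b div 2)"
    have half: "\<bar>of_int (x div 2) - of_int x / 2\<bar> \<le> (1/2 :: real)" for x :: int
    proof -
      have "x = 2 * (x div 2) + x mod 2" "x mod 2 = 0 \<or> x mod 2 = 1" by auto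
      hence "x = 2 * (x div 2) \<or> x = 2 * (x div 2) + 1" by auto
      hence "of_int x = (2 * of_int (x div 2) :: real) \<or> of_int x = (2 * of_int (x div 2) + 1 :: real)"
        by (metis of_int_1 of_int_add of_int_mult of_int_numeral)
      thus ?thesis by auto
    qed
    have Ah: "norm (A - P a b /\<^sub>R 2) \<le> 1"
    proof -
      have "A - P a b /\<^sub>R 2 = (of_int (a div 2) - of_int a / 2) *\<^sub>R e1 + (of_int (b div 2) - of_int b / 2) *\<^sub>R e2"
        by (simp add: A_def P_def algebra_simps)
      also have "norm \<dots> \<le> \<bar>of_int (a div 2) - of_int a / 2\<bar> * 1 + \<bar>of_int (b div 2) - of_int b / 2\<bar> * 1"
        by (rule order_trans[OF norm_triangle_ineq]) (simp add: e1)
      also have "\<dots> \<le> 1"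
      proof -
        have "\<bar>x\<bar> * 1 + \<bar>y\<bar> * 1 \<le> 1" if "\<bar>x\<bar> \<le> 1/2" "\<bar>y\<bar> \<le> 1/2" for x y :: real using that by linarith
        from this[OF half half] show ?thesis .
      qed
      finally show ?thesis .
    qed
    have half_norm: "norm (P a b /\<^sub>R 2) \<le> \<rho> - 1" using d d2 by simp
    have A: "norm A \<le> \<rho>"
      using norm_triangle_ineq[of "A - P a b /\<^sub>R 2" "P a b /\<^sub>R 2"] Ah half_norm by simp
    have eq: "A - P a b = (A - P a b /\<^sub>R 2) - P a b /\<^sub>R 2"
      by (simp add: algebra_simps flip: scaleR_add_left)
    have "norm (A - P a b) \<le> norm (A - P a b /\<^sub>R 2) + norm (P a b /\<^sub>R 2)"
      by (subst eq) (rule norm_triangle_ineq4)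
    hence B: "norm (A - P a b) \<le> \<rho>" using Ah half_norm by linarith
    have "d > 0" using m by simp
    hence "P a b \<noteq> 0" using d by auto
    hence ne: "A \<noteq> A - P a b" by simp
    have mem: "A \<in> S" "A - P a b \<in> S" unfolding S' A_def diff by blast+
    have "A \<in> S \<inter> cball 0 \<rho>" "A - P a b \<in> S \<inter> cball 0 \<rho>" using A B mem by simp_all
    moreover have "d = norm (A - (A - P a b))" using d by simp
    ultimately show "d \<in> T" unfolding T_def using ne by blast
  qed
  have finT: "finite T" using up finV finite_surj by blast
  have "card ((\<lambda>m. sqrt (real m)) ` V ((2 * \<rho> - 2)\<^sup>2)) \<le> card T" by (rule card_mono[OF finT lo])
  thus "card {m \<in> nats_upto ((2 * \<rho> - 2)\<^sup>2). \<exists>a b. int m = qform t a b} \<le> num_distances (S \<inter> cball 0 \<rho>)"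
    unfolding num_distances_def T_def[symmetric] card_image[OF inj] V_def .
  have "card T \<le> card ((\<lambda>m. sqrt (real m)) ` V (4 * \<rho>\<^sup>2))" by (rule card_mono[OF finite_imageI[OF finV] up])
  thus "num_distances (S \<inter> cball 0 \<rho>) \<le> card {m \<in> nats_upto (4 * \<rho>\<^sup>2). \<exists>a b. int m = qform t a b}"
    unfolding num_distances_def T_def[symmetric] card_image[OF inj] V_def .
qed

text \<open>Both bounds of the sandwich are the counting function at (2 (s sqrt n - d))^2, with d =
  1 below and d = 0 above. The shift changes neither the leading term nor the logarithm
  asymptotically.\<close>

lemma num_distances_asymp:
  fixes e1 e2 :: "real \<times> real"
  assumes norm: "\<And>a b. norm (of_int a *\<^sub>R e1 + of_int b *\<^sub>R e2) ^ 2 = of_int (qform t a b)"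
    and S: "S = {of_int a *\<^sub>R e1 + of_int b *\<^sub>R e2 | a b. True}" and h: "h > 0"
    and lim: "((\<lambda>x. real (card {m \<in> nats_upto x. \<exists>a b. int m = qform t a b}) * sqrt (ln x) / x) \<longlongrightarrow> c) at_top"
  shows "(\<lambda>n::nat. real (num_distances (S \<inter> cball 0 (sqrt (h * real n / pi)))) * sqrt (ln (real n)) / real n)
    \<longlonglongrightarrow> 4 * h / pi * c"
proof -
  define s where "s = sqrt (h / pi)"
  have s: "s > 0" using h by (simp add: s_def)
  have ss: "4 * s ^ 2 = 4 * h / pi" using h by (simp add: s_def)
  have \<rho>: "sqrt (h * real n / pi) = s * sqrt (real n)" for n by (simp add: s_def flip: real_sqrt_mult)
  define N where "N x = real (card {m \<in> nats_upto x. \<exists>a b. int m = qform t a b})" for x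
  have lim: "((\<lambda>x. N x * sqrt (ln x) / x) \<longlongrightarrow> c) at_top" using lim by (simp add: N_def)
  have root: "filterlim (\<lambda>n::nat. s * sqrt (real n) - d) at_top sequentially" for d
    using s by real_asymp
  have *: "(\<lambda>n::nat. N ((2 * (s * sqrt (real n) - d))\<^sup>2) * sqrt (ln (real n)) / real n) \<longlonglongrightarrow> 4 * h / pi * c" for d
  proof -
    define X where "X n = (2 * (s * sqrt (real n) - d))\<^sup>2" for n :: nat
    have X: "filterlim X at_top sequentially" unfolding X_def using s by real_asymp
    have q: "(\<lambda>n. X n / real n) \<longlonglongrightarrow> 4 * s ^ 2"
      unfolding X_def using s by (real_asymp simp: power2_eq_square)
    have "(\<lambda>n. ln (X n / real n)) \<longlonglongrightarrow> ln (4 * s ^ 2)" using s by (intro tendsto_ln q) auto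
    moreover have "filterlim (\<lambda>n::nat. ln (real n)) at_infinity sequentially" by real_asymp
    ultimately have "(\<lambda>n. ln (X n / real n) / ln (real n)) \<longlonglongrightarrow> 0" by (rule tendsto_divide_0)
    hence "(\<lambda>n. sqrt (1 / (1 + ln (X n / real n) / ln (real n)))) \<longlonglongrightarrow> sqrt (1 / (1 + 0))"
      by (intro tendsto_intros) auto
    \<comment> \<open>The last factor is sqrt(ln n / ln X), which tends to 1 because X / n has a
      positive limit.\<close>
    hence "(\<lambda>n. (N (X n) * sqrt (ln (X n)) / X n) * (X n / real n) * sqrt (1 / (1 + ln (X n / real n) / ln (real n))))
        \<longlonglongrightarrow> c * (4 * s ^ 2) * sqrt (1 / (1 + 0))"
      by (intro tendsto_mult filterlim_compose[OF lim X] q)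
    hence "(\<lambda>n. (N (X n) * sqrt (ln (X n)) / X n) * (X n / real n) * sqrt (1 / (1 + ln (X n / real n) / ln (real n))))
        \<longlonglongrightarrow> 4 * h / pi * c" by (simp add: ss mult.commute)
    moreover have "\<forall>\<^sub>F n in sequentially. X n > 1" using X by (simp add: filterlim_at_top_dense)
    hence "\<forall>\<^sub>F n in sequentially. (N (X n) * sqrt (ln (X n)) / X n) * (X n / real n) * sqrt (1 / (1 + ln (X n / real n) / ln (real n)))
       = N (X n) * sqrt (ln (real n)) / real n"
      using eventually_gt_at_top[of 1]
    proof eventually_elim
      case (elim n)
      have l: "ln (real n) > 0" "ln (X n) > 0" using elim by auto
      have "1 + ln (X n / real n) / ln (real n) = ln (X n) / ln (real n)"
        using elim l by (simp add: ln_div field_simps)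
      hence "sqrt (1 / (1 + ln (X n / real n) / ln (real n))) = sqrt (ln (real n)) / sqrt (ln (X n))"
        by (simp add: real_sqrt_divide)
      thus ?case using elim l by simp
    qed
    ultimately show ?thesis unfolding X_def by (rule Lim_transform_eventually)
  qed
  show ?thesis unfolding \<rho>
  proof (rule tendsto_sandwich[OF _ _ *[of 1] *[of 0]])
    define k where "k n = num_distances (S \<inter> cball 0 (s * sqrt (real n)))" for n
    have ev: "\<forall>\<^sub>F n in sequentially. s * sqrt (real n) \<ge> 1"
      using root[of 0] by (simp add: filterlim_at_top)
    show "\<forall>\<^sub>F n in sequentially. N ((2 * (s * sqrt (real n) - 1))\<^sup>2) * sqrt (ln (real n)) / real n
        \<le> real (num_distances (S \<inter> cball 0 (s * sqrt (real n)))) * sqrt (ln (real n)) / real n"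
      using ev eventually_gt_at_top[of 1]
    proof eventually_elim
      case (elim n)
      have "N ((2 * (s * sqrt (real n) - 1))\<^sup>2) \<le> real (num_distances (S \<inter> cball 0 (s * sqrt (real n))))"
        using num_distances_bounds(1)[OF norm S elim(1)] by (simp add: N_def algebra_simps)
      thus ?case using elim by (intro divide_right_mono mult_right_mono) auto
    qed
    show "\<forall>\<^sub>F n in sequentially. real (num_distances (S \<inter> cball 0 (s * sqrt (real n)))) * sqrt (ln (real n)) / real n
        \<le> N ((2 * (s * sqrt (real n) - 0))\<^sup>2) * sqrt (ln (real n)) / real n"
      using ev eventually_gt_at_top[of 1]
    proof eventually_elim
      case (elim n)
      have "real (num_distances (S \<inter> cball 0 (s * sqrt (real n)))) \<le> N ((2 * (s * sqrt (real n) - 0))\<^sup>2)"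
        using num_distances_bounds(2)[OF norm S elim(1)] by (simp add: N_def power_mult_distrib)
      thus ?case using elim by (intro divide_right_mono mult_right_mono) auto
    qed
  qed
qed

lemma brick_row_unique:
  fixes x w :: real
  shows "\<exists>!a::int. of_int a + w \<le> x \<and> x < of_int a + w + 1"
proof (rule ex1I[of _ "\<lfloor>x - w\<rfloor>"])
  show "of_int \<lfloor>x - w\<rfloor> + w \<le> x \<and> x < of_int \<lfloor>x - w\<rfloor> + w + 1" by linarith
  show "a = \<lfloor>x - w\<rfloor>" if "of_int a + w \<le> x \<and> x < of_int a + w + 1" for a :: int
    using that by linarith
qed

text \<open>\<open>w b\<close> is the horizontal offset of row b. The second coordinate of z
  determines the row, and the first one then the brick within it.\<close>

lemma brick_tiling:
  fixes w :: "int \<Rightarrow> real"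
  assumes h: "h > 0" and S: "S = {(of_int a + w b, h * of_int b) | a b :: int. True}"
  shows "\<exists>!v. v \<in> S \<and> z \<in> cell h v"
proof -
  obtain x y where z: "z = (x, y)" by (cases z)
  define b where "b = \<lfloor>y / h\<rfloor>"
  have row: "h * of_int c \<le> y \<and> y < h * of_int c + h \<longleftrightarrow> c = b" for c :: int
  proof -
    have "h * of_int c \<le> y \<and> y < h * of_int c + h \<longleftrightarrow> of_int c \<le> y / h \<and> y / h < of_int c + 1"
      using h by (simp add: field_simps)
    also have "\<dots> \<longleftrightarrow> c = b" unfolding b_def by linarith
    finally show ?thesis .
  qed
  obtain a where a: "of_int a + w b \<le> x \<and> x < of_int a + w b + 1"
    and uniq: "\<And>a'. of_int a' + w b \<le> x \<and> x < of_int a' + w b + 1 \<Longrightarrow> a' = a"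
    using brick_row_unique[of "w b" x] by blast
  show ?thesis
  proof (rule ex1I[of _ "(of_int a + w b, h * of_int b)"])
    show "(of_int a + w b, h * of_int b) \<in> S \<and> z \<in> cell h (of_int a + w b, h * of_int b)"
      using a row[of b] by (auto simp: S cell_def z)
    fix v assume v: "v \<in> S \<and> z \<in> cell h v"
    then obtain a' b' where v': "v = (of_int a' + w b', h * of_int b')" by (auto simp: S)
    have "b' = b" using v row[of b'] by (simp add: v' cell_def z)
    moreover from this have "a' = a" using v uniq[of a'] by (simp add: v' cell_def z)
    ultimately show "v = (of_int a + w b, h * of_int b)" by (simp add: v')
  qed
qed

lemma tri_lattice_eq: "tri_lattice = {of_int a *\<^sub>R (1, 0) + of_int b *\<^sub>R (1/2, sqrt 3 / 2) | a b. True}"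
  unfolding tri_lattice_def by (simp add: mult.commute)

lemma int_lattice_eq: "int_lattice = {of_int a *\<^sub>R (1, 0) + of_int b *\<^sub>R (0, 1) | a b. True}"
  unfolding int_lattice_def by simp

lemma norm_Pair_square: "norm (x, y) ^ 2 = x ^ 2 + y ^ 2" for x y :: real
  by (simp add: norm_Pair)

lemma norm_tri_lattice:
  "norm (of_int a *\<^sub>R (1, 0) + of_int b *\<^sub>R (1/2, sqrt 3 / 2) :: real \<times> real) ^ 2 = of_int (qform 1 a b)"
proof -
  have "of_int a *\<^sub>R (1, 0) + of_int b *\<^sub>R (1/2, sqrt 3 / 2) = ((of_int a + of_int b / 2, of_int b * (sqrt 3 / 2)) :: real \<times> real)"
    by simp
  moreover have "(of_int a + of_int b / 2) ^ 2 + (of_int b * (sqrt 3 / 2)) ^ 2 = (of_int (qform 1 a b) :: real)"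
    by (simp add: qform_def power_mult_distrib power_divide) (simp add: power2_eq_square field_simps)
  ultimately show ?thesis by (simp only: norm_Pair_square)
qed

lemma norm_int_lattice:
  "norm (of_int a *\<^sub>R (1, 0) + of_int b *\<^sub>R (0, 1) :: real \<times> real) ^ 2 = of_int (qform 0 a b)"
  by (simp add: norm_Pair_square qform_def)

text \<open>Here sqrt 3 / 2 is the area of a fundamental cell, so the disc has the area of n
  cells.\<close>

lemma r1_eq: "r1 n = sqrt (sqrt 3 / 2 * real n / pi)"
  by (simp add: r1_def mult.commute)

lemma r2_eq: "r2 n = sqrt (1 * real n / pi)"
  by (simp add: r2_def)

theorem mainTheorem3:
  shows "(\<lambda>n::nat. real (card (D1 n)) - real n) \<in> o(\<lambda>n. real n)
    \<and> (\<lambda>n::nat. real (card (D2 n)) - real n) \<in> o(\<lambda>n. real n)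
    \<and> (\<lambda>n::nat. real (k1 n)) \<sim>[at_top]
           (\<lambda>n. tri_const * (2 * sqrt 3 * real n / (pi * sqrt (ln (real n)))))
    \<and> (\<lambda>n::nat. real (k2 n)) \<sim>[at_top]
           (\<lambda>n. landau_ramanujan_const * (4 * real n / (pi * sqrt (ln (real n)))))
    \<and> (\<lambda>n::nat. real (k1 n) / real (k2 n) - sqrt 3 / 2 * (tri_const / landau_ramanujan_const))
           \<in> o(\<lambda>_. 1)"
proof (intro conjI)
  have s3: "0 < sqrt 3 / (2::real)" "sqrt 3 / 2 \<le> (1::real)"
    using real_sqrt_le_mono[of 3 4] by auto
  show "(\<lambda>n::nat. real (card (D1 n)) - real n) \<in> o(\<lambda>n. real n)"
    unfolding D1_def r1_eq
    by (intro brick_tiling_count_asymp s3 brick_tiling[where w = "\<lambda>b. 1 / 2 * of_int b"]) (simp add: tri_lattice_def)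
  show "(\<lambda>n::nat. real (card (D2 n)) - real n) \<in> o(\<lambda>n. real n)"
    unfolding D2_def r2_eq
    by (intro brick_tiling_count_asymp brick_tiling[where w = "\<lambda>b. 0"]) (simp_all add: int_lattice_def)
  have c1: "tri_const > 0"
    using prime_product_tendsto(2)[of "\<lambda>p. p mod 3 = 2"] unfolding tri_const_def by simp
  note c2 = landau_ramanujan_pos
  have k1: "(\<lambda>n. real (k1 n) * sqrt (ln (real n)) / real n) \<longlonglongrightarrow> 4 * (sqrt 3 / 2) / pi * tri_const"
    unfolding k1_def D1_def r1_eq
    by (rule num_distances_asymp[OF norm_tri_lattice tri_lattice_eq s3(1) loeschian_count])
  have k2: "(\<lambda>n. real (k2 n) * sqrt (ln (real n)) / real n) \<longlonglongrightarrow> 4 * 1 / pi * landau_ramanujan_const"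
    unfolding k2_def D2_def r2_eq
    by (rule num_distances_asymp[OF norm_int_lattice int_lattice_eq _ landau_ramanujan]) simp
  \<comment> \<open>Applied with d equal to four times the cell area: 2 sqrt 3 and 4.\<close>
  have equiv: "(\<lambda>n. real (k n)) \<sim>[at_top] (\<lambda>n. c * (d * real n / (pi * sqrt (ln (real n)))))"
    if lim: "(\<lambda>n. real (k n) * sqrt (ln (real n)) / real n) \<longlonglongrightarrow> d / pi * c" and "c > 0" "d > 0"
    for k :: "nat \<Rightarrow> nat" and c d :: real
  proof (rule asymp_equivI')
    have "(\<lambda>n. (real (k n) * sqrt (ln (real n)) / real n) / (d / pi * c)) \<longlonglongrightarrow> (d / pi * c) / (d / pi * c)"
      using that by (intro tendsto_divide lim tendsto_const) auto
    moreover have "(d / pi * c) / (d / pi * c) = 1" using that by simp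
    moreover have "(real (k n) * sqrt (ln (real n)) / real n) / (d / pi * c) = real (k n) / (c * (d * real n / (pi * sqrt (ln (real n)))))" for n
      by (simp add: mult_ac)
    ultimately show "(\<lambda>n. real (k n) / (c * (d * real n / (pi * sqrt (ln (real n)))))) \<longlonglongrightarrow> 1" by simp
  qed
  show "(\<lambda>n::nat. real (k1 n)) \<sim>[at_top] (\<lambda>n. tri_const * (2 * sqrt 3 * real n / (pi * sqrt (ln (real n)))))"
    using k1 c1 by (intro equiv) auto
  show "(\<lambda>n::nat. real (k2 n)) \<sim>[at_top] (\<lambda>n. landau_ramanujan_const * (4 * real n / (pi * sqrt (ln (real n)))))"
    using k2 c2 by (intro equiv) auto
  show "(\<lambda>n::nat. real (k1 n) / real (k2 n) - sqrt 3 / 2 * (tri_const / landau_ramanujan_const)) \<in> o(\<lambda>_. 1)"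
  proof (rule smalloI_tendsto)
    have "(\<lambda>n. (real (k1 n) * sqrt (ln (real n)) / real n) / (real (k2 n) * sqrt (ln (real n)) / real n))
      \<longlonglongrightarrow> (4 * (sqrt 3 / 2) / pi * tri_const) / (4 * 1 / pi * landau_ramanujan_const)"
      using c2 by (intro tendsto_divide k1 k2) auto
    also have "(4 * (sqrt 3 / 2) / pi * tri_const) / (4 * 1 / pi * landau_ramanujan_const)
      = sqrt 3 / 2 * (tri_const / landau_ramanujan_const)" by simp
    finally have "(\<lambda>n. real (k1 n) / real (k2 n)) \<longlonglongrightarrow> sqrt 3 / 2 * (tri_const / landau_ramanujan_const)"
    proof (rule Lim_transform_eventually)
      show "\<forall>\<^sub>F n in sequentially. (real (k1 n) * sqrt (ln (real n)) / real n) / (real (k2 n) * sqrt (ln (real n)) / real n)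
        = real (k1 n) / real (k2 n)"
        using eventually_gt_at_top[of 1]
      proof eventually_elim
        case (elim n)
        hence "sqrt (ln (real n)) > 0" "real n > 0" by auto
        thus ?case by simp
      qed
    qed
    thus "(\<lambda>n. (real (k1 n) / real (k2 n) - sqrt 3 / 2 * (tri_const / landau_ramanujan_const)) / 1) \<longlonglongrightarrow> 0"
      by (simp add: LIM_zero)
  qed simp
qed

end
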